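(* Let $k$ be an algebraically closed field of characteristic $0$, let $J$ be a unital Jordan algebra over $k$, let $n\ge 0$ be an integer, and let $(V,\rho)$ be a nonzero $J$-space of level $n$. Then $V$ is dominant of level $n$ if and only if $$\sum_{\sigma\vdash n+1}\operatorname{sgn}(\sigma)\,|C_\sigma|\,\rho_\sigma(a)=0\qquad\text{in } \operatorname{End}_k(V)$$ for all $a\in J$.
   Context: All vector spaces, algebras and tensor products are over $k$. For $a,b\in J$, $\partial_{a,b}=[L_a,L_b]$, where $L_a(c)=ac$; thus $\partial_{a,b}(c)=a(bc)-b(ac)$. The Lie algebra $\mathfrak{sl}_2(J)$: as a vector space $\mathfrak{sl}_2(J)=(\mathfrak{sl}_2(k)\otimes J)\oplus\{J,J\}$, where $\{J,J\}=(\bigwedge^2J)/\mathrm{Span}\{a\wedge a^2 : a\in J\}$ and $\{a,b\}$ denotes the image of $a\wedge b$. Write $x(a)=x\otimes a$. Let $\kappa$ be one half of the Killing form of $\mathfrak{sl}_2(k)$. The bracket is $[x(a),y(b)]=[x,y](ab)+\kappa(x,y)\{a,b\}$, $[\{a,b\},x(c)]=x(\partial_{a,b}c)$, $[\{a,b\},\{c,d\}]=\{\partial_{a,b}c,d\}+\{c,\partial_{a,b}d\}$. (This is the universal central extension of the Tits-Kantor-Koecher algebra of $J$.) Let $\{e,f,h\}$ be the standard basis of $\mathfrak{sl}_2(k)$: $[h,e]=2e$, $[h,f]=-2f$, $[e,f]=h$. Bounded modules: for an $\mathfrak{sl}_2(J)$-module $M$ and $j\in\mathbb Z$, $M_j=\{m\in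 M: h(1)m=jm\}$. $M$ is bounded of level $n$ if $M=\bigoplus_{-n\le j\le n}M_j$ and $M_n\ne0$. $J$-spaces: a $J$-space is a vector space $V$ with a linear map $\rho:J\to\operatorname{End}_k(V)$ such that $[\rho(a),\rho(a^2)]=0$ and $[[\rho(a),\rho(b)],\rho(c)]=4\rho(\partial_{a,b}c)$ for all $a,b,c\in J$. It is of level $n$ if $\rho(1)=n\,\mathrm{id}$. If $M$ is a bounded $\mathfrak{sl}_2(J)$-module of level $n$, then $M_n$ is a $J$-space of level $n$, with $\rho(a)$ the action of $h(a)$. A $J$-space $V$ of level $n$ is dominant of level $n$ if $V\cong M_n$ as $J$-spaces (that is, by a linear isomorphism commuting with the action of $J$) for some bounded $\mathfrak{sl}_2(J)$-module $M$ of level $n$. Partitions: for a partition $\sigma=(\sigma_1,\dots,\sigma_m)$ of $n+1$, $C_\sigma$ is the conjugacy class of permutations in $S_{n+1}$ of cycle type $\sigma$, $|C_\sigma|$ is its cardinality, $\operatorname{sgn}(\sigma)$ is the common sign of its elements, and $\rho_\sigma(a)=\rho(a^{\sigma_1})\rho(a^{\sigma_2})\cdots\rho(a^{\sigma_m})$. (The operators $\rho(a^i)$, $\rho(a^j)$ commute, so the order of the factors is irrelevant.) *)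

theory Defs
  imports
    "HOL-Library.Function_Algebras"
    "HOL-Library.Poly_Mapping"
    "HOL-Library.Multiset"
    "HOL-Combinatorics.Permutations"
    "HOL-Combinatorics.Orbits"
    "HOL-Computational_Algebra.Polynomial"
begin

section \<open>The Lie algebra of traceless two by two matrices\<close>

datatype sl2_basis = Be | Bf | Bh

lemma UNIV_sl2_basis: "UNIV = {Be, Bf, Bh}"
  using sl2_basis.exhaust by auto

instance sl2_basis :: finite
  by standard (simp add: UNIV_sl2_basis)

text \<open>
  Coordinates with respect to the basis \<open>e, f, h\<close>.  For \<open>'a = 'k\<close> these are the elements of
  \<open>sl2(k)\<close>; for \<open>'a = 'j\<close> they are the elements of \<open>sl2(k) \<otimes> J\<close>, the function \<open>X\<close> standing for
  \<open>e \<otimes> X Be + f \<otimes> X Bf + h \<otimes> X Bh\<close>.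
\<close>
type_synonym 'a sl2 = "sl2_basis \<Rightarrow> 'a"

definition sl2_unit :: "sl2_basis \<Rightarrow> 'k::field sl2" where
  "sl2_unit i = (\<lambda>j. if j = i then 1 else 0)"

text \<open>The bilinear extension of \<open>[h,e] = 2e\<close>, \<open>[h,f] = -2f\<close>, \<open>[e,f] = h\<close>.\<close>
definition sl2_bracket :: "'k::field sl2 \<Rightarrow> 'k sl2 \<Rightarrow> 'k sl2" where
  "sl2_bracket x y = (\<lambda>i. case i of
      Be \<Rightarrow> 2 * (x Bh * y Be - x Be * y Bh)
    | Bf \<Rightarrow> - 2 * (x Bh * y Bf - x Bf * y Bh)
    | Bh \<Rightarrow> x Be * y Bf - x Bf * y Be)"

text \<open>The Killing form: the trace of \<open>ad x \<circ> ad y\<close>.\<close>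
definition sl2_killing :: "'k::field sl2 \<Rightarrow> 'k sl2 \<Rightarrow> 'k" where
  "sl2_killing x y = (\<Sum>i\<in>UNIV. sl2_bracket x (sl2_bracket y (sl2_unit i)) i)"

definition sl2_kappa :: "'k::field sl2 \<Rightarrow> 'k sl2 \<Rightarrow> 'k" where
  "sl2_kappa x y = sl2_killing x y / 2"


section \<open>Free vector spaces\<close>

definition free_scale :: "'k::field \<Rightarrow> ('b \<Rightarrow>\<^sub>0 'k) \<Rightarrow> ('b \<Rightarrow>\<^sub>0 'k)" where
  "free_scale c u = Poly_Mapping.map ((*) c) u"

lemma lookup_free_scale [simp]: "Poly_Mapping.lookup (free_scale c u) x = c * Poly_Mapping.lookup u x"
  by (simp add: free_scale_def map.rep_eq when_def)

text \<open>The linear extension of \<open>f\<close> to the free vector space on \<open>'c\<close>.\<close>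
definition (in vector_space) lin_ext :: "('c \<Rightarrow> 'b) \<Rightarrow> ('c \<Rightarrow>\<^sub>0 'a) \<Rightarrow> 'b" where
  "lin_ext f u = (\<Sum>p\<in>Poly_Mapping.keys u. scale (Poly_Mapping.lookup u p) (f p))"

interpretation free: vector_space free_scale
  by standard (rule poly_mapping_eqI; simp add: lookup_add algebra_simps)+

context vector_space
begin

lemma lin_ext_superset:
  assumes "finite S" "Poly_Mapping.keys u \<subseteq> S"
  shows "lin_ext f u = (\<Sum>p\<in>S. scale (Poly_Mapping.lookup u p) (f p))"
  unfolding lin_ext_def using assms
  by (intro sum.mono_neutral_left) (auto simp: in_keys_iff)

lemma lin_ext_add: "lin_ext f (u + w) = lin_ext f u + lin_ext f w"
proof -
  let ?S = "Poly_Mapping.keys u \<union> Poly_Mapping.keys w"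
  have "Poly_Mapping.keys (u + w) \<subseteq> ?S"
    by (rule Poly_Mapping.keys_add)
  then show ?thesis
    by (simp add: lin_ext_superset[of ?S] lookup_add scale_left_distrib sum.distrib)
qed

lemma lin_ext_scale: "lin_ext f (free_scale r u) = scale r (lin_ext f u)"
proof -
  have "Poly_Mapping.keys (free_scale r u) \<subseteq> Poly_Mapping.keys u"
    by (auto simp: in_keys_iff)
  then show ?thesis
    by (simp add: lin_ext_superset[of "Poly_Mapping.keys u"] scale_sum_right)
qed

lemma linear_lin_ext: "Vector_Spaces.linear free_scale scale (lin_ext f)"
  unfolding Vector_Spaces.linear_def module_hom_def module_hom_axioms_def
  using lin_ext_add lin_ext_scale
  by (auto simp: free.vector_space_axioms vector_space_axioms module_axioms free.module_axioms)

lemma lin_ext_single [simp]: "lin_ext f (Poly_Mapping.single p 1) = f p"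
  by (simp add: lin_ext_def)

end


section \<open>Unital Jordan algebras\<close>

type_synonym ('k, 'j) jj = "('j \<times> 'j \<Rightarrow>\<^sub>0 'k) set"
type_synonym ('k, 'j) sl2J = "'j sl2 \<times> ('k, 'j) jj"

definition op_comm :: "('v::ab_group_add \<Rightarrow> 'v) \<Rightarrow> ('v \<Rightarrow> 'v) \<Rightarrow> 'v \<Rightarrow> 'v" where
  "op_comm f g = (\<lambda>v. f (g v) - g (f v))"

locale jordan_algebra = vector_space scale
  for scale :: "'k::field_char_0 \<Rightarrow> 'j::ab_group_add \<Rightarrow> 'j" +
  fixes mult :: "'j \<Rightarrow> 'j \<Rightarrow> 'j"
    and one :: 'j
  assumes mult_add_left: "mult (a + b) c = mult a c + mult b c"
    and mult_scale_left: "mult (scale r a) c = scale r (mult a c)"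
    and mult_commute: "mult a b = mult b a"
    and jordan_identity: "mult (mult a b) (mult a a) = mult a (mult b (mult a a))"
    and mult_one_left: "mult one a = a"
begin

primrec jpow :: "'j \<Rightarrow> nat \<Rightarrow> 'j" where
  "jpow a 0 = one"
| "jpow a (Suc n) = mult a (jpow a n)"

definition der :: "'j \<Rightarrow> 'j \<Rightarrow> 'j \<Rightarrow> 'j" where
  "der a b c = mult a (mult b c) - mult b (mult a c)"


subsection \<open>The space \<open>{J,J}\<close>\<close>

text \<open>
  \<open>{J,J}\<close> is the quotient of the free vector space on \<open>J \<times> J\<close> by the span of the relations of
  bilinearity, of \<open>a \<and> a = 0\<close> (these two give the exterior square) and of \<open>a \<and> a\<^sup>2 = 0\<close>.
  Its elements are the cosets.
\<close>
abbreviation fgen :: "'j \<Rightarrow> 'j \<Rightarrow> ('j \<times> 'j \<Rightarrow>\<^sub>0 'k)" where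
  "fgen a b \<equiv> Poly_Mapping.single (a, b) 1"

inductive_set jj_relators :: "('j \<times> 'j \<Rightarrow>\<^sub>0 'k) set" where
  "fgen (a + a') b - fgen a b - fgen a' b \<in> jj_relators"
| "fgen a (b + b') - fgen a b - fgen a b' \<in> jj_relators"
| "fgen (scale r a) b - free_scale r (fgen a b) \<in> jj_relators"
| "fgen a (scale r b) - free_scale r (fgen a b) \<in> jj_relators"
| "fgen a a \<in> jj_relators"
| "fgen a (mult a a) \<in> jj_relators"

definition jj_class :: "('j \<times> 'j \<Rightarrow>\<^sub>0 'k) \<Rightarrow> ('k, 'j) jj" where
  "jj_class u = {w. w - u \<in> free.span jj_relators}"

definition jj_carrier :: "('k, 'j) jj set" where
  "jj_carrier = range jj_class"

definition jj_rep :: "('k, 'j) jj \<Rightarrow> ('j \<times> 'j \<Rightarrow>\<^sub>0 'k)" where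
  "jj_rep C = (SOME u. u \<in> C)"

definition jj_add :: "('k, 'j) jj \<Rightarrow> ('k, 'j) jj \<Rightarrow> ('k, 'j) jj" where
  "jj_add C D = jj_class (jj_rep C + jj_rep D)"

definition jj_scale :: "'k \<Rightarrow> ('k, 'j) jj \<Rightarrow> ('k, 'j) jj" where
  "jj_scale r C = jj_class (free_scale r (jj_rep C))"

definition brace :: "'j \<Rightarrow> 'j \<Rightarrow> ('k, 'j) jj" where
  "brace a b = jj_class (fgen a b)"

text \<open>The linear extension of \<open>{a,b} \<mapsto> \<partial>\<^bsub>a,b\<^esub>\<close>.\<close>
definition jj_der :: "('k, 'j) jj \<Rightarrow> 'j \<Rightarrow> 'j" where
  "jj_der C c = lin_ext (\<lambda>(a, b). der a b c) (jj_rep C)"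

text \<open>The bilinear extension of \<open>[{a,b},{c,d}] = {\<partial>\<^bsub>a,b\<^esub> c, d} + {c, \<partial>\<^bsub>a,b\<^esub> d}\<close>.\<close>
definition jj_bracket :: "('k, 'j) jj \<Rightarrow> ('k, 'j) jj \<Rightarrow> ('k, 'j) jj" where
  "jj_bracket C D = jj_class
     (free.lin_ext (\<lambda>(c, d). fgen (jj_der C c) d + fgen c (jj_der C d)) (jj_rep D))"


subsection \<open>The Lie algebra \<open>sl2(J)\<close>\<close>

text \<open>The carrier is \<open>(sl2(k) \<otimes> J) \<oplus> {J,J}\<close>.\<close>

definition sl2J_carrier :: "('k, 'j) sl2J set" where
  "sl2J_carrier = UNIV \<times> jj_carrier"

definition sl2J_add :: "('k, 'j) sl2J \<Rightarrow> ('k, 'j) sl2J \<Rightarrow> ('k, 'j) sl2J" where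
  "sl2J_add u v = (\<lambda>i. fst u i + fst v i, jj_add (snd u) (snd v))"

definition sl2J_scale :: "'k \<Rightarrow> ('k, 'j) sl2J \<Rightarrow> ('k, 'j) sl2J" where
  "sl2J_scale r u = (\<lambda>i. scale r (fst u i), jj_scale r (snd u))"

text \<open>The pure tensor \<open>x(a) = x \<otimes> a\<close> and the element \<open>{a,b}\<close> of \<open>sl2(J)\<close>.\<close>

definition tens :: "'k sl2 \<Rightarrow> 'j \<Rightarrow> ('k, 'j) sl2J" where
  "tens x a = (\<lambda>i. scale (x i) a, jj_class 0)"

definition sl2J_brace :: "'j \<Rightarrow> 'j \<Rightarrow> ('k, 'j) sl2J" where
  "sl2J_brace a b = (\<lambda>i. 0, brace a b)"

text \<open>
  The bracket; \<open>X\<close> is the sum over the basis of the pure tensors \<open>sl2_unit i \<otimes> X i\<close>.  The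
  three formulas that determine it on generators are \<open>bracket_tens_tens\<close>, \<open>bracket_brace_tens\<close>
  and \<open>bracket_brace_brace\<close> below.
\<close>
definition sl2J_bracket :: "('k, 'j) sl2J \<Rightarrow> ('k, 'j) sl2J \<Rightarrow> ('k, 'j) sl2J" where
  "sl2J_bracket u v =
     (case u of (X, C) \<Rightarrow> case v of (Y, D) \<Rightarrow>
       (\<lambda>l. (\<Sum>i\<in>UNIV. \<Sum>j\<in>UNIV.
               scale (sl2_bracket (sl2_unit i) (sl2_unit j) l) (mult (X i) (Y j)))
             + jj_der C (Y l) - jj_der D (X l),
        jj_add
          (jj_class (\<Sum>i\<in>UNIV. \<Sum>j\<in>UNIV.
             free_scale (sl2_kappa (sl2_unit i) (sl2_unit j)) (fgen (X i) (Y j))))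
          (jj_bracket C D)))"


subsection \<open>The bracket on generators\<close>

lemma mult_add_right: "mult a (b + c) = mult a b + mult a c"
  by (metis mult_add_left mult_commute)

lemma mult_scale_right: "mult a (scale r b) = scale r (mult a b)"
  by (metis mult_scale_left mult_commute)

lemma linear_mult: "Vector_Spaces.linear scale scale (mult a)"
  unfolding Vector_Spaces.linear_def module_hom_def module_hom_axioms_def
  using vector_space_axioms module_axioms mult_add_right mult_scale_right by blast

lemmas mult_diff_right = module_hom.diff[OF Vector_Spaces.linear.axioms(3)[OF linear_mult]]
lemmas mult_zero_right [simp] = module_hom.zero[OF Vector_Spaces.linear.axioms(3)[OF linear_mult]]

lemma mult_diff_left: "mult (a - b) c = mult a c - mult b c"
  by (metis mult_diff_right mult_commute)

lemma mult_zero_left [simp]: "mult 0 a = 0"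
  by (metis mult_commute mult_zero_right)

lemma der_add: "der a b (c + d) = der a b c + der a b d"
  and der_scale: "der a b (scale r c) = scale r (der a b c)"
  and der_add_1: "der (a + a') b c = der a b c + der a' b c"
  and der_add_2: "der a (b + b') c = der a b c + der a b' c"
  and der_scale_1: "der (scale r a) b c = scale r (der a b c)"
  and der_scale_2: "der a (scale r b) c = scale r (der a b c)"
  and der_self: "der a a c = 0"
  by (simp_all add: der_def mult_add_left mult_add_right mult_scale_left mult_scale_right
        scale_right_diff_distrib)

lemma der_square: "der a (mult a a) c = 0"
  unfolding der_def by (metis jordan_identity mult_commute right_minus_eq)

text \<open>The linearized Jordan identity.\<close>
lemma jordan_linearized:
  "mult a (mult (mult b c) d) + mult b (mult (mult c a) d) + mult c (mult (mult a b) d) =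
   mult (mult b c) (mult a d) + mult (mult c a) (mult b d) + mult (mult a b) (mult c d)"
proof -
  define F where "F x = der x (mult x x) d" for x
  let ?G = "der a (mult b c) d + der b (mult c a) d + der c (mult a b) d"
  have "F (a + b + c) - F (a + b) - F (a + c) - F (b + c) + F a + F b + F c = ?G + ?G"
    by (simp add: F_def der_add_1 der_add_2 mult_add_left mult_add_right mult_commute[of b a]
        mult_commute[of c a] mult_commute[of c b])
  moreover have "F x = 0" for x
    by (simp add: F_def der_square)
  ultimately have "scale 2 ?G = 0"
    by (metis (no_types, lifting) add_0 diff_0_right one_add_one scale_left_distrib scale_one)
  then have "?G = 0"
    by simp
  then show ?thesis
    by (simp add: der_def algebra_simps)
qed

lemma der_mult: "der a d (mult b c) = mult (der a d b) c + mult b (der a d c)"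
proof -
  have "mult a (mult (mult b c) d) + mult b (mult (mult c a) d) + mult c (mult (mult a b) d) =
        mult d (mult (mult b c) a) + mult b (mult (mult c d) a) + mult c (mult (mult d b) a)"
    using jordan_linearized[of a b c d] jordan_linearized[of d b c a]
    by (simp add: mult_commute add_ac)
  then have "mult a (mult d (mult b c)) - mult d (mult a (mult b c)) =
     (mult b (mult a (mult d c)) - mult b (mult d (mult a c))) +
     (mult c (mult a (mult d b)) - mult c (mult d (mult a b)))"
    by (simp add: mult_commute[of _ d] mult_commute[of _ a] algebra_simps)
  then show ?thesis
    by (simp add: der_def mult_diff_left mult_diff_right mult_commute[of _ c] algebra_simps)
qed

abbreviation jj_rel :: "('j \<times> 'j \<Rightarrow>\<^sub>0 'k) set" where
  "jj_rel \<equiv> free.span jj_relators"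

lemma jj_class_eq_iff: "jj_class u = jj_class w \<longleftrightarrow> u - w \<in> jj_rel"
proof
  assume "jj_class u = jj_class w"
  moreover have "u \<in> jj_class u"
    by (simp add: jj_class_def free.span_zero)
  ultimately show "u - w \<in> jj_rel"
    by (simp add: jj_class_def)
next
  assume *: "u - w \<in> jj_rel"
  show "jj_class u = jj_class w"
    unfolding jj_class_def
  proof (intro Collect_cong iffI)
    fix x assume "x - u \<in> jj_rel"
    from free.span_add[OF this *] show "x - w \<in> jj_rel" by simp
  next
    fix x assume "x - w \<in> jj_rel"
    from free.span_diff[OF this *] show "x - u \<in> jj_rel" by simp
  qed
qed

lemma jj_class_rep: "jj_rep (jj_class u) - u \<in> jj_rel"
proof -
  have "u \<in> jj_class u"
    by (simp add: jj_class_def free.span_zero)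
  then have "jj_rep (jj_class u) \<in> jj_class u"
    unfolding jj_rep_def by (rule someI)
  then show ?thesis
    by (simp add: jj_class_def)
qed

lemma jj_add_class: "jj_add (jj_class u) (jj_class w) = jj_class (u + w)"
  unfolding jj_add_def jj_class_eq_iff
  using free.span_add[OF jj_class_rep[of u] jj_class_rep[of w]] by (simp add: algebra_simps)

lemma jj_scale_class: "jj_scale r (jj_class u) = jj_class (free_scale r u)"
  unfolding jj_scale_def jj_class_eq_iff
  using free.span_scale[OF jj_class_rep[of u], of r]
  by (simp add: free.scale_right_diff_distrib)

lemma jj_relatorsI:
  "fgen (a + a') b - fgen a b - fgen a' b \<in> jj_rel"
  "fgen a (b + b') - fgen a b - fgen a b' \<in> jj_rel"
  "fgen (scale r a) b - free_scale r (fgen a b) \<in> jj_rel"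
  "fgen a (scale r b) - free_scale r (fgen a b) \<in> jj_rel"
  "fgen a a \<in> jj_rel"
  "fgen a (mult a a) \<in> jj_rel"
  by (rule free.span_base, rule jj_relators.intros)+

lemma brace_add_left: "brace (a + a') b = jj_add (brace a b) (brace a' b)"
  and brace_add_right: "brace a (b + b') = jj_add (brace a b) (brace a b')"
  and brace_scale_left: "brace (scale r a) b = jj_scale r (brace a b)"
  and brace_scale_right: "brace a (scale r b) = jj_scale r (brace a b)"
  and brace_self: "brace a a = jj_class 0"
  and brace_square: "brace a (mult a a) = jj_class 0"
  using jj_relatorsI
  by (simp_all add: brace_def jj_add_class jj_scale_class jj_class_eq_iff diff_diff_eq)

lemma linear_vanish_jj_rel:
  assumes "vector_space s" and "Vector_Spaces.linear free_scale s g"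
    and "\<And>u. u \<in> jj_relators \<Longrightarrow> g u \<in> W" and "module.subspace s W" and "u \<in> jj_rel"
  shows "g u \<in> W"
proof -
  interpret Vector_Spaces.linear free_scale s g by fact
  from assms(5) show ?thesis
  proof (induction rule: free.span_induct_alt)
    case base
    then show ?case using assms(4) by (simp add: vs2.subspace_0)
  next
    case (step c x y)
    then show ?case using assms(3,4) by (simp add: add scale vs2.subspace_add vs2.subspace_scale)
  qed
qed

lemma lin_ext_der_rel:
  assumes "u \<in> jj_rel"
  shows "lin_ext (\<lambda>(a, b). der a b c) u = 0"
proof -
  interpret l: Vector_Spaces.linear free_scale scale "lin_ext (\<lambda>(a, b). der a b c)"
    by (rule linear_lin_ext)
  have "lin_ext (\<lambda>(a, b). der a b c) w \<in> {0}" if "w \<in> jj_relators" for w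
    using that by cases (simp_all add: l.diff l.scale der_add_1 der_add_2 der_scale_1 der_scale_2
        der_self der_square)
  then have "lin_ext (\<lambda>(a, b). der a b c) u \<in> {0}"
    by (rule linear_vanish_jj_rel[OF vector_space_axioms linear_lin_ext _ subspace_single_0 assms])
  then show ?thesis by simp
qed

lemma jj_der_class: "jj_der (jj_class u) c = lin_ext (\<lambda>(a, b). der a b c) u"
proof -
  interpret l: Vector_Spaces.linear free_scale scale "lin_ext (\<lambda>(a, b). der a b c)"
    by (rule linear_lin_ext)
  show ?thesis
    unfolding jj_der_def using lin_ext_der_rel[OF jj_class_rep[of u], of c] by (simp add: l.diff)
qed

lemma jj_der_brace: "jj_der (brace a b) c = der a b c"
  by (simp add: brace_def jj_der_class)

lemma jj_der_0: "jj_der (jj_class 0) c = 0"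
  by (simp add: jj_der_class lin_ext_def)

lemma jj_der_add: "jj_der C (c + d) = jj_der C c + jj_der C d"
  and jj_der_scale: "jj_der C (scale r c) = scale r (jj_der C c)"
  by (simp_all add: jj_der_def lin_ext_def case_prod_beta der_add der_scale scale_right_distrib
        sum.distrib scale_sum_right mult.commute)

lemma mult_sum_right: "mult a (\<Sum>i\<in>S. f i) = (\<Sum>i\<in>S. mult a (f i))"
  by (induction S rule: infinite_finite_induct) (simp_all add: mult_add_right)

lemma mult_sum_left: "mult (\<Sum>i\<in>S. f i) a = (\<Sum>i\<in>S. mult (f i) a)"
  by (simp add: mult_commute[of _ a] mult_sum_right)

lemma jj_der_mult: "jj_der C (mult c d) = mult (jj_der C c) d + mult c (jj_der C d)"
  by (simp add: jj_der_def lin_ext_def case_prod_beta der_mult mult_sum_left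
        mult_sum_right mult_scale_left mult_scale_right scale_right_distrib sum.distrib)

lemma brace_antisym: "jj_class (fgen a b + fgen b a) = jj_class 0"
proof -
  have "jj_class 0 = brace (a + b) (a + b)"
    by (simp only: brace_self)
  also have "\<dots> = jj_add (jj_add (jj_class 0) (brace a b)) (jj_add (brace b a) (jj_class 0))"
    unfolding brace_add_left unfolding brace_add_right unfolding brace_self ..
  also have "\<dots> = jj_class (fgen a b + fgen b a)"
    by (simp only: brace_def jj_add_class add_0_left add_0_right)
  finally show ?thesis by (rule sym)
qed

text \<open>The linearization of \<open>{a, a\<^sup>2} = 0\<close>.\<close>
lemma brace_square_linearized:
  "jj_class (fgen b (mult a a) + fgen a (mult b a + mult a b)) = jj_class 0"
proof -
  define p where "p a b = fgen b (mult a a) + fgen a (mult b a) + fgen a (mult a b)" for a b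
  have pq: "p a b + p b a \<in> jj_rel" for a b
  proof -
    have "jj_class 0 = brace (a + b) (mult (a + b) (a + b))"
      by (simp only: brace_square)
    also have "\<dots> = jj_class (p a b + p b a)"
      unfolding mult_add_left mult_add_right brace_add_left brace_add_right brace_square
      unfolding brace_def jj_add_class p_def by (simp add: add_ac)
    finally show ?thesis by (metis jj_class_eq_iff diff_zero)
  qed
  have p4: "p (scale 2 a) b - free_scale 4 (p a b) \<in> jj_rel"
  proof -
    have "jj_class (p (scale 2 a) b) = jj_class (free_scale 4 (p a b))"
      unfolding p_def mult_scale_left mult_scale_right free.scale_right_distrib
      unfolding jj_add_class[symmetric] brace_def[symmetric] jj_scale_class[symmetric]
      unfolding brace_scale_left brace_scale_right
      unfolding brace_def jj_scale_class jj_add_class by simp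
    then show ?thesis by (simp only: jj_class_eq_iff)
  qed
  have p2: "p b (scale 2 a) - free_scale 2 (p b a) \<in> jj_rel"
  proof -
    have "jj_class (p b (scale 2 a)) = jj_class (free_scale 2 (p b a))"
      unfolding p_def mult_scale_left mult_scale_right free.scale_right_distrib
      unfolding jj_add_class[symmetric] brace_def[symmetric] jj_scale_class[symmetric]
      unfolding brace_scale_left brace_scale_right ..
    then show ?thesis by (simp only: jj_class_eq_iff)
  qed
  have "p (scale 2 a) b + p b (scale 2 a) - (p (scale 2 a) b - free_scale 4 (p a b))
      - (p b (scale 2 a) - free_scale 2 (p b a)) - free_scale 2 (p a b + p b a) \<in> jj_rel"
    by (intro free.span_diff free.span_scale pq p2 p4)
  also have "p (scale 2 a) b + p b (scale 2 a) - (p (scale 2 a) b - free_scale 4 (p a b))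
      - (p b (scale 2 a) - free_scale 2 (p b a)) - free_scale 2 (p a b + p b a)
      = free_scale 2 (p a b)"
    by (rule poly_mapping_eqI) (simp add: lookup_add lookup_minus algebra_simps)
  finally have "free_scale (1 / 2) (free_scale 2 (p a b)) \<in> jj_rel"
    by (rule free.span_scale)
  then have "jj_class (p a b) = jj_class 0"
    by (simp add: jj_class_eq_iff)
  moreover have "jj_class (fgen b (mult a a) + fgen a (mult b a + mult a b)) = jj_class (p a b)"
    unfolding p_def jj_add_class[symmetric] brace_def[symmetric] brace_add_right
    unfolding brace_def jj_add_class by (simp add: add_ac)
  ultimately show ?thesis by simp
qed

definition fder :: "('j \<Rightarrow> 'j) \<Rightarrow> ('j \<times> 'j \<Rightarrow>\<^sub>0 'k) \<Rightarrow> ('j \<times> 'j \<Rightarrow>\<^sub>0 'k)" where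
  "fder D = free.lin_ext (\<lambda>(c, d). fgen (D c) d + fgen c (D d))"

lemma linear_fder: "Vector_Spaces.linear free_scale free_scale (fder D)"
  unfolding fder_def by (rule free.linear_lin_ext)

lemma fder_fgen: "fder D (fgen c d) = fgen (D c) d + fgen c (D d)"
  by (simp add: fder_def)

lemma fder_rel:
  assumes D: "\<And>x y. D (x + y) = D x + D y" "\<And>r x. D (scale r x) = scale r (D x)"
    "\<And>x y. D (mult x y) = mult (D x) y + mult x (D y)"
    and "u \<in> jj_rel"
  shows "fder D u \<in> jj_rel"
proof -
  interpret l: Vector_Spaces.linear free_scale free_scale "fder D"
    by (rule linear_fder)
  have "fder D u \<in> jj_rel" if "u \<in> jj_relators" for u
    using that
  proof cases
    case (1 a a' b)
    have "fder D u = (fgen (D a + D a') b - fgen (D a) b - fgen (D a') b)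
        + (fgen (a + a') (D b) - fgen a (D b) - fgen a' (D b))"
      unfolding 1 l.diff fder_fgen D by (simp only: diff_conv_add_uminus minus_add add_ac)
    then show ?thesis by (simp only: free.span_add jj_relatorsI)
  next
    case (2 a b b')
    have "fder D u = (fgen (D a) (b + b') - fgen (D a) b - fgen (D a) b')
        + (fgen a (D b + D b') - fgen a (D b) - fgen a (D b'))"
      unfolding 2 l.diff fder_fgen D by (simp only: diff_conv_add_uminus minus_add add_ac)
    then show ?thesis by (simp only: free.span_add jj_relatorsI)
  next
    case (3 r a b)
    have "fder D u = (fgen (scale r (D a)) b - free_scale r (fgen (D a) b))
        + (fgen (scale r a) (D b) - free_scale r (fgen a (D b)))"
      unfolding 3 l.diff l.scale fder_fgen D free.scale_right_distrib
      by (simp only: diff_conv_add_uminus minus_add add_ac)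
    then show ?thesis by (simp only: free.span_add jj_relatorsI)
  next
    case (4 a r b)
    have "fder D u = (fgen (D a) (scale r b) - free_scale r (fgen (D a) b))
        + (fgen a (scale r (D b)) - free_scale r (fgen a (D b)))"
      unfolding 4 l.diff l.scale fder_fgen D free.scale_right_distrib
      by (simp only: diff_conv_add_uminus minus_add add_ac)
    then show ?thesis by (simp only: free.span_add jj_relatorsI)
  next
    case (5 a)
    then show ?thesis
      using brace_antisym[of "D a" a] by (simp add: fder_fgen jj_class_eq_iff)
  next
    case (6 a)
    then show ?thesis
      using brace_square_linearized[of "D a" a] by (simp add: fder_fgen D(3) jj_class_eq_iff)
  qed
  then show ?thesis
    by (rule linear_vanish_jj_rel[OF free.vector_space_axioms linear_fder _ free.subspace_span
          assms(4)])
qed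

lemma jj_bracket_class:
  "jj_bracket C (jj_class w) = jj_class (fder (jj_der C) w)"
proof -
  interpret l: Vector_Spaces.linear free_scale free_scale "fder (jj_der C)"
    by (rule linear_fder)
  have "fder (jj_der C) (jj_rep (jj_class w) - w) \<in> jj_rel"
    by (rule fder_rel[OF jj_der_add jj_der_scale jj_der_mult jj_class_rep])
  then show ?thesis
    unfolding jj_bracket_def fder_def[symmetric] jj_class_eq_iff by (simp add: l.diff)
qed

lemma brace_zero: "brace 0 b = jj_class 0" "brace a 0 = jj_class 0"
  using brace_scale_left[of 0 0 b] brace_scale_right[of a 0 0]
  by (simp_all add: jj_scale_class brace_def)

lemma jj_class_sum_cong:
  assumes "\<And>i. i \<in> S \<Longrightarrow> jj_class (f i) = jj_class (g i)"
  shows "jj_class (\<Sum>i\<in>S. f i) = jj_class (\<Sum>i\<in>S. g i)"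
  unfolding jj_class_eq_iff sum_subtractf[symmetric]
  using assms by (intro free.span_sum) (simp add: jj_class_eq_iff)

lemma bracket_brace_brace:
  "sl2J_bracket (sl2J_brace a b) (sl2J_brace c d) =
   sl2J_add (sl2J_brace (der a b c) d) (sl2J_brace c (der a b d))"
proof -
  have *: "jj_der C 0 = 0" for C
    using jj_der_scale[of C 0 0] by simp
  have "jj_class (\<Sum>i\<in>(UNIV :: sl2_basis set). \<Sum>j\<in>(UNIV :: sl2_basis set).
      free_scale (sl2_kappa (sl2_unit i) (sl2_unit j)) (fgen 0 0))
    = jj_class (\<Sum>i\<in>(UNIV :: sl2_basis set). \<Sum>j\<in>(UNIV :: sl2_basis set). 0)"
    by (intro jj_class_sum_cong)
      (metis brace_def brace_zero(1) free.scale_zero_right jj_scale_class)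
  moreover have "jj_bracket (brace a b) (brace c d)
      = jj_add (brace (der a b c) d) (brace c (der a b d))"
    by (simp add: brace_def[of c d] jj_bracket_class fder_fgen jj_der_brace)
      (simp add: brace_def jj_add_class)
  ultimately show ?thesis
    by (simp add: sl2J_bracket_def sl2J_brace_def sl2J_add_def *)
      (simp add: brace_def jj_add_class)
qed

lemma bracket_brace_tens:
  "sl2J_bracket (sl2J_brace a b) (tens x c) = tens x (der a b c)"
proof -
  have "jj_class (\<Sum>i\<in>(UNIV :: sl2_basis set). \<Sum>j\<in>UNIV.
      free_scale (sl2_kappa (sl2_unit i) (sl2_unit j)) (fgen 0 (scale (x j) c)))
    = jj_class (\<Sum>i\<in>(UNIV :: sl2_basis set). \<Sum>j\<in>(UNIV :: sl2_basis set). 0)"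
    by (intro jj_class_sum_cong)
      (metis brace_def brace_zero(1) free.scale_zero_right jj_scale_class)
  moreover have "jj_bracket (brace a b) (jj_class 0) = jj_class 0"
    by (simp add: jj_bracket_class fder_def free.lin_ext_def)
  ultimately show ?thesis
    by (simp add: sl2J_bracket_def sl2J_brace_def tens_def jj_der_brace der_scale jj_der_0
        jj_add_class)
qed

end

lemma sl2_kappa_eq:
  "sl2_kappa x y = (2 * x Be * y Bf + 2 * x Bf * y Be + 4 * x Bh * y Bh :: 'k::field_char_0)"
  by (simp add: sl2_kappa_def sl2_killing_def UNIV_sl2_basis sl2_bracket_def sl2_unit_def
      algebra_simps)

context jordan_algebra
begin

lemma bracket_tens_tens:
  "sl2J_bracket (tens x a) (tens y b) =
   sl2J_add (tens (sl2_bracket x y) (mult a b)) (sl2J_scale (sl2_kappa x y) (sl2J_brace a b))"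
proof -
  have "jj_class (free_scale (sl2_kappa (sl2_unit i) (sl2_unit j))
        (fgen (scale (x i) a) (scale (y j) b)))
    = jj_class (free_scale (sl2_kappa (sl2_unit i) (sl2_unit j) * (x i * y j)) (fgen a b))" for i j
    unfolding jj_scale_class[symmetric] brace_def[symmetric] brace_scale_left brace_scale_right
    unfolding brace_def jj_scale_class by (simp add: mult.commute)
  then have "jj_class (\<Sum>i\<in>UNIV. \<Sum>j\<in>UNIV.
        free_scale (sl2_kappa (sl2_unit i) (sl2_unit j)) (fgen (scale (x i) a) (scale (y j) b)))
    = jj_class (\<Sum>i\<in>UNIV. \<Sum>j\<in>UNIV.
        free_scale (sl2_kappa (sl2_unit i) (sl2_unit j) * (x i * y j)) (fgen a b))"
    by (intro jj_class_sum_cong)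
  also have "(\<Sum>i\<in>UNIV. \<Sum>j\<in>UNIV.
        free_scale (sl2_kappa (sl2_unit i) (sl2_unit j) * (x i * y j)) (fgen a b))
      = free_scale (sl2_kappa x y) (fgen a b)"
    unfolding free.scale_sum_left[symmetric]
    by (simp add: sl2_kappa_eq UNIV_sl2_basis sl2_unit_def algebra_simps)
  finally have 1: "jj_class (\<Sum>i\<in>UNIV. \<Sum>j\<in>UNIV.
        free_scale (sl2_kappa (sl2_unit i) (sl2_unit j)) (fgen (scale (x i) a) (scale (y j) b)))
      = jj_class (free_scale (sl2_kappa x y) (fgen a b))" .
  have 2: "(\<Sum>i\<in>UNIV. \<Sum>j\<in>UNIV. scale (sl2_bracket (sl2_unit i) (sl2_unit j) l)
        (mult (scale (x i) a) (scale (y j) b))) = scale (sl2_bracket x y l) (mult a b)" for l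
    unfolding mult_scale_left mult_scale_right scale_scale scale_sum_left[symmetric]
    by (cases l) (simp_all add: UNIV_sl2_basis sl2_bracket_def sl2_unit_def algebra_simps)
  have 3: "jj_bracket (jj_class 0) (jj_class 0) = jj_class 0"
    by (simp add: jj_bracket_class fder_def free.lin_ext_def)
  show ?thesis
    unfolding sl2J_bracket_def tens_def sl2J_add_def sl2J_scale_def sl2J_brace_def
    by (simp add: 1 2 3 jj_der_0 jj_add_class brace_def jj_scale_class)
qed

subsection \<open>Modules\<close>

text \<open>
  The underlying space of a module is a subspace \<open>M\<close> of a vector space on the type \<open>'m\<close>.
  The action is only constrained on \<open>sl2J_carrier\<close> and \<open>M\<close>.
\<close>
definition sl2J_module ::
  "('k \<Rightarrow> 'm::ab_group_add \<Rightarrow> 'm) \<Rightarrow> 'm set \<Rightarrow>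
   (('k, 'j) sl2J \<Rightarrow> 'm \<Rightarrow> 'm) \<Rightarrow> bool" where
  "sl2J_module smul M act \<longleftrightarrow>
     vector_space smul \<and> module.subspace smul M \<and>
     (\<forall>x\<in>sl2J_carrier. \<forall>m\<in>M. act x m \<in> M) \<and>
     (\<forall>x\<in>sl2J_carrier. \<forall>m\<in>M. \<forall>m'\<in>M. act x (m + m') = act x m + act x m') \<and>
     (\<forall>x\<in>sl2J_carrier. \<forall>m\<in>M. \<forall>r. act x (smul r m) = smul r (act x m)) \<and>
     (\<forall>x\<in>sl2J_carrier. \<forall>y\<in>sl2J_carrier. \<forall>m\<in>M. act (sl2J_add x y) m = act x m + act y m) \<and>
     (\<forall>x\<in>sl2J_carrier. \<forall>m\<in>M. \<forall>r. act (sl2J_scale r x) m = smul r (act x m)) \<and>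
     (\<forall>x\<in>sl2J_carrier. \<forall>y\<in>sl2J_carrier. \<forall>m\<in>M.
        act (sl2J_bracket x y) m = act x (act y m) - act y (act x m))"

definition weight_space ::
  "('k \<Rightarrow> 'm::ab_group_add \<Rightarrow> 'm) \<Rightarrow> 'm set \<Rightarrow>
   (('k, 'j) sl2J \<Rightarrow> 'm \<Rightarrow> 'm) \<Rightarrow> int \<Rightarrow> 'm set" where
  "weight_space smul M act j =
     {m \<in> M. act (tens (sl2_unit Bh) one) m = smul (of_int j) m}"

definition bounded_module ::
  "('k \<Rightarrow> 'm::ab_group_add \<Rightarrow> 'm) \<Rightarrow> 'm set \<Rightarrow>
   (('k, 'j) sl2J \<Rightarrow> 'm \<Rightarrow> 'm) \<Rightarrow> nat \<Rightarrow> bool" where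
  "bounded_module smul M act n \<longleftrightarrow>
     sl2J_module smul M act \<and>
     (\<forall>m\<in>M. \<exists>!c. (\<forall>j\<in>{- int n..int n}. c j \<in> weight_space smul M act j) \<and>
                 (\<forall>j. j \<notin> {- int n..int n} \<longrightarrow> c j = 0) \<and>
                 m = (\<Sum>j\<in>{- int n..int n}. c j)) \<and>
     weight_space smul M act (int n) \<noteq> {0}"

lemma tens_in_carrier: "tens x a \<in> sl2J_carrier"
  and carrier_closed: "sl2J_add u v \<in> sl2J_carrier" "sl2J_scale r u \<in> sl2J_carrier"
    "sl2J_bracket u v \<in> sl2J_carrier"
  by (auto simp: tens_def sl2J_carrier_def jj_carrier_def sl2J_add_def sl2J_scale_def
      sl2J_bracket_def jj_add_def jj_scale_def case_prod_beta)


subsection \<open>\<open>J\<close>-spaces\<close>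

definition J_space ::
  "('k \<Rightarrow> 'v::ab_group_add \<Rightarrow> 'v) \<Rightarrow> ('j \<Rightarrow> 'v \<Rightarrow> 'v) \<Rightarrow> bool" where
  "J_space scaleV \<rho> \<longleftrightarrow>
     vector_space scaleV \<and>
     (\<forall>a. Vector_Spaces.linear scaleV scaleV (\<rho> a)) \<and>
     (\<forall>a b v. \<rho> (a + b) v = \<rho> a v + \<rho> b v) \<and>
     (\<forall>r a v. \<rho> (scale r a) v = scaleV r (\<rho> a v)) \<and>
     (\<forall>a v. op_comm (\<rho> a) (\<rho> (mult a a)) v = 0) \<and>
     (\<forall>a b c v. op_comm (op_comm (\<rho> a) (\<rho> b)) (\<rho> c) v = scaleV 4 (\<rho> (der a b c) v))"

definition J_space_of_level ::
  "('k \<Rightarrow> 'v::ab_group_add \<Rightarrow> 'v) \<Rightarrow> ('j \<Rightarrow> 'v \<Rightarrow> 'v) \<Rightarrow> nat \<Rightarrow> bool" where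
  "J_space_of_level scaleV \<rho> n \<longleftrightarrow>
     J_space scaleV \<rho> \<and> (\<forall>v. \<rho> one v = scaleV (of_nat n) v)"

text \<open>Dominance with respect to the modules whose elements are taken from the type \<open>'m\<close>.\<close>
definition dominant_in ::
  "'m::ab_group_add itself \<Rightarrow>
   ('k \<Rightarrow> 'v::ab_group_add \<Rightarrow> 'v) \<Rightarrow> ('j \<Rightarrow> 'v \<Rightarrow> 'v) \<Rightarrow> nat \<Rightarrow> bool" where
  "dominant_in (_ :: 'm itself) scaleV \<rho> n \<longleftrightarrow>
     (\<exists>(smul :: 'k \<Rightarrow> 'm \<Rightarrow> 'm) M act \<phi>.
        bounded_module smul M act n \<and>
        Vector_Spaces.linear scaleV smul \<phi> \<and>
        bij_betw \<phi> UNIV (weight_space smul M act (int n)) \<and>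
        (\<forall>a v. \<phi> (\<rho> a v) = act (tens (sl2_unit Bh) a) (\<phi> v)))"

text \<open>
  HOL cannot quantify over the type \<open>'m\<close>, so a type large enough is fixed here.  This loses
  nothing: by \<open>dominant_in_imp_dominant\<close> below, a bounded module on any type whatsoever
  witnesses dominance in this sense.
\<close>
definition dominant ::
  "('k \<Rightarrow> 'v::ab_group_add \<Rightarrow> 'v) \<Rightarrow> ('j \<Rightarrow> 'v \<Rightarrow> 'v) \<Rightarrow> nat \<Rightarrow> bool" where
  "dominant = dominant_in TYPE(('k, 'j) sl2J list \<Rightarrow> 'v)"

lemma weights_independent:
  fixes smul :: "'k \<Rightarrow> 'm::ab_group_add \<Rightarrow> 'm"
  assumes mod: "sl2J_module smul M act" and "finite S"
    and "\<And>j. j \<in> S \<Longrightarrow> c j \<in> weight_space smul M act j" and "(\<Sum>j\<in>S. c j) = 0"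
  shows "\<forall>j\<in>S. c j = 0"
proof -
  let ?H = "act (tens (sl2_unit Bh) one)"
  interpret m: vector_space smul
    using mod by (simp add: sl2J_module_def)
  have M: "m.subspace M"
    using mod by (simp add: sl2J_module_def)
  have H: "?H (m + m') = ?H m + ?H m'" "?H (smul r m) = smul r (?H m)"
    if "m \<in> M" "m' \<in> M" for m m' r
    using mod that by (auto simp: sl2J_module_def tens_in_carrier)
  have H0: "?H 0 = 0"
    using H(2)[of 0 0 0] M by (simp add: m.subspace_0)
  have H_sum: "?H (\<Sum>j\<in>T. c j) = (\<Sum>j\<in>T. ?H (c j))"
    if "\<And>j. j \<in> T \<Longrightarrow> c j \<in> M" for T and c :: "int \<Rightarrow> 'm"
    using that by (induction T rule: infinite_finite_induct) (simp_all add: H0 H M m.subspace_sum)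
  show ?thesis
    using assms(2-4)
  proof (induction S arbitrary: c rule: finite_induct)
    case (insert k S)
    have c: "c j \<in> M" "?H (c j) = smul (of_int j) (c j)" if "j \<in> insert k S" for j
      using insert.prems(1)[OF that] by (simp_all add: weight_space_def)
    have "(\<Sum>j\<in>S. smul (of_int (j - k)) (c j)) =
        (\<Sum>j\<in>insert k S. smul (of_int (j - k)) (c j))"
      using insert.hyps by simp
    also have "\<dots> = (\<Sum>j\<in>insert k S. ?H (c j)) - smul (of_int k) (\<Sum>j\<in>insert k S. c j)"
      unfolding m.scale_sum_right sum_subtractf[symmetric]
      by (intro sum.cong) (simp_all add: c m.scale_left_diff_distrib)
    also have "\<dots> = 0"
      using H_sum[of "insert k S" c] c(1) insert.prems(2) H0 by simp
    finally have "(\<Sum>j\<in>S. smul (of_int (j - k)) (c j)) = 0" .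
    moreover have "smul (of_int (j - k)) (c j) \<in> weight_space smul M act j" if "j \<in> S" for j
      using that c[of j] H(2)[of "c j" "c j"] M
      by (simp add: weight_space_def m.subspace_scale mult.commute)
    ultimately have "\<forall>j\<in>S. smul (of_int (j - k)) (c j) = 0"
      by (intro insert.IH)
    then have "\<forall>j\<in>S. c j = 0"
      using insert.hyps(2) by auto
    then show ?case
      using insert.prems(2) insert.hyps by simp
  qed simp
qed

lemma weight_space_subspace:
  assumes "sl2J_module smul M act"
  shows "module.subspace smul (weight_space smul M act j)"
proof -
  interpret m: vector_space smul
    using assms by (simp add: sl2J_module_def)
  have M: "m.subspace M"
    using assms by (simp add: sl2J_module_def)
  have H: "act (tens (sl2_unit Bh) one) (m + m') =
        act (tens (sl2_unit Bh) one) m + act (tens (sl2_unit Bh) one) m'"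
    "act (tens (sl2_unit Bh) one) (smul r m) = smul r (act (tens (sl2_unit Bh) one) m)"
    if "m \<in> M" "m' \<in> M" for m m' r
    using assms that by (auto simp: sl2J_module_def tens_in_carrier)
  have "act (tens (sl2_unit Bh) one) 0 = 0"
    using H(2)[of 0 0 0] M by (simp add: m.subspace_0)
  then show ?thesis
    using M H by (intro m.subspaceI)
      (auto simp: weight_space_def m.subspace_0 m.subspace_add m.subspace_scale
        m.scale_right_distrib m.scale_left_commute)
qed

text \<open>
  The elements of the quotient of \<open>M\<close> by its largest submodule that meets \<open>M\<^sub>n\<close> trivially
  are encoded as functions from words in \<open>sl2(J)\<close> to \<open>V\<close>: an element \<open>m\<close> is sent to the function
  that maps \<open>x\<^sub>1 \<dots> x\<^sub>r\<close> to the component of \<open>x\<^sub>1 \<cdots> x\<^sub>r m\<close> in \<open>M\<^sub>n \<cong> V\<close>.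
\<close>
lemma dominant_in_imp_dominant:
  fixes scaleV :: "'k \<Rightarrow> 'v::ab_group_add \<Rightarrow> 'v"
  assumes "dominant_in TYPE('m::ab_group_add) scaleV \<rho> n"
  shows "dominant scaleV \<rho> n"
proof -
  obtain smul M act and \<phi> :: "'v \<Rightarrow> 'm" where
    bdd: "bounded_module smul M act n" and lin: "Vector_Spaces.linear scaleV smul \<phi>" and
    bij: "bij_betw \<phi> UNIV (weight_space smul M act (int n))" and
    \<phi>: "\<And>a v. \<phi> (\<rho> a v) = act (tens (sl2_unit Bh) a) (\<phi> v)"
    using assms unfolding dominant_in_def by blast
  interpret f: Vector_Spaces.linear scaleV smul \<phi> by fact
  define W where "W = weight_space smul M act"
  let ?I = "{- int n..int n}"
  have mod: "sl2J_module smul M act"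
    using bdd by (simp add: bounded_module_def)
  have M: "f.vs2.subspace M" and
    act_M: "\<And>x m. x \<in> sl2J_carrier \<Longrightarrow> m \<in> M \<Longrightarrow> act x m \<in> M" and
    act_add: "\<And>x m m'. x \<in> sl2J_carrier \<Longrightarrow> m \<in> M \<Longrightarrow> m' \<in> M \<Longrightarrow>
        act x (m + m') = act x m + act x m'" and
    act_scale: "\<And>x m r. x \<in> sl2J_carrier \<Longrightarrow> m \<in> M \<Longrightarrow> act x (smul r m) = smul r (act x m)" and
    add_act: "\<And>x y m. x \<in> sl2J_carrier \<Longrightarrow> y \<in> sl2J_carrier \<Longrightarrow> m \<in> M \<Longrightarrow>
        act (sl2J_add x y) m = act x m + act y m" and
    scale_act: "\<And>x m r. x \<in> sl2J_carrier \<Longrightarrow> m \<in> M \<Longrightarrow>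
        act (sl2J_scale r x) m = smul r (act x m)" and
    bracket_act: "\<And>x y m. x \<in> sl2J_carrier \<Longrightarrow> y \<in> sl2J_carrier \<Longrightarrow> m \<in> M \<Longrightarrow>
        act (sl2J_bracket x y) m = act x (act y m) - act y (act x m)"
    using mod by (simp_all add: sl2J_module_def)
  have W_sub: "f.vs2.subspace (W j)" for j
    unfolding W_def by (rule weight_space_subspace[OF mod])
  have W_M: "m \<in> M" if "m \<in> W j" for m j
    using that by (simp add: W_def weight_space_def)

  define dec where "dec m c \<longleftrightarrow> (\<forall>j\<in>?I. c j \<in> W j) \<and> (\<forall>j. j \<notin> ?I \<longrightarrow> c j = 0) \<and>
      m = (\<Sum>j\<in>?I. c j)" for m c
  have dec_ex1: "\<exists>!c. dec m c" if "m \<in> M" for m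
    using bdd that by (simp add: bounded_module_def dec_def W_def)
  define comp where "comp m = (THE c. dec m c)" for m
  have dec_comp: "dec m (comp m)" if "m \<in> M" for m
    unfolding comp_def using dec_ex1[OF that] by (rule theI')
  have compI: "comp m = c" if "dec m c" "m \<in> M" for m c
    using dec_ex1 dec_comp that by blast
  have comp_W: "comp m j \<in> W j" if "m \<in> M" for m j
    using dec_comp[OF that] f.vs2.subspace_0[OF W_sub] by (cases "j \<in> ?I") (auto simp: dec_def)
  have comp_add: "comp (m + m') = (\<lambda>j. comp m j + comp m' j)" if "m \<in> M" "m' \<in> M" for m m'
    using dec_comp[OF that(1)] dec_comp[OF that(2)] that M W_sub
    by (intro compI) (auto simp: dec_def sum.distrib f.vs2.subspace_add)
  have comp_scale: "comp (smul r m) = (\<lambda>j. smul r (comp m j))" if "m \<in> M" for m r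
    using dec_comp[OF that] that M W_sub
    by (intro compI) (auto simp: dec_def f.vs2.scale_sum_right[symmetric] f.vs2.subspace_scale)
  have comp_top: "comp m (int n) = m" if "m \<in> W (int n)" for m
  proof -
    have "comp m = (\<lambda>j. if j = int n then m else 0)"
      using that W_M[OF that] W_sub by (intro compI) (auto simp: dec_def f.vs2.subspace_0)
    then show ?thesis by simp
  qed

  define pr where "pr m = the_inv_into UNIV \<phi> (comp m (int n))" for m
  have inj: "inj \<phi>" and range: "range \<phi> = W (int n)"
    using bij by (auto simp: bij_betw_def W_def)
  have \<phi>_pr: "\<phi> (pr m) = comp m (int n)" if "m \<in> M" for m
    unfolding pr_def using comp_W[OF that] range inj by (metis f_the_inv_into_f)
  have pr_\<phi>: "pr (\<phi> v) = v" for v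
    unfolding pr_def using range inj comp_top by (metis rangeI the_inv_f_f)
  have pr_add: "pr (m + m') = pr m + pr m'" if "m \<in> M" "m' \<in> M" for m m'
    using that M
    by (intro injD[OF inj]) (simp add: \<phi>_pr f.add comp_add f.vs2.subspace_add)
  have pr_scale: "pr (smul r m) = scaleV r (pr m)" if "m \<in> M" for m r
    using that M
    by (intro injD[OF inj]) (simp add: \<phi>_pr f.scale comp_scale f.vs2.subspace_scale)

  have word_M: "foldr act w m \<in> M" if "set w \<subseteq> sl2J_carrier" "m \<in> M" for w m
    using that by (induction w) (auto intro: act_M)
  have word_add: "foldr act w (m + m') = foldr act w m + foldr act w m'"
    if "set w \<subseteq> sl2J_carrier" "m \<in> M" "m' \<in> M" for w m m'
    using that by (induction w) (auto simp: act_add word_M)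
  have word_scale: "foldr act w (smul r m) = smul r (foldr act w m)"
    if "set w \<subseteq> sl2J_carrier" "m \<in> M" for w m r
    using that by (induction w) (auto simp: act_scale word_M)

  define \<psi> where "\<psi> m = (\<lambda>w. if set w \<subseteq> sl2J_carrier then pr (foldr act w m) else 0)" for m
  define psmul :: "'k \<Rightarrow> (('k, 'j) sl2J list \<Rightarrow> 'v) \<Rightarrow> (('k, 'j) sl2J list \<Rightarrow> 'v)" where
    "psmul r g = (\<lambda>w. scaleV r (g w))" for r g
  define pact :: "('k, 'j) sl2J \<Rightarrow> (('k, 'j) sl2J list \<Rightarrow> 'v) \<Rightarrow> (('k, 'j) sl2J list \<Rightarrow> 'v)" where
    "pact x g = (\<lambda>w. g (w @ [x]))" for x g
  have \<psi>_add: "\<psi> (m + m') = \<psi> m + \<psi> m'" if "m \<in> M" "m' \<in> M" for m m'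
    using that by (auto simp: \<psi>_def fun_eq_iff word_add pr_add word_M)
  have \<psi>_scale: "\<psi> (smul r m) = psmul r (\<psi> m)" if "m \<in> M" for m r
    using that by (auto simp: \<psi>_def psmul_def fun_eq_iff word_scale pr_scale word_M)
  have \<psi>_act: "\<psi> (act x m) = pact x (\<psi> m)" if "x \<in> sl2J_carrier" for m x
    using that by (auto simp: \<psi>_def pact_def fun_eq_iff)
  have \<psi>_Nil: "\<psi> (\<phi> v) [] = v" for v
    by (simp add: \<psi>_def pr_\<phi>)
  interpret p: vector_space psmul
    by standard
      (simp_all add: psmul_def fun_eq_iff f.vs1.scale_right_distrib f.vs1.scale_left_distrib)
  have \<psi>_0: "\<psi> 0 = 0"
    using \<psi>_scale[of 0 0] f.vs2.subspace_0[OF M] by simp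
  have \<psi>_diff: "\<psi> (m - m') = \<psi> m - \<psi> m'" if "m \<in> M" "m' \<in> M" for m m'
    using \<psi>_add[of "m - m'" m'] that f.vs2.subspace_diff[OF M] by (simp add: algebra_simps)
  have \<psi>_sum: "\<psi> (\<Sum>j\<in>T. c j) = (\<Sum>j\<in>T. \<psi> (c j))" if "\<And>j. j \<in> T \<Longrightarrow> c j \<in> M"
    for T and c :: "int \<Rightarrow> 'm"
    using that by (induction T rule: infinite_finite_induct)
      (simp_all add: \<psi>_0 \<psi>_add f.vs2.subspace_sum[OF M])

  have pmod: "sl2J_module psmul (\<psi> ` M) pact"
    unfolding sl2J_module_def ball_simps
  proof (intro conjI ballI allI)
    show "vector_space psmul" ..
    show "p.subspace (\<psi> ` M)"
      using f.vs2.subspace_0[OF M] f.vs2.subspace_add[OF M] f.vs2.subspace_scale[OF M]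
      by (intro p.subspaceI) (auto simp: \<psi>_0[symmetric] \<psi>_add[symmetric] \<psi>_scale[symmetric])
  qed (simp_all add: \<psi>_add[symmetric] \<psi>_scale[symmetric] \<psi>_act[symmetric] \<psi>_diff[symmetric]
      act_M act_add act_scale add_act scale_act bracket_act carrier_closed
      f.vs2.subspace_add[OF M] f.vs2.subspace_scale[OF M] f.vs2.subspace_diff[OF M])
  define W' where "W' = weight_space psmul (\<psi> ` M) pact"
  have \<psi>_W: "\<psi> m \<in> W' j" if "m \<in> W j" for m j
    using that
    by (auto simp: W'_def W_def weight_space_def \<psi>_act[symmetric] \<psi>_scale[symmetric] tens_in_carrier)
  have W'_sub: "p.subspace (W' j)" for j
    unfolding W'_def by (rule weight_space_subspace[OF pmod])
  have dec_unique: "c = c'"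
    if "\<forall>j\<in>?I. c j \<in> W' j" "\<forall>j. j \<notin> ?I \<longrightarrow> c j = 0"
      "\<forall>j\<in>?I. c' j \<in> W' j" "\<forall>j. j \<notin> ?I \<longrightarrow> c' j = 0"
      "(\<Sum>j\<in>?I. c j) = (\<Sum>j\<in>?I. c' j)" for c c'
  proof -
    have "\<forall>j\<in>?I. c j - c' j = 0"
      using that W'_sub unfolding W'_def
      by (intro weights_independent[OF pmod]) (auto simp: sum_subtractf p.subspace_diff)
    then show ?thesis
      using that(2,4) by (metis eq_iff_diff_eq_0 ext)
  qed
  have \<psi>_dec: "(\<forall>j\<in>?I. \<psi> (comp m j) \<in> W' j) \<and> (\<forall>j. j \<notin> ?I \<longrightarrow> \<psi> (comp m j) = 0) \<and>
      \<psi> m = (\<Sum>j\<in>?I. \<psi> (comp m j))" if "m \<in> M" for m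
  proof -
    have "\<psi> (\<Sum>j\<in>?I. comp m j) = (\<Sum>j\<in>?I. \<psi> (comp m j))"
      by (rule \<psi>_sum) (rule W_M[OF comp_W[OF that]])
    moreover have "m = (\<Sum>j\<in>?I. comp m j)" "\<forall>j. j \<notin> ?I \<longrightarrow> comp m j = 0"
      using dec_comp[OF that] by (auto simp: dec_def)
    ultimately show ?thesis
      using comp_W[OF that] \<psi>_W \<psi>_0 by auto
  qed
  have W'_top: "W' (int n) = \<psi> ` W (int n)"
  proof
    show "\<psi> ` W (int n) \<subseteq> W' (int n)"
      using \<psi>_W by auto
    show "W' (int n) \<subseteq> \<psi> ` W (int n)"
    proof
      fix g assume g: "g \<in> W' (int n)"
      then obtain m where m: "m \<in> M" "g = \<psi> m"
        by (auto simp: W'_def weight_space_def)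
      have "(\<lambda>j. if j = int n then g else 0) = (\<lambda>j. \<psi> (comp m j))"
        using \<psi>_dec[OF m(1)] g m(2) W'_sub
        by (intro dec_unique) (auto simp: p.subspace_0)
      then have "g = \<psi> (comp m (int n))"
        by (metis (mono_tags))
      then show "g \<in> \<psi> ` W (int n)"
        using comp_W[OF m(1)] by blast
    qed
  qed
  have "bounded_module psmul (\<psi> ` M) pact n"
    unfolding bounded_module_def
  proof (intro conjI ballI)
    fix g assume "g \<in> \<psi> ` M"
    then obtain m where m: "m \<in> M" "g = \<psi> m"
      by auto
    show "\<exists>!c. (\<forall>j\<in>?I. c j \<in> weight_space psmul (\<psi> ` M) pact j) \<and>
        (\<forall>j. j \<notin> ?I \<longrightarrow> c j = 0) \<and> g = (\<Sum>j\<in>?I. c j)"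
      unfolding W'_def[symmetric]
    proof (rule ex1I)
      show "(\<forall>j\<in>?I. \<psi> (comp m j) \<in> W' j) \<and> (\<forall>j. j \<notin> ?I \<longrightarrow> \<psi> (comp m j) = 0) \<and>
          g = (\<Sum>j\<in>?I. \<psi> (comp m j))"
        using \<psi>_dec[OF m(1)] m(2) by simp
    next
      fix c assume "(\<forall>j\<in>?I. c j \<in> W' j) \<and> (\<forall>j. j \<notin> ?I \<longrightarrow> c j = 0) \<and> g = (\<Sum>j\<in>?I. c j)"
      then show "c = (\<lambda>j. \<psi> (comp m j))"
        using \<psi>_dec[OF m(1)] m(2) by (intro dec_unique) auto
    qed
  next
    have "W (int n) \<noteq> {0}"
      using bdd by (simp add: bounded_module_def W_def)
    then obtain m where "m \<in> W (int n)" "m \<noteq> 0"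
      using f.vs2.subspace_0[OF W_sub[of "int n"]] by blast
    then obtain v where "\<phi> v \<noteq> 0"
      using range by (metis imageE)
    then have "v \<noteq> 0"
      using f.zero by auto
    then have "\<psi> (\<phi> v) \<noteq> 0"
      using \<psi>_Nil[of v] by auto
    moreover have "\<psi> (\<phi> v) \<in> W' (int n)"
      using range \<psi>_W by blast
    ultimately show "weight_space psmul (\<psi> ` M) pact (int n) \<noteq> {0}"
      unfolding W'_def by blast
  qed (fact pmod)
  moreover have \<phi>_M: "\<phi> v \<in> M" for v
    using range W_M by blast
  then have "Vector_Spaces.linear scaleV psmul (\<psi> \<circ> \<phi>)"
    unfolding Vector_Spaces.linear_def module_hom_def module_hom_axioms_def
    using f.vs1.vector_space_axioms f.vs1.module_axioms p.vector_space_axioms p.module_axioms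
    by (simp add: f.add f.scale \<psi>_add \<psi>_scale)
  moreover have "bij_betw (\<psi> \<circ> \<phi>) UNIV (weight_space psmul (\<psi> ` M) pact (int n))"
    unfolding bij_betw_def W'_def[symmetric] W'_top range[symmetric] image_comp
    using \<psi>_Nil by (auto intro!: injI simp: o_def) metis
  moreover have "(\<psi> \<circ> \<phi>) (\<rho> a v) = pact (tens (sl2_unit Bh) a) ((\<psi> \<circ> \<phi>) v)" for a v
    by (simp add: \<phi> \<psi>_act tens_in_carrier)
  ultimately show ?thesis
    unfolding dominant_def dominant_in_def by blast
qed

definition rho_part :: "('j \<Rightarrow> 'v \<Rightarrow> 'v) \<Rightarrow> nat list \<Rightarrow> 'j \<Rightarrow> 'v \<Rightarrow> 'v" where
  "rho_part \<rho> \<sigma> a = foldr (\<circ>) (map (\<lambda>i. \<rho> (jpow a i)) \<sigma>) id"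

end


section \<open>Partitions\<close>

definition partitions :: "nat \<Rightarrow> nat list set" where
  "partitions N = {\<sigma>. sorted_wrt (\<ge>) \<sigma> \<and> 0 \<notin> set \<sigma> \<and> sum_list \<sigma> = N}"

lemma finite_partitions: "finite (partitions N)"
proof (rule finite_subset)
  have "length xs \<le> sum_list xs" if "0 \<notin> set xs" for xs :: "nat list"
    using that by (induction xs) auto
  then show "partitions N \<subseteq> {xs. set xs \<subseteq> {..N} \<and> length xs \<le> N}"
    by (auto simp: partitions_def dest: member_le_sum_list)
qed (simp add: finite_lists_length_le)

definition cycle_type :: "nat set \<Rightarrow> (nat \<Rightarrow> nat) \<Rightarrow> nat multiset" where
  "cycle_type S p = image_mset card (mset_set (orbit p ` S))"

definition conj_class :: "nat list \<Rightarrow> (nat \<Rightarrow> nat) set" where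
  "conj_class \<sigma> =
     {p. p permutes {1..sum_list \<sigma>} \<and> cycle_type {1..sum_list \<sigma>} p = mset \<sigma>}"

definition sgn_part :: "nat list \<Rightarrow> int" where
  "sgn_part \<sigma> = (THE s. sign ` conj_class \<sigma> = {s})"

end

theory Submission
  imports Defs
begin

text \<open>
  Write \<open>e(a), f(a), h(a)\<close> for the pure tensors and \<open>p\<^sub>N\<close> for the elementary symmetric function of
  degree \<open>N\<close>, expressed through the power sums, with \<open>\<rho>(a\<^sup>i)\<close> in place of the \<open>i\<close>-th power sum.
  The sum over partitions of \<open>N\<close> is \<open>N! p\<^sub>N\<close>, and Garland's formula says that
  \<open>e(a)\<^sup>N f(1)\<^sup>N v = N!\<^sup>2 p\<^sub>N v\<close> if \<open>e(J)\<close> kills the vectors \<open>p\<^sub>s v\<close>.  In a bounded module of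
  level \<open>n\<close>, \<open>f(1)\<^sup>n\<^sup>+\<^sup>1\<close> maps \<open>M\<^sub>n\<close> to \<open>M\<^sub>-\<^sub>n\<^sub>-\<^sub>2 = 0\<close>, so \<open>p\<^sub>n\<^sub>+\<^sub>1 = 0\<close> on \<open>M\<^sub>n\<close>.

  Conversely, let \<open>f(J)\<close> act on \<open>V\<close> by zero and let \<open>C\<close> be the module coinduced from
  \<open>f(J) \<oplus> h(J) \<oplus> {J,J}\<close>.  As \<open>e(J)\<close> is abelian, its elements are the symmetric multilinear functions
  \<open>\<phi>(a\<^sub>1,\<dots>,a\<^sub>r) = (e(a\<^sub>1) \<cdots> e(a\<^sub>r) \<phi>)()\<close> with values in \<open>V\<close>.  The elements of \<open>C\<close> on which \<open>f(1)\<close>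
  is nilpotent form a submodule, because \<open>ad f(1)\<close> is nilpotent, and the representation theory of
  \<open>sl2(k)\<close> shows that its weights lie between \<open>-n\<close> and \<open>n\<close>.  It contains \<open>V\<close>, the functions of degree
  zero, if and only if the symmetric function \<open>f(1)\<^sup>n\<^sup>+\<^sup>1 v\<close> of degree \<open>n + 1\<close> vanishes.  By polarization
  this can be tested on the diagonal, where its value at \<open>a\<close> is \<open>(n+1)!\<^sup>2 p\<^sub>n\<^sub>+\<^sub>1 v\<close>.
\<close>

section \<open>Powers in Jordan algebras\<close>

context jordan_algebra
begin

lemma jpow_1 [simp]: "jpow a (Suc 0) = a"
  by (metis jpow.simps mult_commute mult_one_left)

text \<open>Power associativity. The linearized Jordan identity at \<open>a\<close>,
  \<open>a\<close>, \<open>jpow a q\<close> with last argument \<open>jpow a (N - q - 2)\<close>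
  becomes \<open>2 P 1 + P q = 2 P (q + 1) + P 2\<close>, once the induction hypothesis has merged
  all products of total degree below \<open>N\<close>. As \<open>P 1\<close> is the power by
  definition, the case \<open>q = 1\<close> gives \<open>P 2\<close>, and the recurrence gives the
  rest.\<close>

lemma jpow_mult: "mult (jpow a i) (jpow a j) = jpow a (i + j)"
proof (induction "i + j" arbitrary: i j rule: less_induct)
  case (less i j)
  define N where "N = i + j"
  define P where "P q = mult (jpow a q) (jpow a (N - q))" for q
  have IH: "mult (jpow a p) (jpow a q) = jpow a (p + q)" if "p + q < N" for p q
    using less that by (simp add: N_def)
  have sym: "P q = P (N - q)" if "q \<le> N" for q
    using that by (simp add: P_def mult_commute)
  have P0: "P 0 = jpow a N"
    by (simp add: P_def mult_one_left)
  have P1: "P 1 = jpow a N" if "N \<ge> 1"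
    using that by (cases N) (auto simp: P_def simp del: jpow.simps(2), simp)
  have rel: "P 1 + P 1 + P q = P (q + 1) + P (q + 1) + P 2" if "1 \<le> q" "q + 3 \<le> N" for q
  proof -
    define r where "r = N - q - 2"
    have r: "N = q + 2 + r" "r \<ge> 1"
      using that by (simp_all add: r_def)
    define A where "A = jpow a"
    have PA: "P i = mult (A i) (A j)" if "i + j = N" for i j
      using that by (auto simp: P_def A_def)
    have "mult (A 1) (mult (mult (A 1) (A q)) (A r)) + mult (A 1) (mult (mult (A q) (A 1)) (A r))
        + mult (A q) (mult (mult (A 1) (A 1)) (A r)) =
        mult (mult (A 1) (A q)) (mult (A 1) (A r)) + mult (mult (A q) (A 1)) (mult (A 1) (A r))
        + mult (mult (A 1) (A 1)) (mult (A q) (A r))"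
      by (rule jordan_linearized)
    moreover have "mult (A 1) (A q) = A (q + 1)" "mult (A q) (A 1) = A (q + 1)"
      "mult (A 1) (A 1) = A 2" "mult (A 1) (A r) = A (r + 1)" "mult (A q) (A r) = A (q + r)"
      "mult (A (q + 1)) (A r) = A (q + 1 + r)" "mult (A 2) (A r) = A (2 + r)"
      using IH[of 1 q] IH[of q 1] IH[of 1 1] IH[of 1 r] IH[of q r] IH[of "q + 1" r] IH[of 2 r] r that(1)
      by (simp_all add: A_def numeral_2_eq_2 del: jpow.simps(2))
    ultimately show ?thesis
      using PA[of 1 "q + 1 + r"] PA[of q "2 + r"] PA[of "q + 1" "r + 1"] PA[of 2 "q + r"] r
      by (simp only:)
  qed
  have P2: "P 2 = jpow a N" if "N \<ge> 4"
  proof -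
    have "scale 3 (P 2) = scale 3 (P 1)"
    proof -
      have *: "scale 3 x = x + x + x" for x :: 'j
      proof -
        have "scale 3 x = scale (1 + 1 + 1) x" by simp
        also have "\<dots> = x + x + x" by (simp only: scale_left_distrib scale_one)
        finally show ?thesis .
      qed
      show ?thesis
        using rel[of 1] that unfolding * by (simp add: algebra_simps numeral_2_eq_2)
    qed
    then show ?thesis using P1 that by simp
  qed
  have *: "scale 2 x = x + x" for x
    by (metis one_add_one scale_left_distrib scale_one)
  have main: "P q = jpow a N" if "q + 2 \<le> N" "N \<ge> 4" for q
    using that(1)
  proof (induction q)
    case (Suc q)
    show ?case
    proof (cases "q = 0")
      case True
      then show ?thesis using P1 that by simp
    next
      case False
      then have "P 1 + P 1 + P q = P (q + 1) + P (q + 1) + P 2"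
        using Suc.prems by (intro rel) simp_all
      moreover have "P 1 = jpow a N" "P 2 = jpow a N" "P q = jpow a N"
        using P1 P2 Suc that by simp_all
      ultimately have "scale 2 (P (q + 1)) = scale 2 (jpow a N)"
        unfolding * by (simp add: algebra_simps)
      then show ?thesis by simp
    qed
  qed (simp add: P0)
  have "P i = jpow a N"
  proof -
    have "i \<le> N" by (simp add: N_def)
    \<comment> \<open>For \<open>N \<le> 3\<close> the four boundary values exhaust all
      \<open>i \<le> N\<close>, so the recurrence is needed only from \<open>N = 4\<close>
      on.\<close>
    then consider "N \<ge> 4" "i + 2 \<le> N" | "i = 0" | "i = 1" | "i = N" | "i = N - 1" "N \<ge> 1"
      by linarith
    then show ?thesis
    proof cases
      case 1 then show ?thesis using main by simp
    next
      case 4 then show ?thesis using sym[of 0] P0 by simp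
    next
      case 5 then show ?thesis using sym[of 1] P1 by simp
    qed (use P0 P1 \<open>i \<le> N\<close> in auto)
  qed
  then show ?case by (simp add: P_def N_def)
qed

text \<open>
  The linearized identity gives \<open>\<beta>(a\<^sup>i\<^sup>+\<^sup>1, a\<^sup>N\<^sup>-\<^sup>i\<^sup>-\<^sup>1) = \<beta>(a\<^sup>i, a\<^sup>N\<^sup>-\<^sup>i) + \<beta>(a, a\<^sup>N\<^sup>-\<^sup>1)\<close>, so
  \<open>\<beta>(a\<^sup>i, a\<^sup>N\<^sup>-\<^sup>i)\<close> is linear in \<open>i\<close>; it vanishes at \<open>i = N\<close>.
\<close>
lemma alternating_powers_vanish:
  fixes \<beta> :: "'j \<Rightarrow> 'j \<Rightarrow> 'm::ab_group_add" and smul :: "'k \<Rightarrow> 'm \<Rightarrow> 'm"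
  assumes vs: "vector_space smul"
    and addl: "\<And>x y z. \<beta> (x + y) z = \<beta> x z + \<beta> y z"
    and addr: "\<And>x y z. \<beta> x (y + z) = \<beta> x y + \<beta> x z"
    and self: "\<And>x. \<beta> x x = 0"
    and square: "\<And>x. \<beta> x (mult x x) = 0"
  shows "\<beta> (jpow a i) (jpow a j) = 0"
proof -
  interpret m: vector_space smul by fact
  have two: "x = 0" if "x + x = 0" for x :: 'm
    using that by (metis m.scale_eq_0_iff m.scale_left_distrib m.scale_one one_add_one
        zero_neq_numeral)
  have anti: "\<beta> x y = - \<beta> y x" for x y
    using self[of "x + y"] self[of x] self[of y] unfolding eq_neg_iff_add_eq_0 addl addr
    by (simp add: add.commute)
  have lin: "\<beta> x (mult y z) + \<beta> y (mult z x) + \<beta> z (mult x y) = 0" for x y z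
  proof (rule two)
    define B where "B x = \<beta> x (mult x x)" for x
    have "B (x + y + z) - B (x + y) - B (x + z) - B (y + z) + B x + B y + B z =
      (\<beta> x (mult y z) + \<beta> y (mult z x) + \<beta> z (mult x y)) +
      (\<beta> x (mult y z) + \<beta> y (mult z x) + \<beta> z (mult x y))"
      by (simp add: B_def addl addr mult_add_left mult_add_right mult_commute[of y x]
        mult_commute[of z x] mult_commute[of z y])
    moreover have "B x = 0" for x
      by (simp add: B_def square)
    ultimately show "(\<beta> x (mult y z) + \<beta> y (mult z x) + \<beta> z (mult x y)) +
      (\<beta> x (mult y z) + \<beta> y (mult z x) + \<beta> z (mult x y)) = 0"
      by simp
  qed
  have one: "\<beta> x one = 0" for x
    using lin[of x one one] anti[of one x] by (simp add: mult_one_left mult_commute[of x])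
  define N where "N = i + j"
  define g where "g q = \<beta> (jpow a q) (jpow a (N - q))" for q
  have step: "g (Suc q) = g q + g 1" if "Suc q \<le> N" for q
  proof -
    define r where "r = N - Suc q"
    have r: "N - q = Suc r" "N - Suc q = r" "N - 1 = q + r"
      using that by (simp_all add: r_def)
    have "\<beta> (jpow a 1) (mult (jpow a q) (jpow a r)) + \<beta> (jpow a q) (mult (jpow a r) (jpow a 1))
        + \<beta> (jpow a r) (mult (jpow a 1) (jpow a q)) = 0"
      by (rule lin)
    then have "g 1 + g q + \<beta> (jpow a r) (jpow a (Suc q)) = 0"
      unfolding jpow_mult g_def r by (simp del: jpow.simps(2))
    then have "g 1 + g q = \<beta> (jpow a (Suc q)) (jpow a r)"
      unfolding anti[of "jpow a r"] by simp
    then show ?thesis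
      unfolding g_def[of "Suc q"] r by (simp add: add.commute)
  qed
  have lin_g: "g q = smul (of_nat q) (g 1)" if "q \<le> N" for q
    using that
  proof (induction q)
    case 0
    show ?case using one[of "jpow a N"] anti[of one "jpow a N"] by (simp add: g_def)
  next
    case (Suc q)
    then show ?case using step[of q] by (simp add: m.scale_left_distrib add.commute)
  qed
  show ?thesis
  proof (cases "N = 0")
    case True
    then show ?thesis by (simp add: N_def self)
  next
    case False
    have "g N = 0"
      by (simp add: g_def one)
    then have "g 1 = 0"
      using lin_g[of N] False by simp
    then have "g i = 0"
      using lin_g[of i] by (simp add: N_def)
    then show ?thesis by (simp add: g_def N_def)
  qed
qed

end

section \<open>Permutations and Newton's identities\<close>

text \<open>\<open>q\<close> sends \<open>x\<close> to \<open>y\<close> and the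
  \<open>p\<close>-preimage of \<open>y\<close> to \<open>x\<close>: the point \<open>x\<close> is
  inserted just before \<open>y\<close> in its cycle, and the other cycles stay as they are.\<close>

lemma orbit_transpose_comp:
  assumes p: "p permutes S" "finite S" and x: "x \<notin> S" and y: "y \<in> S"
  defines "q \<equiv> transpose x y \<circ> p"
  shows "orbit q x = insert x (orbit p y)"
    and "z \<in> orbit p y \<Longrightarrow> orbit q z = insert x (orbit p y)"
    and "z \<in> S \<Longrightarrow> z \<notin> orbit p y \<Longrightarrow> orbit q z = orbit p z"
proof -
  have perm_p: "permutation p"
    using p by (auto simp: permutation_permutes)
  have perm_q: "permutation q"
    unfolding q_def by (intro permutation_compose permutation_swap_id perm_p)
  have px: "p x = x"
    using p x by (simp add: permutes_not_in)
  have qx: "q x = y"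
    by (simp add: q_def px)
  have q_other: "q z = p z" if "p z \<noteq> x" "p z \<noteq> y" for z
    using that by (simp add: q_def transpose_def)
  have q_y: "q z = x" if "p z = y" for z
    using that by (simp add: q_def)
  have sub: "orbit p y \<subseteq> S"
    using p y by (intro permutes_orbit_subset)
  have yy: "y \<in> orbit p y"
    using perm_p by (rule permutation_self_in_orbit)
  have closed: "q z \<in> insert x (orbit p y)" if "z \<in> insert x (orbit p y)" for z
  proof (cases "z = x \<or> p z = y")
    case True
    then show ?thesis using qx yy q_y by auto
  next
    case False
    then have pz: "p z \<in> orbit p y"
      using that by (auto intro: orbit.step)
    then have "p z \<noteq> x" using sub x by auto
    then show ?thesis using q_other False pz by simp
  qed
  have le: "w \<in> insert x (orbit p y)" if "w \<in> orbit q x" for w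
    using that by induction (use closed in auto)
  have ge: "w \<in> orbit q x" if "w \<in> orbit p y" for w
  proof -
    have y_in: "y \<in> orbit q x"
      using orbit.base[of q x] qx by simp
    from that show ?thesis
    proof induction
      case base
      show ?case
      proof (cases "p y = y")
        case False
        moreover have "p y \<noteq> x"
          using sub orbit.base[of p y] x by auto
        ultimately show ?thesis
          using orbit.step[OF y_in] q_other by metis
      qed (simp add: y_in)
    next
      case (step w)
      show ?case
      proof (cases "p w = y")
        case False
        moreover have "p w \<noteq> x"
          using sub orbit.step[OF step.hyps] x by auto
        ultimately show ?thesis
          using orbit.step[OF step.IH] q_other by metis
      qed (simp add: y_in)
    qed
  qed
  show 1: "orbit q x = insert x (orbit p y)"
    using le ge permutation_self_in_orbit[OF perm_q, of x] by auto
  show "orbit q z = insert x (orbit p y)" if "z \<in> orbit p y"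
    using orbit_cyclic_eq3[OF cyclic_on_orbit'[OF perm_q, of x], of z] that 1 by simp
  show "orbit q z = orbit p z" if z: "z \<in> S" "z \<notin> orbit p y"
  proof (rule orbit_cong)
    show "z \<in> orbit p z"
      using perm_p by (rule permutation_self_in_orbit)
    show "q s = p s" if s: "s \<in> orbit p z" for s
    proof (rule q_other)
      have ps: "p s \<in> orbit p z"
        using s by (rule orbit.step)
      then show "p s \<noteq> x"
        using permutes_orbit_subset[OF p(1) z(1)] x by auto
      show "p s \<noteq> y"
        using ps z(2) permutation_self_in_orbit[OF perm_p] orbit_swap by metis
    qed
  qed
qed

lemma orbits_disjoint:
  assumes "permutation p" "z \<in> orbit p y"
  shows "orbit p z = orbit p y"
  using assms by (meson cyclic_on_orbit' orbit_cyclic_eq3)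

lemma cycle_type_insert_fixed:
  assumes p: "p permutes S" "finite S" and x: "x \<notin> S"
  shows "cycle_type (insert x S) p = add_mset 1 (cycle_type S p)"
proof -
  have ox: "orbit p x = {x}"
    using p x by (simp add: orbit_eq_singleton_iff permutes_not_in)
  have "{x} \<notin> orbit p ` S"
    using permutes_orbit_subset[OF p(1)] x by blast
  then show ?thesis
    unfolding cycle_type_def using p(2) by (simp add: ox)
qed

lemma cycle_type_transpose_comp:
  assumes p: "p permutes S" "finite S" and x: "x \<notin> S" and y: "y \<in> S"
  shows "cycle_type (insert x S) (transpose x y \<circ> p) =
    add_mset (Suc (card (orbit p y))) (cycle_type S p - {#card (orbit p y)#})"
proof -
  let ?q = "transpose x y \<circ> p" and ?O = "orbit p y"
  note orb = orbit_transpose_comp[OF p x y]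
  have perm_p: "permutation p"
    using p by (auto simp: permutation_permutes)
  have sub: "orbit p z \<subseteq> S" if "z \<in> S" for z
    using p that by (intro permutes_orbit_subset)
  have "orbit ?q ` insert x S = insert (insert x ?O) (orbit p ` S - {?O})"
  proof (intro equalityI subsetI)
    fix C assume "C \<in> orbit ?q ` insert x S"
    then obtain z where z: "C = orbit ?q z" "z = x \<or> z \<in> S" by auto
    then consider "z = x" | "z \<in> ?O" | "z \<in> S" "z \<notin> ?O" by auto
    then show "C \<in> insert (insert x ?O) (orbit p ` S - {?O})"
    proof cases
      case 3
      then show ?thesis
        using z orb(3) permutation_self_in_orbit[OF perm_p, of z] by auto
    qed (use z orb in auto)
  next
    fix C assume "C \<in> insert (insert x ?O) (orbit p ` S - {?O})"
    then consider "C = insert x ?O" | z where "C = orbit p z" "z \<in> S" "C \<noteq> ?O" by auto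
    then show "C \<in> orbit ?q ` insert x S"
    proof cases
      case 1
      then show ?thesis using orb(1) by blast
    next
      case 2
      then have "z \<notin> ?O"
        using orbits_disjoint[OF perm_p] by auto
      then show ?thesis using 2 orb(3) by blast
    qed
  qed
  moreover have "insert x ?O \<notin> orbit p ` S - {?O}"
    using sub x by blast
  moreover have "card (insert x ?O) = Suc (card ?O)"
    using sub[OF y] x p(2) by (meson card_insert_disjoint finite_subset subsetD)
  moreover have "mset_set (orbit p ` S - {?O}) = mset_set (orbit p ` S) - {#?O#}"
    using p(2) y by (subst mset_set_Diff) auto
  ultimately show ?thesis
    unfolding cycle_type_def using p(2) y
    by (simp add: image_mset_Diff)
qed

lemma cycle_type_mset_sum:
  fixes g :: "nat \<Rightarrow> 'a::comm_monoid_add"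
  assumes p: "p permutes S" "finite S"
  shows "(\<Sum>y\<in>S. g (card (orbit p y))) = (\<Sum>C\<in>orbit p ` S. \<Sum>y\<in>C. g (card C))"
proof -
  have perm_p: "permutation p"
    using p by (auto simp: permutation_permutes)
  have "(\<Sum>y\<in>S. g (card (orbit p y)))
      = (\<Sum>C\<in>orbit p ` S. \<Sum>y\<in>{y \<in> S. orbit p y = C}. g (card (orbit p y)))"
    using p(2) by (rule sum.image_gen)
  also have "\<dots> = (\<Sum>C\<in>orbit p ` S. \<Sum>y\<in>C. g (card C))"
  proof (rule sum.cong)
    fix C assume "C \<in> orbit p ` S"
    then obtain z where z: "C = orbit p z" "z \<in> S" by auto
    have "{y \<in> S. orbit p y = C} = C"
      using z permutes_orbit_subset[OF p(1) z(2)] permutation_self_in_orbit[OF perm_p]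
        orbits_disjoint[OF perm_p] by auto
    then show "(\<Sum>y\<in>{y \<in> S. orbit p y = C}. g (card (orbit p y))) = (\<Sum>y\<in>C. g (card C))"
      by (intro sum.cong) auto
  qed simp
  finally show ?thesis .
qed

lemma sum_mset_cycle_type:
  assumes p: "p permutes S" "finite S"
  shows "sum_mset (cycle_type S p) = card S"
  using cycle_type_mset_sum[OF assms, of "\<lambda>_. 1 :: nat"]
  by (simp add: cycle_type_def flip: sum_unfold_sum_mset)

lemma cycle_type_nonzero:
  assumes p: "p permutes S" "finite S"
  shows "0 \<notin># cycle_type S p"
proof -
  have "permutation p"
    using p by (auto simp: permutation_permutes)
  then have "finite (orbit p z)" for z
    by (intro finite_orbit permutation_self_in_orbit)
  then show ?thesis
    using p(2) by (auto simp: cycle_type_def orbit_nonempty)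
qed

lemma sign_transpose_comp:
  assumes "permutation p" "x \<noteq> y"
  shows "sign (transpose x y \<circ> p) = - sign p"
  using assms by (simp add: sign_compose permutation_swap_id sign_swap_id)

text \<open>Induction over the points. A new fixed point contributes the factor
  \<open>(- 1) ^ 2\<close>; a point inserted in a cycle of length \<open>c\<close> turns
  \<open>(- 1) ^ Suc c\<close> into its negative, as the transposition does with the sign. Hence the
  sign is constant on conjugacy classes, as \<open>sgn_part\<close> presupposes.\<close>

lemma sign_eq_prod_cycle_type:
  assumes "finite S" "p permutes S"
  shows "sign p = (\<Prod>c\<in>#cycle_type S p. (- 1) ^ Suc c)"
  using assms
proof (induction S arbitrary: p rule: finite_induct)
  case empty
  then show ?case by (simp add: cycle_type_def)
next
  case (insert x S)
  from insert.prems have "p \<in> (\<lambda>(b, p). transpose x b \<circ> p) ` {(b, p). b \<in> insert x S \<and> p \<in> {p. p permutes S}}"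
    using permutes_insert[of x S] by blast
  then obtain b q where q: "q permutes S" "b \<in> insert x S" "p = transpose x b \<circ> q"
    by auto
  show ?case
  proof (cases "b = x")
    case True
    then have "p = q" using q by simp
    then show ?thesis
      using insert q cycle_type_insert_fixed[OF q(1) insert.hyps(1,2)] by simp
  next
    case False
    then have b: "b \<in> S" using q by simp
    have perm_q: "permutation q"
      using q insert.hyps by (auto simp: permutation_permutes)
    define c where "c = card (orbit q b)"
    have "c \<in># cycle_type S q"
      using b insert.hyps by (auto simp: c_def cycle_type_def)
    then obtain A where A: "cycle_type S q = add_mset c A"
      by (metis insert_DiffM)
    have "cycle_type (insert x S) p = add_mset (Suc c) A"
      using cycle_type_transpose_comp[OF q(1) insert.hyps(1,2) b] q(3) A by (simp add: c_def)
    moreover have "sign p = - sign q"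
      using sign_transpose_comp[OF perm_q] False q(3) by metis
    ultimately show ?thesis
      using insert.IH[OF q(1)] A by simp
  qed
qed

section \<open>Alternating sums over the symmetric group and Newton's identities\<close>

locale char_0_space = vector_space scale
  for scale :: "'k::field_char_0 \<Rightarrow> 'v::ab_group_add \<Rightarrow> 'v"
begin

lemma sum_cycle_type:
  assumes "p permutes S" "finite S"
  shows "(\<Sum>y\<in>S. g (card (orbit p y))) = (\<Sum>c\<in>#cycle_type S p. scale (of_nat c) (g c))"
  using cycle_type_mset_sum[OF assms, of g]
  by (simp add: cycle_type_def sum_constant_scale image_mset.compositionality o_def
      flip: sum_unfold_sum_mset)

text \<open>\<open>w\<close> is an arbitrary vector-valued function of the cycle type and not a
  product of scalars, because it will be a product of commuting operators applied to a fixed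
  vector.\<close>

definition alt_sum :: "nat set \<Rightarrow> (nat multiset \<Rightarrow> 'v) \<Rightarrow> 'v" where
  "alt_sum S w = (\<Sum>p | p permutes S. scale (of_int (sign p)) (w (cycle_type S p)))"

text \<open>
  A permutation of \<open>insert x S\<close> arises from one of \<open>S\<close> by adding the fixed point \<open>x\<close>, or by
  inserting \<open>x\<close> in one of the \<open>c\<close> places of a cycle of length \<open>c\<close>, which changes the sign.
\<close>
definition add_point :: "(nat multiset \<Rightarrow> 'v) \<Rightarrow> nat multiset \<Rightarrow> 'v" where
  "add_point w \<mu> = w (add_mset 1 \<mu>) -
     (\<Sum>c\<in>#\<mu>. scale (of_nat c) (w (add_mset (Suc c) (\<mu> - {#c#}))))"

lemma alt_sum_insert:
  assumes S: "finite S" "x \<notin> S"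
  shows "alt_sum (insert x S) w = alt_sum S (add_point w)"
proof -
  have "alt_sum (insert x S) w = (\<Sum>b\<in>insert x S. \<Sum>q | q permutes S.
      scale (of_int (sign (transpose x b \<circ> q))) (w (cycle_type (insert x S) (transpose x b \<circ> q))))"
    unfolding alt_sum_def by (rule sum_over_permutations_insert[OF S])
  also have "\<dots> = (\<Sum>q | q permutes S. \<Sum>b\<in>insert x S.
      scale (of_int (sign (transpose x b \<circ> q))) (w (cycle_type (insert x S) (transpose x b \<circ> q))))"
    by (rule sum.swap)
  also have "\<dots> = (\<Sum>q | q permutes S. scale (of_int (sign q)) (add_point w (cycle_type S q)))"
  proof (rule sum.cong)
    fix q assume "q \<in> {q. q permutes S}"
    then have q: "q permutes S" by simp
    then have perm_q: "permutation q"
      using S by (auto simp: permutation_permutes)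
    have sgn: "sign (transpose x y \<circ> q) = - sign q" if "y \<in> S" for y
      using sign_transpose_comp[OF perm_q] that S by metis
    let ?g = "\<lambda>c. w (add_mset (Suc c) (cycle_type S q - {#c#}))"
    have "(\<Sum>b\<in>insert x S. scale (of_int (sign (transpose x b \<circ> q)))
        (w (cycle_type (insert x S) (transpose x b \<circ> q))))
      = scale (of_int (sign q)) (w (add_mset 1 (cycle_type S q)))
        + (\<Sum>b\<in>S. scale (of_int (- sign q)) (?g (card (orbit q b))))"
      using S cycle_type_insert_fixed[OF q S] cycle_type_transpose_comp[OF q S]
      by (simp add: sgn)
    also have "(\<Sum>b\<in>S. scale (of_int (- sign q)) (?g (card (orbit q b))))
        = scale (of_int (- sign q)) (\<Sum>b\<in>S. ?g (card (orbit q b)))"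
      by (simp add: scale_sum_right)
    also have "(\<Sum>b\<in>S. ?g (card (orbit q b))) = (\<Sum>c\<in>#cycle_type S q. scale (of_nat c) (?g c))"
      by (rule sum_cycle_type[OF q S(1)])
    finally show "(\<Sum>b\<in>insert x S. scale (of_int (sign (transpose x b \<circ> q)))
        (w (cycle_type (insert x S) (transpose x b \<circ> q))))
      = scale (of_int (sign q)) (add_point w (cycle_type S q))"
      by (simp only: add_point_def scale_right_diff_distrib of_int_minus scale_minus_left
          diff_conv_add_uminus[symmetric])
  qed simp
  finally show ?thesis by (simp add: alt_sum_def)
qed

text \<open>
  \<open>newton N w\<close> is the \<open>N\<close>-th elementary symmetric function, expressed through the power sums by
  Newton's identities, where \<open>w \<mu>\<close> takes the place of the product of the power sums with degrees
  in \<open>\<mu>\<close>.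
\<close>
fun newton :: "nat \<Rightarrow> (nat multiset \<Rightarrow> 'v) \<Rightarrow> 'v" where
  "newton 0 w = w {#}"
| "newton (Suc N) w = scale (1 / of_nat (Suc N))
     (\<Sum>i\<le>N. scale ((- 1) ^ i) (newton (N - i) (\<lambda>\<mu>. w (add_mset (Suc i) \<mu>))))"

lemma newton_Suc:
  "scale (of_nat (Suc N)) (newton (Suc N) w)
   = (\<Sum>i\<le>N. scale ((- 1) ^ i) (newton (N - i) (\<lambda>\<mu>. w (add_mset (Suc i) \<mu>))))"
  by (simp del: of_nat_Suc)

declare newton.simps(2) [simp del]

lemma newton_linear:
  assumes "module_hom scale scale g"
  shows "newton N (\<lambda>\<mu>. g (w \<mu>)) = g (newton N w)"
proof -
  interpret g: module_hom scale scale g by fact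
  show ?thesis
    by (induction N w rule: newton.induct) (simp_all add: newton.simps(2) g.scale g.sum del: of_nat_Suc)
qed

lemma newton_diff_scale:
  "newton N (\<lambda>\<mu>. w \<mu> - scale r (w' \<mu>)) = newton N w - scale r (newton N w')"
proof (induction N arbitrary: w w' rule: less_induct)
  case (less N)
  show ?case
  proof (cases N)
    case (Suc n)
    have "newton (n - i) (\<lambda>\<mu>. w (add_mset (Suc i) \<mu>) - scale r (w' (add_mset (Suc i) \<mu>)))
      = newton (n - i) (\<lambda>\<mu>. w (add_mset (Suc i) \<mu>)) - scale r (newton (n - i) (\<lambda>\<mu>. w' (add_mset (Suc i) \<mu>)))" for i
      by (rule less) (simp add: Suc)
    then show ?thesis
      unfolding Suc newton.simps(2)
      by (simp add: scale_right_diff_distrib sum_subtractf scale_sum_right mult.commute mult.left_commute)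
  qed simp
qed

text \<open>The new point either leaves the distinguished cycle of length \<open>i\<close> alone or
  enters it at one of \<open>i\<close> places.\<close>

lemma add_point_add_mset:
  "add_point w (add_mset i \<mu>) = add_point (\<lambda>\<mu>. w (add_mset i \<mu>)) \<mu>
     - scale (of_nat i) (w (add_mset (Suc i) \<mu>))"
proof -
  have "(\<Sum>c\<in>#\<mu>. scale (of_nat c) (w (add_mset (Suc c) (add_mset i \<mu> - {#c#}))))
      = (\<Sum>c\<in>#\<mu>. scale (of_nat c) (w (add_mset i (add_mset (Suc c) (\<mu> - {#c#})))))"
    by (intro arg_cong[of _ _ sum_mset] image_mset_cong)
      (simp add: diff_union_swap2 add_mset_commute)
  then show ?thesis
    by (simp add: add_point_def add_mset_commute)
qed

text \<open>Multiply by \<open>N\<close> and expand by Newton's recursion. The induction hypothesis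
  gives terms with coefficient \<open>N - i\<close>, the growth of the distinguished part gives
  terms with coefficient \<open>i\<close>. Together they are \<open>N\<close> times the recursion
  for \<open>Suc N\<close>, and \<open>N\<close> cancels.\<close>

lemma newton_add_point: "newton N (add_point w) = scale (of_nat (Suc N)) (newton (Suc N) w)"
proof (induction N arbitrary: w rule: less_induct)
  case (less N)
  let ?w = "\<lambda>i \<mu>. w (add_mset i \<mu>)"
  show ?case
  proof (cases N)
    case 0
    then show ?thesis by (simp add: add_point_def newton.simps(2))
  next
    case (Suc n)
    have IH: "newton (n - i) (add_point (?w (Suc i)))
        = scale (of_nat (Suc (n - i))) (newton (Suc (n - i)) (?w (Suc i)))" for i
      using less[of "n - i"] Suc by simp
    have "scale (of_nat N) (newton N (add_point w))
        = (\<Sum>i\<le>n. scale ((- 1) ^ i) (newton (n - i) (\<lambda>\<mu>. add_point w (add_mset (Suc i) \<mu>))))"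
      unfolding Suc by (rule newton_Suc)
    also have "\<dots> = (\<Sum>i\<le>n. scale ((- 1) ^ i * of_nat (Suc (n - i))) (newton (Suc (n - i)) (?w (Suc i))))
        - (\<Sum>i\<le>n. scale ((- 1) ^ i * of_nat (Suc i)) (newton (n - i) (?w (Suc (Suc i)))))"
      unfolding add_point_add_mset newton_diff_scale IH
      by (simp add: scale_right_diff_distrib sum_subtractf del: of_nat_Suc)
    \<comment> \<open>Both sums are brought to the range \<open>i \<le> Suc n\<close>: here the
      added term has the factor \<open>of_nat 0\<close>; below, the shift of \<open>i\<close>
      reverses the sign and the new term \<open>i = 0\<close> vanishes.\<close>
    also have "(\<Sum>i\<le>n. scale ((- 1) ^ i * of_nat (Suc (n - i))) (newton (Suc (n - i)) (?w (Suc i))))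
       = (\<Sum>i\<le>Suc n. scale ((- 1) ^ i * of_nat (Suc n - i)) (newton (Suc n - i) (?w (Suc i))))"
      by (simp add: Suc_diff_le del: of_nat_Suc of_nat_diff)
    also have "(\<Sum>i\<le>n. scale ((- 1) ^ i * of_nat (Suc i)) (newton (n - i) (?w (Suc (Suc i)))))
       = - (\<Sum>i\<le>Suc n. scale ((- 1) ^ i * of_nat i) (newton (Suc n - i) (?w (Suc i))))"
      by (subst sum.atMost_Suc_shift) (simp add: sum_negf[symmetric] del: of_nat_Suc)
    also have "(\<Sum>i\<le>Suc n. scale ((- 1) ^ i * of_nat (Suc n - i)) (newton (Suc n - i) (?w (Suc i))))
       - - (\<Sum>i\<le>Suc n. scale ((- 1) ^ i * of_nat i) (newton (Suc n - i) (?w (Suc i))))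
       = (\<Sum>i\<le>Suc n. scale (of_nat N) (scale ((- 1) ^ i) (newton (Suc n - i) (?w (Suc i)))))"
      unfolding diff_minus_eq_add sum.distrib[symmetric]
    proof (rule sum.cong)
      fix i assume "i \<in> {..Suc n}"
      then have "(of_nat N :: 'k) = of_nat (Suc n - i) + of_nat i"
        by (simp add: Suc flip: of_nat_add)
      then show "scale ((- 1) ^ i * of_nat (Suc n - i)) (newton (Suc n - i) (?w (Suc i)))
          + scale ((- 1) ^ i * of_nat i) (newton (Suc n - i) (?w (Suc i)))
        = scale (of_nat N) (scale ((- 1) ^ i) (newton (Suc n - i) (?w (Suc i))))"
        by (simp only: scale_scale scale_left_distrib[symmetric] distrib_right
            mult.commute[of "(- 1) ^ i"])
    qed simp
    also have "\<dots> = scale (of_nat N) (scale (of_nat (Suc N)) (newton (Suc N) w))"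
      unfolding newton_Suc[of N] by (simp only: scale_sum_right Suc)
    finally show ?thesis
      unfolding Suc scale_cancel_left using of_nat_neq_0 by blast
  qed
qed

text \<open>Both sides pass from \<open>N\<close> to \<open>Suc N\<close> through
  \<open>add_point w\<close>; the factors \<open>Suc N\<close> from \<open>newton_add_point\<close>
  build up the factorial.\<close>

lemma alt_sum_eq_newton: "alt_sum {1..N} w = scale (fact N) (newton N w)"
proof (induction N arbitrary: w)
  case 0
  have "{p. p permutes ({} :: nat set)} = {id}" by auto
  then show ?case by (simp add: alt_sum_def cycle_type_def)
next
  case (Suc N)
  have "{1..Suc N} = insert (Suc N) {1..N}" by auto
  then have "alt_sum {1..Suc N} w = alt_sum {1..N} (add_point w)"
    using alt_sum_insert[of "{1..N}" "Suc N" w] by simp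
  then show ?case
    unfolding Suc.IH newton_add_point by (simp add: mult.commute del: of_nat_Suc)
qed

text \<open>The permutations in \<open>alt_sum {1..N} w\<close> are grouped by cycle type. A
  partition is a decreasing list, so it is determined by its multiset and the classes are
  disjoint.\<close>

lemma sum_partitions_eq_newton:
  "(\<Sum>\<sigma>\<in>partitions N. scale (of_int (sgn_part \<sigma>) * of_nat (card (conj_class \<sigma>))) (w (mset \<sigma>)))
   = scale (fact N) (newton N w)"
proof -
  have disj: "\<sigma> = \<tau>" if "\<sigma> \<in> partitions N" "\<tau> \<in> partitions N" "mset \<sigma> = mset \<tau>" for \<sigma> \<tau>
  proof -
    have "sorted (rev \<sigma>)" "sorted (rev \<tau>)"
      using that by (auto simp: partitions_def sorted_wrt_rev)
    then have "rev \<sigma> = rev \<tau>"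
      using that(3) by (metis mset_rev sorted_list_of_multiset_mset sorted_sort_id)
    then show ?thesis by simp
  qed
  have sum: "sum_list \<sigma> = N" if "\<sigma> \<in> partitions N" for \<sigma>
    using that by (simp add: partitions_def)
  have ex: "\<exists>\<sigma>\<in>partitions N. p \<in> conj_class \<sigma>" if p: "p permutes {1..N}" for p
  proof -
    define \<sigma> where "\<sigma> = rev (sorted_list_of_multiset (cycle_type {1..N} p))"
    have \<sigma>: "mset \<sigma> = cycle_type {1..N} p"
      by (simp add: \<sigma>_def)
    have "0 \<notin> set \<sigma>"
      using cycle_type_nonzero[OF p] \<sigma> by (metis finite_atLeastAtMost set_mset_mset)
    moreover have "sum_list \<sigma> = N"
      using sum_mset_cycle_type[OF p] \<sigma> by (metis card_atLeastAtMost diff_Suc_1 finite_atLeastAtMost sum_mset_sum_list)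
    moreover have "sorted_wrt (\<ge>) \<sigma>"
      by (simp add: \<sigma>_def sorted_wrt_rev)
    ultimately show ?thesis
      using p \<sigma> by (auto simp: partitions_def conj_class_def)
  qed
  have "alt_sum {1..N} w = (\<Sum>p\<in>(\<Union>\<sigma>\<in>partitions N. conj_class \<sigma>).
      scale (of_int (sign p)) (w (cycle_type {1..N} p)))"
    unfolding alt_sum_def using ex sum by (intro sum.cong) (auto simp: conj_class_def)
  also have "\<dots> = (\<Sum>\<sigma>\<in>partitions N. \<Sum>p\<in>conj_class \<sigma>.
      scale (of_int (sign p)) (w (cycle_type {1..N} p)))"
  proof (rule sum.UNION_disjoint[OF finite_partitions])
    have "finite (conj_class \<sigma>)" for \<sigma>
      unfolding conj_class_def
      by (rule finite_subset[OF _ finite_permutations[of "{1..sum_list \<sigma>}"]]) auto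
    then show "\<forall>\<sigma>\<in>partitions N. finite (conj_class \<sigma>)" by blast
    show "\<forall>\<sigma>\<in>partitions N. \<forall>\<tau>\<in>partitions N. \<sigma> \<noteq> \<tau> \<longrightarrow> conj_class \<sigma> \<inter> conj_class \<tau> = {}"
      using disj sum by (fastforce simp: conj_class_def)
  qed
  also have "\<dots> = (\<Sum>\<sigma>\<in>partitions N.
      scale (of_int (sgn_part \<sigma>) * of_nat (card (conj_class \<sigma>))) (w (mset \<sigma>)))"
  proof (rule sum.cong)
    fix \<sigma> assume \<sigma>: "\<sigma> \<in> partitions N"
    define s where "s = (\<Prod>c\<in>#mset \<sigma>. (- 1) ^ Suc c :: int)"
    have sgn: "sign p = s" "cycle_type {1..N} p = mset \<sigma>" if "p \<in> conj_class \<sigma>" for p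
      using that sum[OF \<sigma>] sign_eq_prod_cycle_type[of "{1..N}" p]
      by (simp_all add: conj_class_def s_def)
    have "sgn_part \<sigma> = s" if "conj_class \<sigma> \<noteq> {}"
    proof -
      have "sign ` conj_class \<sigma> = {s}"
        using sgn that by auto
      then show ?thesis by (simp add: sgn_part_def)
    qed
    \<comment> \<open>\<open>sgn_part\<close> would be unspecified on an empty class, but there the
      cardinality makes both sides zero.\<close>
    then have *: "of_int s * of_nat (card (conj_class \<sigma>))
        = (of_int (sgn_part \<sigma>) * of_nat (card (conj_class \<sigma>)) :: 'k)"
      by (cases "conj_class \<sigma> = {}") simp_all
    have "(\<Sum>p\<in>conj_class \<sigma>. scale (of_int (sign p)) (w (cycle_type {1..N} p)))
        = (\<Sum>p\<in>conj_class \<sigma>. scale (of_int s) (w (mset \<sigma>)))"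
      by (intro sum.cong) (simp_all only: sgn)
    also have "\<dots> = scale (of_int s * of_nat (card (conj_class \<sigma>))) (w (mset \<sigma>))"
      by (simp add: sum_constant_scale mult.commute)
    finally show "(\<Sum>p\<in>conj_class \<sigma>. scale (of_int (sign p)) (w (cycle_type {1..N} p)))
        = scale (of_int (sgn_part \<sigma>) * of_nat (card (conj_class \<sigma>))) (w (mset \<sigma>))"
      unfolding * .
  qed simp
  finally show ?thesis
    unfolding alt_sum_eq_newton by simp
qed

end

section \<open>Garland's formula\<close>

lemma sum_pairs_atMost:
  fixes g :: "nat \<Rightarrow> nat \<Rightarrow> 'a::comm_monoid_add"
  shows "(\<Sum>i\<le>s. \<Sum>j\<le>s - i. g i j) = (\<Sum>(i, j)\<in>{(i, j). i + j \<le> s}. g i j)"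
  by (subst sum.Sigma) (auto intro!: sum.cong)

lemma sum_pairs_swap:
  fixes g :: "nat \<Rightarrow> nat \<Rightarrow> 'a::comm_monoid_add"
  shows "(\<Sum>i\<le>s. \<Sum>j\<le>s - i. g i j) = (\<Sum>j\<le>s. \<Sum>i\<le>s - j. g i j)"
  unfolding sum_pairs_atMost
  by (rule sum.reindex_bij_witness[of _ "\<lambda>(i, j). (j, i)" "\<lambda>(i, j). (j, i)"]) auto

lemma sum_pairs_diagonal:
  fixes g :: "nat \<Rightarrow> nat \<Rightarrow> 'a::comm_monoid_add"
  shows "(\<Sum>i\<le>s. \<Sum>j\<le>s - i. g i j) = (\<Sum>k\<le>s. \<Sum>i\<le>k. g i (k - i))"
  unfolding sum_pairs_atMost by (rule sum.triangle_reindex_eq)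

text \<open>
  Up to signs, \<open>f i\<close> and \<open>h i\<close> are \<open>f \<otimes> t\<^sup>i\<close> and \<open>h \<otimes> t\<^sup>i\<^sup>+\<^sup>1\<close> in \<open>sl2(k[t])\<close>, and \<open>e\<close> is
  \<open>e \<otimes> t\<close>.  Sequences in \<open>M\<close> are viewed as power series in \<open>u\<close> and \<open>series A\<close> acts as
  \<open>\<Sum>\<^sub>i A i u\<^sup>i\<close>.  With \<open>F = \<Sum>\<^sub>i f i u\<^sup>i\<close> and \<open>H = \<Sum>\<^sub>i h i u\<^sup>i\<close>, the
  relations become \<open>[H, F] = 2 F'\<close> and \<open>[e, F] = H\<close>, and \<open>H p = p'\<close>, \<open>e p = 0\<close>.
\<close>
locale current_sl2_action = vector_space smul
  for smul :: "'k::field_char_0 \<Rightarrow> 'm::ab_group_add \<Rightarrow> 'm" +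
  fixes M :: "'m set" and e :: "'m \<Rightarrow> 'm" and f h :: "nat \<Rightarrow> 'm \<Rightarrow> 'm" and p :: "nat \<Rightarrow> 'm"
  assumes M: "subspace M"
    and closed [simp]: "m \<in> M \<Longrightarrow> e m \<in> M" "m \<in> M \<Longrightarrow> f i m \<in> M" "m \<in> M \<Longrightarrow> h i m \<in> M"
    and add: "m \<in> M \<Longrightarrow> m' \<in> M \<Longrightarrow> e (m + m') = e m + e m'"
      "m \<in> M \<Longrightarrow> m' \<in> M \<Longrightarrow> f i (m + m') = f i m + f i m'"
      "m \<in> M \<Longrightarrow> m' \<in> M \<Longrightarrow> h i (m + m') = h i m + h i m'"
    and scaling: "m \<in> M \<Longrightarrow> e (smul r m) = smul r (e m)"
      "m \<in> M \<Longrightarrow> f i (smul r m) = smul r (f i m)"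
    and e_f: "m \<in> M \<Longrightarrow> e (f i m) = f i (e m) + h i m"
    and h_f: "m \<in> M \<Longrightarrow> h i (f j m) = f j (h i m) + smul 2 (f (Suc (i + j)) m)"
    and f_f: "m \<in> M \<Longrightarrow> f i (f j m) = f j (f i m)"
    and p_closed [simp]: "p s \<in> M"
    and e_p: "e (p s) = 0"
    and newton: "smul (of_nat (Suc s)) (p (Suc s)) = (\<Sum>i\<le>s. h i (p (s - i)))"
begin

lemma in_M [simp]: "0 \<in> M" "m \<in> M \<Longrightarrow> m' \<in> M \<Longrightarrow> m + m' \<in> M" "m \<in> M \<Longrightarrow> smul r m \<in> M"
  "(\<And>i. i \<in> S \<Longrightarrow> g i \<in> M) \<Longrightarrow> sum g S \<in> M"
  using M by (auto simp: subspace_0 subspace_add subspace_scale intro: subspace_sum)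

lemma zero: "e 0 = 0" "f i 0 = 0" "h i 0 = 0"
  using add(1)[of 0 0] add(2)[of 0 0] add(3)[of 0 0] by simp_all

lemma sum_image:
  assumes "\<And>i. i \<in> S \<Longrightarrow> g i \<in> M"
  shows "e (sum g S) = (\<Sum>i\<in>S. e (g i))" "f j (sum g S) = (\<Sum>i\<in>S. f j (g i))"
    "h j (sum g S) = (\<Sum>i\<in>S. h j (g i))"
  using assms by (induction S rule: infinite_finite_induct) (simp_all add: zero add)

lemma scale_2: "smul 2 m = m + m"
  by (metis one_add_one scale_left_distrib scale_one)

definition series :: "(nat \<Rightarrow> 'm \<Rightarrow> 'm) \<Rightarrow> (nat \<Rightarrow> 'm) \<Rightarrow> nat \<Rightarrow> 'm" where
  "series A x s = (\<Sum>i\<le>s. A i (x (s - i)))"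

definition deriv :: "(nat \<Rightarrow> 'm) \<Rightarrow> nat \<Rightarrow> 'm" where
  "deriv x s = smul (of_nat (Suc s)) (x (Suc s))"

definition f' :: "nat \<Rightarrow> 'm \<Rightarrow> 'm" where
  "f' i m = smul (of_nat (Suc i)) (f (Suc i) m)"

lemma series_closed [simp]: "(\<And>s. x s \<in> M) \<Longrightarrow> series f x s \<in> M"
  by (simp add: series_def)

text \<open>Leibniz rule: in each coefficient of the product, the factor \<open>Suc s\<close> splits
  as \<open>i + (Suc s - i)\<close>.\<close>

lemma deriv_series:
  assumes x: "\<And>s. x s \<in> M"
  shows "deriv (series f x) s = series f' x s + series f (deriv x) s"
proof -
  have "deriv (series f x) s = (\<Sum>i\<le>Suc s. smul (of_nat (Suc s)) (f i (x (Suc s - i))))"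
    by (simp only: deriv_def series_def scale_sum_right)
  also have "\<dots> = (\<Sum>i\<le>Suc s. smul (of_nat i) (f i (x (Suc s - i)))
      + smul (of_nat (Suc s - i)) (f i (x (Suc s - i))))"
    by (intro sum.cong) (simp_all flip: scale_left_distrib of_nat_add)
  also have "\<dots> = (\<Sum>i\<le>Suc s. smul (of_nat i) (f i (x (Suc s - i))))
      + (\<Sum>i\<le>Suc s. smul (of_nat (Suc s - i)) (f i (x (Suc s - i))))"
    by (rule sum.distrib)
  also have "(\<Sum>i\<le>Suc s. smul (of_nat i) (f i (x (Suc s - i)))) = series f' x s"
    by (subst sum.atMost_Suc_shift) (simp add: series_def f'_def)
  also have "(\<Sum>i\<le>Suc s. smul (of_nat (Suc s - i)) (f i (x (Suc s - i)))) = series f (deriv x) s"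
    unfolding series_def deriv_def
    by (simp add: scaling x Suc_diff_le del: of_nat_Suc of_nat_diff)
  finally show ?thesis .
qed

lemma series_f_f':
  assumes x: "\<And>s. x s \<in> M"
  shows "series f (series f' x) s = series f' (series f x) s"
proof -
  have "series f (series f' x) s
      = (\<Sum>i\<le>s. \<Sum>j\<le>s - i. smul (of_nat (Suc j)) (f (Suc j) (f i (x (s - i - j)))))"
    unfolding series_def f'_def by (simp add: sum_image x scaling f_f[of _ _ "Suc _"])
  also have "\<dots> = (\<Sum>j\<le>s. \<Sum>i\<le>s - j. smul (of_nat (Suc j)) (f (Suc j) (f i (x (s - j - i)))))"
    by (subst sum_pairs_swap) (simp add: add.commute)
  also have "\<dots> = series f' (series f x) s"
    unfolding series_def f'_def by (simp add: sum_image x scale_sum_right)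
  finally show ?thesis .
qed

text \<open>This is \<open>[H, F] = 2 F'\<close>: the commutator of \<open>h i\<close> and
  \<open>f j\<close> depends only on \<open>k = i + j\<close>, and the \<open>Suc k\<close> pairs
  with that sum produce the coefficient of \<open>F'\<close>.\<close>

lemma series_h_f:
  assumes x: "\<And>s. x s \<in> M"
  shows "series h (series f x) s = series f (series h x) s + smul 2 (series f' x s)"
proof -
  have "series h (series f x) s = (\<Sum>i\<le>s. \<Sum>j\<le>s - i. f j (h i (x (s - i - j))))
      + (\<Sum>i\<le>s. \<Sum>j\<le>s - i. smul 2 (f (Suc (i + j)) (x (s - (i + j)))))"
    unfolding series_def by (simp add: sum_image x h_f sum.distrib)
  also have "(\<Sum>i\<le>s. \<Sum>j\<le>s - i. f j (h i (x (s - i - j)))) = series f (series h x) s"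
    unfolding series_def
    by (subst sum_pairs_swap) (simp add: sum_image x add.commute)
  also have "(\<Sum>i\<le>s. \<Sum>j\<le>s - i. smul 2 (f (Suc (i + j)) (x (s - (i + j)))))
      = smul 2 (series f' x s)"
    unfolding series_def f'_def
    by (subst sum_pairs_diagonal) (simp add: sum_constant_scale scale_sum_right mult.commute
        del: of_nat_Suc)
  finally show ?thesis .
qed

lemma series_e_f:
  assumes x: "\<And>s. x s \<in> M"
  shows "e (series f x s) = series f (\<lambda>s. e (x s)) s + series h x s"
  unfolding series_def by (simp add: sum_image x e_f sum.distrib)

primrec S :: "nat \<Rightarrow> nat \<Rightarrow> 'm" where
  "S 0 = p"
| "S (Suc m) = series f (S m)"

lemma S_closed [simp]: "S m s \<in> M"
  by (induction m arbitrary: s) simp_all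

lemma series_scale: "(\<And>s. x s \<in> M) \<Longrightarrow> series f (\<lambda>s. smul r (x s)) s = smul r (series f x s)"
  by (simp add: series_def scaling scale_sum_right)

lemma series_add:
  "(\<And>s. x s \<in> M) \<Longrightarrow> (\<And>s. y s \<in> M) \<Longrightarrow> series f (\<lambda>s. x s + y s) s = series f x s + series f y s"
  by (simp add: series_def add sum.distrib)

lemma deriv_closed [simp]: "(\<And>s. x s \<in> M) \<Longrightarrow> deriv x s \<in> M"
  by (simp add: deriv_def)

lemma series_f'_closed [simp]: "(\<And>s. x s \<in> M) \<Longrightarrow> series f' x s \<in> M"
  by (simp add: series_def f'_def)

text \<open>Moving \<open>H\<close> through \<open>F^m\<close> gives
  \<open>H F^m p = F^m p' + 2 m F' F^(m-1) p\<close>, and one of the two copies of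
  \<open>m F' F^(m-1) p\<close> completes \<open>F^m p'\<close> to the derivative of
  \<open>F^m p\<close>.\<close>

lemma series_h_S:
  "series h (S m) s = deriv (S m) s + smul (of_nat m) (series f' (S (m - 1)) s)"
proof (induction m arbitrary: s)
  case 0
  show ?case using newton by (simp add: series_def deriv_def)
next
  case (Suc m)
  have *: "smul (of_nat m) (series f (series f' (S (m - 1))) s) = smul (of_nat m) (series f' (S m) s)" for s
  proof (cases m)
    case (Suc k)
    then show ?thesis by (simp add: series_f_f')
  qed simp
  have "series h (S (Suc m)) s = series f (series h (S m)) s + smul 2 (series f' (S m) s)"
    by (simp add: series_h_f)
  also have "series f (series h (S m)) s
     = series f (deriv (S m)) s + smul (of_nat m) (series f' (S m) s)"
    unfolding Suc.IH[abs_def] by (simp only: series_add series_scale S_closed deriv_closed series_f'_closed in_M *)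
  also have "series f (deriv (S m)) s = deriv (S (Suc m)) s - series f' (S m) s"
    by (simp add: deriv_series)
  finally show ?case
    by (simp add: scale_left_distrib scale_2)
qed

text \<open>Induction by \<open>e F = F e + H\<close>: the terms \<open>F (F^m p)'\<close> and
  \<open>F' F^m p\<close>, each with coefficient \<open>Suc m\<close>, add up to a derivative by the
  Leibniz rule, and \<open>series_h_S\<close> supplies one more copy of it.\<close>

lemma e_S_Suc: "e (S (Suc m) s) = smul (of_nat (Suc m)) (deriv (S m) s)"
proof (induction m arbitrary: s)
  case 0
  have "series f (\<lambda>s. 0) s = 0" for s
    by (simp add: series_def zero)
  then show ?case using series_h_S[of 0 s] by (simp add: series_e_f e_p)
next
  case (Suc m)
  have "e (S (Suc (Suc m)) s) = series f (\<lambda>s. e (S (Suc m) s)) s + series h (S (Suc m)) s"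
    by (simp add: series_e_f)
  also have "\<dots> = smul (of_nat (Suc m)) (series f (deriv (S m)) s + series f' (S m) s)
      + deriv (S (Suc m)) s"
    unfolding Suc.IH series_h_S by (simp add: series_scale scale_right_distrib)
  also have "series f (deriv (S m)) s + series f' (S m) s = deriv (S (Suc m)) s"
    by (simp add: deriv_series)
  finally show ?case
    by (simp add: scale_left_distrib scale_2)
qed

lemma e_power_add_scale:
  assumes "m \<in> M"
  shows "(e ^^ k) m \<in> M" "(e ^^ k) (smul r m) = smul r ((e ^^ k) m)"
  using assms by (induction k) (simp_all add: scaling)

text \<open>Each application of \<open>e\<close> removes one factor \<open>F\<close> and takes one
  derivative, which raises the index \<open>s\<close> by one. The factorials collect the exponents
  of \<open>F\<close> and the indices.\<close>

lemma e_power_S: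
  "smul (fact j * fact s) ((e ^^ k) (S (k + j) s)) = smul (fact (k + j) * fact (s + k)) (S j (s + k))"
proof (induction k arbitrary: s)
  case (Suc k)
  have "(e ^^ Suc k) (S (Suc k + j) s)
      = smul (of_nat (Suc (k + j)) * of_nat (Suc s)) ((e ^^ k) (S (k + j) (Suc s)))"
    unfolding funpow_Suc_right o_apply add_Suc e_S_Suc deriv_def
    by (simp add: e_power_add_scale del: of_nat_Suc)
  then have "smul (fact j * fact s) ((e ^^ Suc k) (S (Suc k + j) s))
      = smul (of_nat (Suc (k + j))) (smul (fact j * fact (Suc s)) ((e ^^ k) (S (k + j) (Suc s))))"
    by (simp add: ac_simps)
  also have "\<dots> = smul (fact (Suc k + j) * fact (s + Suc k)) (S j (s + Suc k))"
    unfolding Suc.IH by (simp add: ac_simps)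
  finally show ?case .
qed simp

lemma S_0: "S m 0 = (f 0 ^^ m) (p 0)"
  by (induction m) (simp_all add: series_def)

text \<open>The constant coefficient of \<open>F^N p\<close> is \<open>f(1)^N\<close> applied to
  \<open>p 0\<close>. After \<open>N\<close> steps no \<open>F\<close> is left and the coefficient
  \<open>p N\<close> remains.\<close>

theorem e_power_f_power: "(e ^^ N) ((f 0 ^^ N) (p 0)) = smul (fact N * fact N) (p N)"
  using e_power_S[of 0 0 N] by (simp add: S_0)

end

section \<open>Necessity of the identity\<close>

context jordan_algebra
begin

lemma tens_scale: "sl2J_scale r (tens x a) = tens (\<lambda>i. r * x i) a"
  by (simp add: sl2J_scale_def tens_def jj_scale_class)

lemma sl2J_brace_in_carrier: "sl2J_brace a b \<in> sl2J_carrier"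
  by (auto simp: sl2J_brace_def sl2J_carrier_def jj_carrier_def brace_def)

text \<open>Zero is written as \<open>sl2J_scale 0 u\<close>, so that the module axiom for scalar
  multiples shows at once that it acts by zero.\<close>

lemma sl2J_brace_linear:
  "sl2J_brace (a + a') b = sl2J_add (sl2J_brace a b) (sl2J_brace a' b)"
  "sl2J_brace a (b + b') = sl2J_add (sl2J_brace a b) (sl2J_brace a b')"
  "sl2J_brace a a = sl2J_scale 0 u"
  "sl2J_brace a (mult a a) = sl2J_scale 0 u"
proof -
  have "jj_scale 0 C = jj_class 0" for C
    by (simp add: jj_scale_def)
  then show "sl2J_brace (a + a') b = sl2J_add (sl2J_brace a b) (sl2J_brace a' b)"
    "sl2J_brace a (b + b') = sl2J_add (sl2J_brace a b) (sl2J_brace a b')"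
    "sl2J_brace a a = sl2J_scale 0 u" "sl2J_brace a (mult a a) = sl2J_scale 0 u"
    by (simp_all add: sl2J_brace_def sl2J_add_def sl2J_scale_def brace_add_left brace_add_right
        brace_self brace_square)
qed

end

section \<open>Commutation relations and weights in a module\<close>

locale sl2J_action = jordan_algebra scale mult one
  for scale :: "'k::field_char_0 \<Rightarrow> 'j::ab_group_add \<Rightarrow> 'j" and mult one +
  fixes smul :: "'k \<Rightarrow> 'm::ab_group_add \<Rightarrow> 'm" and M :: "'m set"
    and act :: "('k, 'j) sl2J \<Rightarrow> 'm \<Rightarrow> 'm"
  assumes mod: "sl2J_module smul M act"
begin

sublocale m: vector_space smul
  using mod by (simp add: sl2J_module_def)

lemma M_subspace: "m.subspace M"
  using mod by (simp add: sl2J_module_def)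

lemma M_closed [simp]: "0 \<in> M" "m \<in> M \<Longrightarrow> m' \<in> M \<Longrightarrow> m + m' \<in> M"
  "m \<in> M \<Longrightarrow> m' \<in> M \<Longrightarrow> m - m' \<in> M" "m \<in> M \<Longrightarrow> smul r m \<in> M"
  using M_subspace by (auto simp: m.subspace_0 m.subspace_add m.subspace_diff m.subspace_scale)

lemma act_M [simp]: "x \<in> sl2J_carrier \<Longrightarrow> m \<in> M \<Longrightarrow> act x m \<in> M"
  and act_add: "x \<in> sl2J_carrier \<Longrightarrow> m \<in> M \<Longrightarrow> m' \<in> M \<Longrightarrow> act x (m + m') = act x m + act x m'"
  and act_scale: "x \<in> sl2J_carrier \<Longrightarrow> m \<in> M \<Longrightarrow> act x (smul r m) = smul r (act x m)"
  and add_act: "x \<in> sl2J_carrier \<Longrightarrow> y \<in> sl2J_carrier \<Longrightarrow> m \<in> M \<Longrightarrow>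
    act (sl2J_add x y) m = act x m + act y m"
  and scale_act: "x \<in> sl2J_carrier \<Longrightarrow> m \<in> M \<Longrightarrow> act (sl2J_scale r x) m = smul r (act x m)"
  and bracket_act: "x \<in> sl2J_carrier \<Longrightarrow> y \<in> sl2J_carrier \<Longrightarrow> m \<in> M \<Longrightarrow>
    act (sl2J_bracket x y) m = act x (act y m) - act y (act x m)"
  using mod by (simp_all add: sl2J_module_def)

lemmas [simp] = tens_in_carrier sl2J_brace_in_carrier carrier_closed

abbreviation E :: "'j \<Rightarrow> 'm \<Rightarrow> 'm" where "E a \<equiv> act (tens (sl2_unit Be) a)"
abbreviation F :: "'j \<Rightarrow> 'm \<Rightarrow> 'm" where "F a \<equiv> act (tens (sl2_unit Bf) a)"
abbreviation H :: "'j \<Rightarrow> 'm \<Rightarrow> 'm" where "H a \<equiv> act (tens (sl2_unit Bh) a)"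

lemma tens_act_scaled: "m \<in> M \<Longrightarrow> act (tens (\<lambda>i. r * x i) a) m = smul r (act (tens x a) m)"
  by (simp add: scale_act flip: tens_scale)

lemma tens_commutator:
  assumes m: "m \<in> M" and z: "sl2_bracket x y = (\<lambda>i. r * z i)"
  shows "act (tens x a) (act (tens y b) m) = act (tens y b) (act (tens x a) m)
    + smul r (act (tens z (mult a b)) m) + smul (sl2_kappa x y) (act (sl2J_brace a b) m)"
  using bracket_act[of "tens x a" "tens y b" m] m
  unfolding bracket_tens_tens z by (simp add: add_act scale_act tens_act_scaled algebra_simps)

text \<open>The coefficient \<open>2\<close> is the value of \<open>sl2_kappa\<close> at
  \<open>e\<close>, \<open>f\<close>.\<close>

lemma EF:
  assumes "m \<in> M"
  shows "E a (F b m) = F b (E a m) + H (mult a b) m + smul 2 (act (sl2J_brace a b) m)"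
  using tens_commutator[OF assms, of "sl2_unit Be" "sl2_unit Bf" 1 "sl2_unit Bh" a b]
  by (simp add: sl2_kappa_eq sl2_unit_def sl2_bracket_def fun_eq_iff split: sl2_basis.split)

lemma HE:
  assumes "m \<in> M"
  shows "H a (E b m) = E b (H a m) + smul 2 (E (mult a b) m)"
  using tens_commutator[OF assms, of "sl2_unit Bh" "sl2_unit Be" 2 "sl2_unit Be" a b]
  by (simp add: sl2_kappa_eq sl2_unit_def sl2_bracket_def fun_eq_iff split: sl2_basis.split)

lemma HF:
  assumes "m \<in> M"
  shows "H a (F b m) = F b (H a m) - smul 2 (F (mult a b) m)"
  using tens_commutator[OF assms, of "sl2_unit Bh" "sl2_unit Bf" "-2" "sl2_unit Bf" a b]
  by (simp add: sl2_kappa_eq sl2_unit_def sl2_bracket_def fun_eq_iff split: sl2_basis.split)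

lemma FF:
  assumes "m \<in> M"
  shows "F a (F b m) = F b (F a m)"
  using tens_commutator[OF assms, of "sl2_unit Bf" "sl2_unit Bf" 0 "sl2_unit Bf" a b]
  by (simp add: sl2_kappa_eq sl2_unit_def sl2_bracket_def fun_eq_iff split: sl2_basis.split)

text \<open>This removes the \<open>{J,J}\<close> terms as long as only powers of a single
  \<open>a\<close> occur, so that Garland's formula for \<open>sl2(k[t])\<close> becomes
  applicable.\<close>

lemma brace_powers_act:
  assumes "m \<in> M"
  shows "act (sl2J_brace (jpow a i) (jpow a j)) m = 0"
proof (rule alternating_powers_vanish[of smul])
  show "vector_space smul" ..
  have *: "act (sl2J_scale 0 (tens (sl2_unit Be) x)) m = 0" for x
    using assms by (simp add: scale_act del: carrier_closed(2))
  show "act (sl2J_brace x x) m = 0" for x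
    unfolding sl2J_brace_linear(3)[of x "tens (sl2_unit Be) x"] by (rule *)
  show "act (sl2J_brace x (mult x x)) m = 0" for x
    unfolding sl2J_brace_linear(4)[of x "tens (sl2_unit Be) x"] by (rule *)
qed (simp_all add: sl2J_brace_linear(1,2) add_act assms)

text \<open>The powers of \<open>a\<close> take the place of the powers of \<open>t\<close>. The
  signs \<open>(- 1) ^ i\<close> turn \<open>[h, f] = - 2 f\<close> into the relation
  \<open>h_f\<close> with \<open>+ 2\<close>, and the alternating recursion of Newton into
  \<open>H p = p'\<close>.\<close>

lemma E_power_F_power:
  assumes p: "\<And>s. p s \<in> M" and Ep: "\<And>s. E a (p s) = 0"
    and newton: "\<And>s. smul (of_nat (Suc s)) (p (Suc s))
      = (\<Sum>i\<le>s. smul ((- 1) ^ i) (H (jpow a (Suc i)) (p (s - i))))"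
  shows "(E a ^^ N) ((F one ^^ N) (p 0)) = smul (fact N * fact N) (p N)"
proof -
  let ?f = "\<lambda>i m. smul ((- 1) ^ i) (F (jpow a i) m)"
  let ?h = "\<lambda>i m. smul ((- 1) ^ i) (H (jpow a (Suc i)) m)"
  have brace0: "act (sl2J_brace a (jpow a i)) m = 0" if "m \<in> M" for i m
    using brace_powers_act[OF that, of a 1 i] by (simp del: jpow.simps(2))
  interpret current_sl2_action smul M "E a" ?f ?h p
  proof
    show "E a (?f i m) = ?f i (E a m) + ?h i m" if "m \<in> M" for i m
      using that by (simp add: act_scale EF brace0 m.scale_right_distrib)
    show "?h i (?f j m) = ?f j (?h i m) + smul 2 (?f (Suc (i + j)) m)" if "m \<in> M" for i j m
    proof -
      have "mult (jpow a (Suc i)) (jpow a j) = jpow a (Suc (i + j))"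
        unfolding jpow_mult by simp
      then show ?thesis
        using that by (simp add: act_scale HF m.scale_right_diff_distrib power_add mult.commute
            del: jpow.simps(2))
    qed
    show "?f i (?f j m) = ?f j (?f i m)" if "m \<in> M" for i j m
      using that FF[OF that, of "jpow a i" "jpow a j"] by (simp add: act_scale mult.commute)
  qed (use M_subspace p Ep newton in \<open>simp_all add: act_add act_scale m.scale_right_distrib
      mult.commute del: jpow.simps(2)\<close>)
  show ?thesis
    using e_power_f_power[of N] by simp
qed

lemma weight_shift:
  assumes m: "m \<in> weight_space smul M act j"
  shows "E a m \<in> weight_space smul M act (j + 2)" "F a m \<in> weight_space smul M act (j - 2)"
  using m HE[of m one a] HF[of m one a]
  by (auto simp: weight_space_def act_scale mult_one_left m.scale_left_distrib m.scale_left_diff_distrib)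

lemma weight_F_power:
  assumes "m \<in> weight_space smul M act j"
  shows "(F a ^^ k) m \<in> weight_space smul M act (j - 2 * int k)"
  using assms
proof (induction k)
  case (Suc k)
  then show ?case using weight_shift(2)[of "(F a ^^ k) m" "j - 2 * int k" a] by (simp add: algebra_simps)
qed simp

text \<open>Adjoining \<open>- m\<close> in weight \<open>j\<close> to the decomposition of
  \<open>m\<close> gives a vanishing sum of vectors of distinct weights.\<close>

lemma bounded_weight_zero:
  assumes bdd: "bounded_module smul M act n" and m: "m \<in> weight_space smul M act j"
    and j: "j \<notin> {- int n..int n}"
  shows "m = 0"
proof -
  have "m \<in> M"
    using m by (simp add: weight_space_def)
  then obtain c where c: "\<And>i. i \<in> {- int n..int n} \<Longrightarrow> c i \<in> weight_space smul M act i"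
    "m = (\<Sum>i\<in>{- int n..int n}. c i)"
    using bdd unfolding bounded_module_def by blast
  let ?c = "c(j := - m)" and ?S = "insert j {- int n..int n}"
  have "(\<Sum>i\<in>?S. ?c i) = - m + (\<Sum>i\<in>{- int n..int n}. ?c i)"
    using j by simp
  also have "(\<Sum>i\<in>{- int n..int n}. ?c i) = m"
    unfolding c(2) using j by (intro sum.cong) auto
  finally have "(\<Sum>i\<in>?S. ?c i) = 0" by simp
  moreover have "?c i \<in> weight_space smul M act i" if "i \<in> ?S" for i
    using that c(1) m weight_space_subspace[OF mod, of j] by (auto simp: m.subspace_neg)
  ultimately have "\<forall>i\<in>?S. ?c i = 0"
    by (intro weights_independent[OF mod]) auto
  then show ?thesis by auto
qed

end

section \<open>Symmetric functions of the operators of a \<open>J\<close>-space\<close>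

locale J_rep = jordan_algebra scale mult one
  for scale :: "'k::field_char_0 \<Rightarrow> 'j::ab_group_add \<Rightarrow> 'j" and mult one +
  fixes scaleV :: "'k \<Rightarrow> 'v::ab_group_add \<Rightarrow> 'v" and \<rho> :: "'j \<Rightarrow> 'v \<Rightarrow> 'v" and n :: nat
  assumes level: "J_space_of_level scaleV \<rho> n"
begin

sublocale V: char_0_space scaleV
  using level by (simp add: J_space_of_level_def J_space_def char_0_space_def)

lemma linear_rho: "Vector_Spaces.linear scaleV scaleV (\<rho> a)"
  using level by (simp add: J_space_of_level_def J_space_def)

lemma module_hom_rho: "module_hom scaleV scaleV (\<rho> a)"
  using linear_rho by (rule Vector_Spaces.linear.axioms(3))

lemmas rho_add = module_hom.add[OF module_hom_rho]
  and rho_scale = module_hom.scale[OF module_hom_rho]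
  and rho_zero = module_hom.zero[OF module_hom_rho]
  and rho_diff = module_hom.diff[OF module_hom_rho]
  and rho_sum = module_hom.sum[OF module_hom_rho]

lemma rho_add_left: "\<rho> (a + b) v = \<rho> a v + \<rho> b v"
  and rho_scale_left: "\<rho> (scale r a) v = scaleV r (\<rho> a v)"
  and rho_square: "\<rho> a (\<rho> (mult a a) v) = \<rho> (mult a a) (\<rho> a v)"
  and rho_der: "op_comm (op_comm (\<rho> a) (\<rho> b)) (\<rho> c) v = scaleV 4 (\<rho> (der a b c) v)"
  and rho_one: "\<rho> one v = scaleV (of_nat n) v"
  using level by (simp_all add: J_space_of_level_def J_space_def op_comm_def)

text \<open>For fixed \<open>v\<close>, the commutator applied to \<open>v\<close> is an alternating
  bilinear form that vanishes on \<open>a\<close> and its square.\<close>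

lemma rho_powers_commute: "\<rho> (jpow a i) (\<rho> (jpow a j) v) = \<rho> (jpow a j) (\<rho> (jpow a i) v)"
proof -
  have "op_comm (\<rho> (jpow a i)) (\<rho> (jpow a j)) v = 0"
    by (rule alternating_powers_vanish[OF V.vector_space_axioms])
      (simp_all add: op_comm_def rho_add_left rho_add rho_square)
  then show ?thesis by (simp add: op_comm_def)
qed

definition power_prod :: "'j \<Rightarrow> 'v \<Rightarrow> nat multiset \<Rightarrow> 'v" where
  "power_prod a v \<mu> = fold_mset (\<lambda>i. \<rho> (jpow a i)) v \<mu>"

lemma power_prod_simps [simp]:
  "power_prod a v {#} = v" "power_prod a v (add_mset i \<mu>) = \<rho> (jpow a i) (power_prod a v \<mu>)"
proof -
  interpret comp_fun_commute "\<lambda>i. \<rho> (jpow a i)"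
    by standard (simp add: fun_eq_iff rho_powers_commute)
  show "power_prod a v {#} = v"
    "power_prod a v (add_mset i \<mu>) = \<rho> (jpow a i) (power_prod a v \<mu>)"
    by (simp_all add: power_prod_def)
qed

lemma rho_part_eq_power_prod: "rho_part \<rho> \<sigma> a v = power_prod a v (mset \<sigma>)"
  by (induction \<sigma>) (simp_all add: rho_part_def)

text \<open>The vector \<open>p\<^sub>s v\<close>: the elementary symmetric function of degree
  \<open>s\<close> with \<open>\<rho> (jpow a i)\<close> as \<open>i\<close>-th power sum, applied
  to \<open>v\<close>.\<close>

definition elem :: "'j \<Rightarrow> 'v \<Rightarrow> nat \<Rightarrow> 'v" where
  "elem a v s = V.newton s (power_prod a v)"

lemma elem_0 [simp]: "elem a v 0 = v"
  by (simp add: elem_def)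

lemma elem_Suc: "scaleV (of_nat (Suc s)) (elem a v (Suc s))
    = (\<Sum>i\<le>s. scaleV ((- 1) ^ i) (\<rho> (jpow a (Suc i)) (elem a v (s - i))))"
  unfolding elem_def V.newton_Suc power_prod_simps V.newton_linear[OF module_hom_rho] ..

lemma sum_partitions_eq_0_iff:
  "(\<Sum>\<sigma>\<in>partitions N. scaleV (of_int (sgn_part \<sigma>) * of_nat (card (conj_class \<sigma>)))
      (rho_part \<rho> \<sigma> a v)) = 0 \<longleftrightarrow> elem a v N = 0"
  unfolding rho_part_eq_power_prod V.sum_partitions_eq_newton by (simp add: elem_def)

text \<open>\<open>E a\<close> kills the images of \<open>V\<close> since their weight would become
  \<open>n + 2\<close>, so Garland's formula applies. The left side is zero because
  \<open>F one ^^ Suc n\<close> leads to weight \<open>- n - 2\<close>; the squared factorial is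
  nonzero and \<open>\<phi>\<close> is injective.\<close>

lemma dominant_imp_elem_eq_0:
  assumes "dominant scaleV \<rho> n"
  shows "elem a v (Suc n) = 0"
proof -
  obtain smul M act and \<phi> :: "'v \<Rightarrow> ('k, 'j) sl2J list \<Rightarrow> 'v" where
    bdd: "bounded_module smul M act n" and lin: "Vector_Spaces.linear scaleV smul \<phi>" and
    bij: "bij_betw \<phi> UNIV (weight_space smul M act (int n))" and
    \<phi>: "\<And>a v. \<phi> (\<rho> a v) = act (tens (sl2_unit Bh) a) (\<phi> v)"
    using assms unfolding dominant_def dominant_in_def by blast
  interpret f: Vector_Spaces.linear scaleV smul \<phi> by fact
  interpret sl2J_action scale mult one smul M act
    using bdd by unfold_locales (simp add: bounded_module_def)
  have \<phi>_top: "\<phi> u \<in> weight_space smul M act (int n)" for u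
    using bij by (auto simp: bij_betw_def)
  have "(E a ^^ Suc n) ((F one ^^ Suc n) (\<phi> (elem a v 0)))
      = smul (fact (Suc n) * fact (Suc n)) (\<phi> (elem a v (Suc n)))"
  proof (rule E_power_F_power)
    show "\<phi> (elem a v s) \<in> M" for s
      using \<phi>_top by (simp add: weight_space_def)
    show "E a (\<phi> (elem a v s)) = 0" for s
      using weight_shift(1)[OF \<phi>_top] by (rule bounded_weight_zero[OF bdd]) simp
    show "smul (of_nat (Suc s)) (\<phi> (elem a v (Suc s)))
      = (\<Sum>i\<le>s. smul ((- 1) ^ i) (H (jpow a (Suc i)) (\<phi> (elem a v (s - i)))))" for s
      unfolding f.scale[symmetric] elem_Suc f.sum \<phi> [symmetric] ..
  qed
  moreover have "(F one ^^ Suc n) (\<phi> (elem a v 0)) = 0"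
    using weight_F_power[OF \<phi>_top] by (rule bounded_weight_zero[OF bdd]) simp
  moreover have "(E a ^^ k) 0 = 0" for k
    using act_scale[of "tens (sl2_unit Be) a" 0 0] by (induction k) simp_all
  ultimately have "\<phi> (elem a v (Suc n)) = 0"
    by (metis f.vs2.scale_eq_0_iff mult_eq_0_iff fact_nonzero)
  then show ?thesis
    using bij f.zero by (metis bij_betw_def injD)
qed

end

section \<open>The coinduced module\<close>

context jordan_algebra
begin

text \<open>The Jordan triple product, normalized so that \<open>[[e(a), f(b)], e(c)]\<close> is
  \<open>e\<close> of \<open>2 triple a b c\<close>.\<close>

definition triple :: "'j \<Rightarrow> 'j \<Rightarrow> 'j \<Rightarrow> 'j" where
  "triple a b c = mult (mult a b) c + der a b c"

lemma triple_swap: "triple a b c = triple c b a"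
  by (simp add: triple_def der_def mult_commute)

lemma triple_linear:
  "triple (a + a') b c = triple a b c + triple a' b c"
  "triple a (b + b') c = triple a b c + triple a b' c"
  "triple a b (c + c') = triple a b c + triple a b c'"
  "triple (scale r a) b c = scale r (triple a b c)"
  "triple a (scale r b) c = scale r (triple a b c)"
  "triple a b (scale r c) = scale r (triple a b c)"
  by (simp_all add: triple_def mult_add_left mult_add_right mult_scale_left mult_scale_right
      der_add der_scale der_add_1 der_add_2 der_scale_1 der_scale_2 scale_right_distrib)

lemma der_swap: "der a b c = - der b a c"
  by (simp add: der_def)

lemma der_cyclic: "der a (mult b c) d + der b (mult c a) d + der c (mult a b) d = 0"
  using jordan_linearized[of a b c d] by (simp add: der_def algebra_simps)

text \<open>The Jacobi identity for \<open>h(c)\<close>, \<open>e(a)\<close>, \<open>f(b)\<close>,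
  evaluated on \<open>e(y)\<close>. In terms of \<open>J\<close> it combines the derivation property
  of \<open>der a b\<close> with the cyclic identity.\<close>

lemma mult_triple:
  "mult c (triple a b y) - triple a b (mult c y) = triple (mult c a) b y - triple a (mult c b) y"
proof -
  have 1: "der a b (mult c y) = mult (der a b c) y + mult c (der a b y)"
    by (rule der_mult)
  have 2: "mult (der a b c) y = mult (mult a (mult c b)) y - mult (mult (mult c a) b) y"
    by (simp add: der_def mult_diff_left mult_diff_right mult_commute)
  have 3: "der (mult c a) b y = der a (mult c b) y + der c (mult a b) y"
    using der_cyclic[of a b c y] der_swap[of b "mult c a" y] by (simp add: mult_commute[of b c] algebra_simps)
  have 4: "mult c (mult (mult a b) y) - mult (mult a b) (mult c y) = der c (mult a b) y"
    by (simp add: der_def)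
  have "mult c (triple a b y) - triple a b (mult c y)
      = (mult c (mult (mult a b) y) - mult (mult a b) (mult c y)) - mult (der a b c) y"
    by (simp add: triple_def mult_add_right 1)
  also have "\<dots> = triple (mult c a) b y - triple a (mult c b) y"
    unfolding 4 2 by (simp add: triple_def 3)
  finally show ?thesis .
qed

lemma jj_der_linear:
  "C \<in> jj_carrier \<Longrightarrow> C' \<in> jj_carrier \<Longrightarrow> jj_der (jj_add C C') x = jj_der C x + jj_der C' x"
  "C \<in> jj_carrier \<Longrightarrow> jj_der (jj_scale r C) x = scale r (jj_der C x)"
  by (auto simp: jj_carrier_def jj_add_class jj_scale_class jj_der_class lin_ext_add lin_ext_scale)

end

lemma (in vector_space) lin_ext_sum: "lin_ext f (\<Sum>i\<in>S. g i) = (\<Sum>i\<in>S. lin_ext f (g i))"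
  by (induction S rule: infinite_finite_induct) (simp_all add: lin_ext_add, simp_all add: lin_ext_def)

lemma (in jordan_algebra) lin_ext_fder:
  assumes "vector_space s"
  shows "vector_space.lin_ext s f (fder D w)
    = vector_space.lin_ext s (\<lambda>(c, d). f (D c, d) + f (c, D d)) w"
proof -
  interpret s: vector_space s by fact
  have "s.lin_ext f (fder D w)
      = (\<Sum>p\<in>Poly_Mapping.keys w. s (Poly_Mapping.lookup w p) (case p of (c, d) \<Rightarrow> f (D c, d) + f (c, D d)))"
    unfolding fder_def free.lin_ext_def s.lin_ext_sum s.lin_ext_scale
    by (intro sum.cong) (auto simp: s.lin_ext_add)
  then show ?thesis by (simp add: s.lin_ext_def)
qed

section \<open>Operators on \<open>V\<close> and on symmetric multilinear functions\<close>

context J_rep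
begin

abbreviation jrel :: "'j \<Rightarrow> 'j \<Rightarrow> 'v \<Rightarrow> 'v" where
  "jrel a b \<equiv> op_comm (\<rho> a) (\<rho> b)"

text \<open>The action of \<open>{J,J}\<close> on \<open>V\<close>, forced by \<open>[h(a), h(b)] = 4 {a,b}\<close>.\<close>
definition jj_op :: "('k, 'j) jj \<Rightarrow> 'v \<Rightarrow> 'v" where
  "jj_op C v = V.lin_ext (\<lambda>(a, b). scaleV (1 / 4) (jrel a b v)) (jj_rep C)"

text \<open>The action descends to classes: the relator of \<open>a\<close> and its square is killed
  by the axiom that \<open>\<rho> a\<close> and \<open>\<rho> (mult a a)\<close> commute, the others
  by bilinearity and antisymmetry.\<close>

lemma jj_op_class: "jj_op (jj_class u) v = V.lin_ext (\<lambda>(a, b). scaleV (1 / 4) (jrel a b v)) u"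
proof -
  let ?f = "V.lin_ext (\<lambda>(a, b). scaleV (1 / 4) (jrel a b v))"
  interpret l: Vector_Spaces.linear free_scale scaleV ?f
    by (rule V.linear_lin_ext)
  have "?f w \<in> {0}" if "w \<in> jj_relators" for w
    using that by cases (simp_all add: l.diff l.scale, simp_all add: op_comm_def rho_add rho_add_left rho_scale
        rho_scale_left rho_square V.scale_right_distrib V.scale_right_diff_distrib mult.commute)
  then have "?f (jj_rep (jj_class u) - u) \<in> {0}"
    by (rule linear_vanish_jj_rel[OF V.vector_space_axioms V.linear_lin_ext _ V.subspace_single_0 jj_class_rep])
  then show ?thesis
    unfolding jj_op_def by (simp add: l.diff)
qed

lemma jj_op_linear:
  "C \<in> jj_carrier \<Longrightarrow> C' \<in> jj_carrier \<Longrightarrow> jj_op (jj_add C C') v = jj_op C v + jj_op C' v"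
  "C \<in> jj_carrier \<Longrightarrow> jj_op (jj_scale r C) v = scaleV r (jj_op C v)"
  by (auto simp: jj_carrier_def jj_add_class jj_scale_class jj_op_class V.lin_ext_add V.lin_ext_scale)

text \<open>Collects what the computations need of an element of \<open>{J,J}\<close>. Besides
  \<open>jj_der C\<close>, \<open>jj_op C\<close> it also covers the explicit pair of
  \<open>2 {a,b}\<close> in \<open>der_pair_S1\<close>, without recourse to classes.\<close>

definition der_pair :: "('j \<Rightarrow> 'j) \<Rightarrow> ('v \<Rightarrow> 'v) \<Rightarrow> bool" where
  "der_pair D Q \<longleftrightarrow> module_hom scale scale D \<and> module_hom scaleV scaleV Q \<and>
    (\<forall>x y. D (mult x y) = mult (D x) y + mult x (D y)) \<and>
    (\<forall>x v. Q (\<rho> x v) = \<rho> x (Q v) + \<rho> (D x) v)"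

lemma module_homI:
  "(\<And>x y. D (x + y) = D x + D y) \<Longrightarrow> (\<And>r x. D (scale r x) = scale r (D x)) \<Longrightarrow> module_hom scale scale D"
  "(\<And>x y. Q (x + y) = Q x + Q y) \<Longrightarrow> (\<And>r x. Q (scaleV r x) = scaleV r (Q x)) \<Longrightarrow> module_hom scaleV scaleV Q"
  by (auto simp: module_hom_def module_hom_axioms_def module_axioms V.module_axioms)

lemma der_pair_jj: "der_pair (jj_der C) (jj_op C)"
proof -
  have "jj_op C (\<rho> x v) = \<rho> x (jj_op C v) + \<rho> (jj_der C x) v" for x v
  proof -
    have "\<rho> (lin_ext f u) v = V.lin_ext (\<lambda>p. \<rho> (f p) v) u" for f and u :: "'j \<times> 'j \<Rightarrow>\<^sub>0 'k"
    proof -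
      have zero: "\<rho> 0 v = 0" using rho_scale_left[of 0 0 v] by simp
      have "\<rho> (sum g S) v = (\<Sum>i\<in>S. \<rho> (g i) v)" for g :: "'j \<times> 'j \<Rightarrow> 'j" and S
        by (induction S rule: infinite_finite_induct) (simp_all add: rho_add_left zero)
      then show ?thesis by (simp add: lin_ext_def V.lin_ext_def rho_scale_left)
    qed
    moreover have "scaleV (1 / 4) (jrel a b (\<rho> x v))
        = \<rho> x (scaleV (1 / 4) (jrel a b v)) + \<rho> (der a b x) v" for a b
    proof -
      have "jrel a b (\<rho> x v) = \<rho> x (jrel a b v) + scaleV 4 (\<rho> (der a b x) v)"
        using rho_der[of a b x v] by (simp add: op_comm_def algebra_simps)
      then show ?thesis by (simp add: V.scale_right_distrib rho_scale)
    qed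
    ultimately show ?thesis
      by (simp add: jj_op_def jj_der_def V.lin_ext_def case_prod_beta rho_sum rho_scale
          V.scale_right_distrib sum.distrib)
  qed
  moreover have "module_hom scaleV scaleV (jj_op C)"
    by (intro module_homI) (simp_all add: jj_op_def V.lin_ext_def case_prod_beta op_comm_def
        rho_add rho_scale V.scale_right_distrib V.scale_right_diff_distrib V.scale_sum_right
        sum.distrib[symmetric] mult.commute mult.left_commute add_diff_add)
  ultimately show ?thesis
    by (simp add: der_pair_def jj_der_mult jj_der_add jj_der_scale module_homI)
qed

text \<open>By linearity in the second argument it suffices that commuting a derivation
  \<open>D\<close> past \<open>der a b\<close> differentiates \<open>a\<close> and \<open>b\<close>
  in turn. The same computation with \<open>jrel a b\<close> works on \<open>V\<close>.\<close>

lemma jj_bracket_der_op: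
  assumes "C' \<in> jj_carrier"
  shows "jj_der (jj_bracket C C') x = jj_der C (jj_der C' x) - jj_der C' (jj_der C x)"
    and "jj_op (jj_bracket C C') v = jj_op C (jj_op C' v) - jj_op C' (jj_op C v)"
proof -
  obtain w where w: "C' = jj_class w"
    using assms by (auto simp: jj_carrier_def)
  have dp: "module_hom scale scale (jj_der C)" "module_hom scaleV scaleV (jj_op C)"
    "\<And>x v. jj_op C (\<rho> x v) = \<rho> x (jj_op C v) + \<rho> (jj_der C x) v"
    using der_pair_jj[of C] by (auto simp: der_pair_def)
  have D: "jj_der C (\<Sum>i\<in>S. f i) = (\<Sum>i\<in>S. jj_der C (f i))" for f and S :: "('j \<times> 'j) set"
    using module_hom.sum[OF dp(1)] .
  have Q: "jj_op C (\<Sum>i\<in>S. f i) = (\<Sum>i\<in>S. jj_op C (f i))" for f and S :: "('j \<times> 'j) set"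
    using module_hom.sum[OF dp(2)] .
  have 1: "der (jj_der C a) b x + der a (jj_der C b) x = jj_der C (der a b x) - der a b (jj_der C x)" for a b
    using module_hom.diff[OF dp(1)] by (simp add: der_def jj_der_mult mult_add_right)
  have 2: "jrel (jj_der C a) b v + jrel a (jj_der C b) v = jj_op C (jrel a b v) - jrel a b (jj_op C v)" for a b
    using module_hom.diff[OF dp(2)] by (simp add: op_comm_def dp(3) rho_add)
  show "jj_der (jj_bracket C C') x = jj_der C (jj_der C' x) - jj_der C' (jj_der C x)"
    unfolding w jj_bracket_class jj_der_class[of w] jj_der_class[of "fder _ _"]
      lin_ext_fder[OF vector_space_axioms]
    by (simp add: lin_ext_def case_prod_beta 1 D jj_der_scale scale_right_diff_distrib sum_subtractf)
  show "jj_op (jj_bracket C C') v = jj_op C (jj_op C' v) - jj_op C' (jj_op C v)"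
    unfolding w jj_bracket_class jj_op_class[of w] jj_op_class[of "fder _ _"]
      lin_ext_fder[OF V.vector_space_axioms]
    by (simp add: V.lin_ext_def case_prod_beta V.scale_right_distrib[symmetric] 2 Q
        module_hom.scale[OF dp(2)] V.scale_right_diff_distrib sum_subtractf)
qed

text \<open>
  For \<open>d \<in> {J,J}\<close> with derivation \<open>D\<close> and action \<open>Q\<close> on \<open>V\<close>, the element \<open>h(c) + d\<close> acts by \<open>T0 c D\<close>
  on \<open>e(J)\<close> and by \<open>S0 c Q\<close> on \<open>V\<close>.  For the element \<open>[e(a), f(b)] = h(ab) + 2 {a,b}\<close> these
  are \<open>T1 a b\<close> and \<open>S1 a b\<close>.
\<close>
abbreviation T0 :: "'j \<Rightarrow> ('j \<Rightarrow> 'j) \<Rightarrow> 'j \<Rightarrow> 'j" where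
  "T0 c D \<equiv> (\<lambda>x. scale 2 (mult c x) + D x)"
abbreviation S0 :: "'j \<Rightarrow> ('v \<Rightarrow> 'v) \<Rightarrow> 'v \<Rightarrow> 'v" where
  "S0 c Q \<equiv> (\<lambda>v. \<rho> c v + Q v)"
abbreviation S1 :: "'j \<Rightarrow> 'j \<Rightarrow> 'v \<Rightarrow> 'v" where
  "S1 a b \<equiv> (\<lambda>v. \<rho> (mult a b) v + scaleV (1 / 2) (jrel a b v))"
abbreviation T1 :: "'j \<Rightarrow> 'j \<Rightarrow> 'j \<Rightarrow> 'j" where
  "T1 a b \<equiv> (\<lambda>x. scale 2 (triple a b x))"

text \<open>
  The operators below are the actions of \<open>e(a)\<close>, of \<open>h(c) + d\<close> and of \<open>f(b)\<close> on the coinduced module.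
  The formulas result from moving \<open>x\<close> to the left in \<open>(x \<phi>)(a\<^sub>1,\<dots>,a\<^sub>r) = (e(a\<^sub>1) \<cdots> e(a\<^sub>r) x \<phi>)()\<close>.
\<close>
definition coind :: "('j multiset \<Rightarrow> 'v) set" where
  "coind = {\<phi>. (\<forall>a b A. \<phi> (add_mset (a + b) A) = \<phi> (add_mset a A) + \<phi> (add_mset b A)) \<and>
     (\<forall>r a A. \<phi> (add_mset (scale r a) A) = scaleV r (\<phi> (add_mset a A)))}"

definition Eop :: "'j \<Rightarrow> ('j multiset \<Rightarrow> 'v) \<Rightarrow> 'j multiset \<Rightarrow> 'v" where
  "Eop a \<phi> = (\<lambda>A. \<phi> (add_mset a A))"

definition Gop :: "('j \<Rightarrow> 'j) \<Rightarrow> ('v \<Rightarrow> 'v) \<Rightarrow> ('j multiset \<Rightarrow> 'v) \<Rightarrow> 'j multiset \<Rightarrow> 'v" where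
  "Gop T S \<phi> = (\<lambda>A. S (\<phi> A) - (\<Sum>x\<in>#A. \<phi> (add_mset (T x) (A - {#x#}))))"

definition Fop :: "'j \<Rightarrow> ('j multiset \<Rightarrow> 'v) \<Rightarrow> 'j multiset \<Rightarrow> 'v" where
  "Fop b \<phi> = (\<lambda>A. \<Sum>x\<in>#A. S1 x b (\<phi> (A - {#x#}))
     - (\<Sum>y\<in>#A - {#x#}. \<phi> (add_mset (triple x b y) (A - {#x#} - {#y#}))))"

definition fscale :: "'k \<Rightarrow> ('j multiset \<Rightarrow> 'v) \<Rightarrow> 'j multiset \<Rightarrow> 'v" where
  "fscale r \<phi> = (\<lambda>A. scaleV r (\<phi> A))"

sublocale fn: vector_space fscale
  by standard (simp_all add: fscale_def fun_eq_iff V.scale_right_distrib V.scale_left_distrib)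

lemma coindD:
  "\<phi> \<in> coind \<Longrightarrow> \<phi> (add_mset (a + b) A) = \<phi> (add_mset a A) + \<phi> (add_mset b A)"
  "\<phi> \<in> coind \<Longrightarrow> \<phi> (add_mset (scale r a) A) = scaleV r (\<phi> (add_mset a A))"
  by (simp_all add: coind_def)

lemma coindD_diff:
  "\<phi> \<in> coind \<Longrightarrow> \<phi> (add_mset (a - b) A) = \<phi> (add_mset a A) - \<phi> (add_mset b A)"
  using coindD(1)[of \<phi> "a - b" b A] by (simp add: algebra_simps)

lemma Eop_coind [simp]: "\<phi> \<in> coind \<Longrightarrow> Eop a \<phi> \<in> coind"
  by (simp add: coind_def Eop_def add_mset_commute[of a])

lemma Eop_commute: "Eop a (Eop b \<phi>) = Eop b (Eop a \<phi>)"
  by (simp add: Eop_def add_mset_commute)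

lemma Eop_linear: "Eop a (\<phi> + \<psi>) = Eop a \<phi> + Eop a \<psi>" "Eop a (\<phi> - \<psi>) = Eop a \<phi> - Eop a \<psi>"
  "Eop a (fscale r \<phi>) = fscale r (Eop a \<phi>)"
  by (simp_all add: Eop_def fun_eq_iff fscale_def)

lemma Eop_linear_left:
  assumes "\<phi> \<in> coind"
  shows "Eop (a + b) \<phi> = Eop a \<phi> + Eop b \<phi>" "Eop (a - b) \<phi> = Eop a \<phi> - Eop b \<phi>"
    "Eop (scale r a) \<phi> = fscale r (Eop a \<phi>)"
  using assms by (simp_all add: Eop_def fun_eq_iff fscale_def coindD coindD_diff)

lemma coind_subspace: "fn.subspace coind"
  by (rule fn.subspaceI) (simp_all add: coind_def fscale_def V.scale_right_distrib mult.commute algebra_simps)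

lemma coind_closed [simp]:
  "0 \<in> coind" "\<phi> \<in> coind \<Longrightarrow> \<psi> \<in> coind \<Longrightarrow> \<phi> + \<psi> \<in> coind" "\<phi> \<in> coind \<Longrightarrow> \<psi> \<in> coind \<Longrightarrow> \<phi> - \<psi> \<in> coind"
  "\<phi> \<in> coind \<Longrightarrow> fscale r \<phi> \<in> coind"
  using coind_subspace by (auto simp: fn.subspace_0 fn.subspace_add fn.subspace_diff fn.subspace_scale)

lemma sum_mset_diff: "(\<Sum>x\<in>#A. f x - g x) = (\<Sum>x\<in>#A. f x) - (\<Sum>x\<in>#A. g x)"
  for f g :: "'x \<Rightarrow> 'y::ab_group_add"
  by (induction A) simp_all

lemma scaleV_sum_mset: "scaleV r (\<Sum>x\<in>#A. f x) = (\<Sum>x\<in>#A. scaleV r (f x))"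
  by (induction A) (simp_all add: V.scale_right_distrib)

lemma sum_mset_cong_in: "(\<And>x. x \<in># A \<Longrightarrow> f x = g x) \<Longrightarrow> (\<Sum>x\<in>#A. f x) = (\<Sum>x\<in>#A. g x)"
  by (metis image_mset_cong)

lemma Gop_empty: "Gop T S \<phi> {#} = S (\<phi> {#})"
  by (simp add: Gop_def)

lemma Fop_empty: "Fop b \<phi> {#} = 0"
  by (simp add: Fop_def)

lemma Gop_add_mset: "Gop T S \<phi> (add_mset a A) = Gop T S (Eop a \<phi>) A - \<phi> (add_mset (T a) A)"
proof -
  have "(\<Sum>x\<in>#A. \<phi> (add_mset (T x) (add_mset a A - {#x#})))
      = (\<Sum>x\<in>#A. \<phi> (add_mset a (add_mset (T x) (A - {#x#}))))"
    by (rule sum_mset_cong_in) (simp add: diff_union_swap2 add_mset_commute)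
  then show ?thesis
    by (simp add: Gop_def Eop_def)
qed

text \<open>The double sum in \<open>Fop\<close> runs over ordered pairs. A new argument
  \<open>a\<close> enters through the pairs \<open>(a, x)\<close> and \<open>(x, a)\<close>, which
  agree by \<open>triple_swap\<close> and together give the coefficient \<open>2\<close> in
  \<open>T1 a b\<close>.\<close>

lemma Fop_add_mset:
  assumes \<phi>: "\<phi> \<in> coind"
  shows "Fop b \<phi> (add_mset a A) = Fop b (Eop a \<phi>) A + Gop (T1 a b) (S1 a b) \<phi> A"
proof -
  let ?t = "\<Sum>x\<in>#A. \<phi> (add_mset (triple a b x) (A - {#x#}))"
  have inner: "(\<Sum>y\<in>#add_mset a A - {#x#}. \<phi> (add_mset (triple x b y) (add_mset a A - {#x#} - {#y#})))
      = \<phi> (add_mset (triple a b x) (A - {#x#}))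
      + (\<Sum>y\<in>#A - {#x#}. Eop a \<phi> (add_mset (triple x b y) (A - {#x#} - {#y#})))"
    if "x \<in># A" for x
  proof -
    have eq: "add_mset a A - {#x#} = add_mset a (A - {#x#})"
      using that by (simp add: diff_union_swap2)
    have "(\<Sum>y\<in>#A - {#x#}. \<phi> (add_mset (triple x b y) (add_mset a (A - {#x#}) - {#y#})))
      = (\<Sum>y\<in>#A - {#x#}. Eop a \<phi> (add_mset (triple x b y) (A - {#x#} - {#y#})))"
      by (rule sum_mset_cong_in) (simp add: diff_union_swap2 add_mset_commute Eop_def)
    then show ?thesis
      unfolding eq by (simp add: triple_swap[of x b a])
  qed
  have rest: "S1 x b (\<phi> (add_mset a A - {#x#})) = S1 x b (Eop a \<phi> (A - {#x#}))" if "x \<in># A" for x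
    using that by (simp add: diff_union_swap2 Eop_def)
  have "(\<Sum>x\<in>#A. S1 x b (\<phi> (add_mset a A - {#x#}))
        - (\<Sum>y\<in>#add_mset a A - {#x#}. \<phi> (add_mset (triple x b y) (add_mset a A - {#x#} - {#y#}))))
      = (\<Sum>x\<in>#A. (S1 x b (Eop a \<phi> (A - {#x#}))
        - (\<Sum>y\<in>#A - {#x#}. Eop a \<phi> (add_mset (triple x b y) (A - {#x#} - {#y#}))))
        - \<phi> (add_mset (triple a b x) (A - {#x#})))"
    by (rule sum_mset_cong_in) (simp only: inner rest diff_add_eq_diff_diff_swap)
  also have "\<dots> = Fop b (Eop a \<phi>) A - ?t"
    unfolding sum_mset_diff[of _ "\<lambda>x. \<phi> (add_mset (triple a b x) (A - {#x#}))"] Fop_def ..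
  moreover have "(\<Sum>x\<in>#A. \<phi> (add_mset (T1 a b x) (A - {#x#}))) = ?t + ?t"
  proof -
    have "(\<Sum>x\<in>#A. \<phi> (add_mset (T1 a b x) (A - {#x#}))) = scaleV 2 ?t"
      using \<phi> by (simp add: coindD scaleV_sum_mset)
    also have "\<dots> = ?t + ?t"
      using V.scale_left_distrib[of 1 1 ?t] by simp
    finally show ?thesis .
  qed
  ultimately show ?thesis
    by (simp add: Fop_def[of b \<phi>] Gop_def algebra_simps)
qed

text \<open>
  All relations between the operators follow by induction on the multiset: together with the value
  at \<open>{#}\<close>, a function is determined by its images under \<open>Eop\<close>.
\<close>
lemma Eop_Gop: "Eop a (Gop T S \<phi>) = Gop T S (Eop a \<phi>) - Eop (T a) \<phi>"
  by (simp add: fun_eq_iff Eop_def[of a "Gop _ _ _"] Gop_add_mset Eop_def[of "T a"])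

lemma Eop_Fop: "\<phi> \<in> coind \<Longrightarrow> Eop a (Fop b \<phi>) = Fop b (Eop a \<phi>) + Gop (T1 a b) (S1 a b) \<phi>"
  by (simp add: fun_eq_iff Eop_def[of a "Fop _ _"] Fop_add_mset)

lemma S1_module_hom: "module_hom scaleV scaleV (S1 a b)"
  by (intro module_homI) (simp_all add: op_comm_def rho_add rho_scale V.scale_right_distrib
      V.scale_right_diff_distrib mult.commute algebra_simps)

lemma Gop_linear:
  assumes "module_hom scaleV scaleV S"
  shows "Gop T S (\<phi> + \<psi>) = Gop T S \<phi> + Gop T S \<psi>" "Gop T S (\<phi> - \<psi>) = Gop T S \<phi> - Gop T S \<psi>"
    "Gop T S (fscale r \<phi>) = fscale r (Gop T S \<phi>)"
  using assms by (simp_all add: Gop_def fun_eq_iff fscale_def module_hom.add module_hom.diff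
      module_hom.scale sum_mset.distrib sum_mset_diff scaleV_sum_mset V.scale_right_diff_distrib algebra_simps)

lemma Fop_linear:
  "Fop b (\<phi> + \<psi>) = Fop b \<phi> + Fop b \<psi>" "Fop b (\<phi> - \<psi>) = Fop b \<phi> - Fop b \<psi>"
  "Fop b (fscale r \<phi>) = fscale r (Fop b \<phi>)"
  by (simp_all add: Fop_def fun_eq_iff fscale_def op_comm_def rho_add rho_diff rho_scale
      V.scale_right_distrib V.scale_right_diff_distrib sum_mset.distrib sum_mset_diff
      scaleV_sum_mset mult.commute)

lemma Gop_pair_linear:
  assumes "\<phi> \<in> coind"
  shows "Gop (\<lambda>x. T x + T' x) (\<lambda>v. S v + S' v) \<phi> = Gop T S \<phi> + Gop T' S' \<phi>"
    "Gop (\<lambda>x. T x - T' x) (\<lambda>v. S v - S' v) \<phi> = Gop T S \<phi> - Gop T' S' \<phi>"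
    "Gop (\<lambda>x. scale r (T x)) (\<lambda>v. scaleV r (S v)) \<phi> = fscale r (Gop T S \<phi>)"
  using assms by (simp_all add: Gop_def fun_eq_iff fscale_def coindD coindD_diff sum_mset.distrib
      sum_mset_diff scaleV_sum_mset V.scale_right_diff_distrib algebra_simps)

lemma S1_linear:
  "S1 (a + a') b v = S1 a b v + S1 a' b v" "S1 (scale r a) b v = scaleV r (S1 a b v)"
  "S1 a (b + b') v = S1 a b v + S1 a b' v" "S1 a (scale r b) v = scaleV r (S1 a b v)"
  by (simp_all add: op_comm_def mult_add_left mult_add_right mult_scale_left mult_scale_right
      rho_add_left rho_scale_left rho_add rho_scale V.scale_right_distrib V.scale_right_diff_distrib
      mult.commute algebra_simps)

lemma T1_linear:
  "T1 (a + a') b x = T1 a b x + T1 a' b x" "T1 (scale r a) b x = scale r (T1 a b x)"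
  "T1 a (b + b') x = T1 a b x + T1 a b' x" "T1 a (scale r b) x = scale r (T1 a b x)"
  by (simp_all add: triple_linear scale_right_distrib mult.commute)

lemma Gop_coind [simp]:
  assumes T: "module_hom scale scale T" and S: "module_hom scaleV scaleV S" and \<phi>: "\<phi> \<in> coind"
  shows "Gop T S \<phi> \<in> coind"
  using \<phi> unfolding coind_def
  by (auto simp: Gop_add_mset Eop_linear_left[OF \<phi>] Gop_linear[OF S] module_hom.add[OF T]
      module_hom.scale[OF T], simp_all add: fscale_def V.scale_right_diff_distrib)

lemma Fop_coind [simp]:
  assumes \<phi>: "\<phi> \<in> coind"
  shows "Fop b \<phi> \<in> coind"
proof -
  have "Gop (T1 (a + a') b) (S1 (a + a') b) \<phi> = Gop (T1 a b) (S1 a b) \<phi> + Gop (T1 a' b) (S1 a' b) \<phi>"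
    for a a'
    unfolding T1_linear S1_linear by (rule Gop_pair_linear[OF \<phi>])
  moreover have "Gop (T1 (scale r a) b) (S1 (scale r a) b) \<phi> = fscale r (Gop (T1 a b) (S1 a b) \<phi>)" for r a
    unfolding T1_linear S1_linear by (rule Gop_pair_linear[OF \<phi>])
  ultimately show ?thesis
    unfolding coind_def mem_Collect_eq Fop_add_mset[OF \<phi>]
    by (simp add: Eop_linear_left[OF \<phi>] Fop_linear) (simp add: fscale_def V.scale_right_distrib)
qed

lemma Fop_linear_left:
  assumes "\<phi> \<in> coind"
  shows "Fop (b + c) \<phi> = Fop b \<phi> + Fop c \<phi>" "Fop (scale r b) \<phi> = fscale r (Fop b \<phi>)"
proof -
  show "Fop (b + c) \<phi> = Fop b \<phi> + Fop c \<phi>"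
  proof
    fix A show "Fop (b + c) \<phi> A = (Fop b \<phi> + Fop c \<phi>) A"
      using assms
    proof (induction A arbitrary: \<phi>)
      case (add a A)
      then have "Gop (T1 a (b + c)) (S1 a (b + c)) \<phi> = Gop (T1 a b) (S1 a b) \<phi> + Gop (T1 a c) (S1 a c) \<phi>"
        unfolding T1_linear S1_linear by (intro Gop_pair_linear)
      with add show ?case by (simp add: Fop_add_mset)
    qed (simp add: Fop_empty)
  qed
  show "Fop (scale r b) \<phi> = fscale r (Fop b \<phi>)"
  proof
    fix A show "Fop (scale r b) \<phi> A = fscale r (Fop b \<phi>) A"
      using assms
    proof (induction A arbitrary: \<phi>)
      case (add a A)
      then have "Gop (T1 a (scale r b)) (S1 a (scale r b)) \<phi> = fscale r (Gop (T1 a b) (S1 a b) \<phi>)"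
        unfolding T1_linear S1_linear by (intro Gop_pair_linear)
      with add show ?case by (simp add: Fop_add_mset fscale_def V.scale_right_distrib)
    qed (simp add: Fop_empty fscale_def)
  qed
qed

lemma Gop_commutator:
  assumes S: "module_hom scaleV scaleV S" "module_hom scaleV scaleV S'" and "\<phi> \<in> coind"
  shows "Gop T S (Gop T' S' \<phi>) - Gop T' S' (Gop T S \<phi>)
    = Gop (\<lambda>x. T (T' x) - T' (T x)) (\<lambda>v. S (S' v) - S' (S v)) \<phi>"
proof
  fix A
  show "(Gop T S (Gop T' S' \<phi>) - Gop T' S' (Gop T S \<phi>)) A
    = Gop (\<lambda>x. T (T' x) - T' (T x)) (\<lambda>v. S (S' v) - S' (S v)) \<phi> A"
    using \<open>\<phi> \<in> coind\<close>
  proof (induction A arbitrary: \<phi>)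
    case (add a A)
    then show ?case
      using add.IH[of "Eop a \<phi>"]
      by (simp add: Gop_add_mset Eop_Gop Gop_linear[OF S(1)] Gop_linear[OF S(2)] coindD_diff algebra_simps)
  qed (simp add: Gop_empty)
qed

text \<open>Let \<open>g\<close> act by \<open>T\<close> and \<open>S\<close>, with
  \<open>[g, f(b)] = f(b')\<close>. The hypotheses \<open>compT\<close> and \<open>compS\<close> are
  the Jacobi identity for \<open>g\<close>, \<open>e(a)\<close>, \<open>f(b)\<close> on
  \<open>J\<close> and on \<open>V\<close>, which is what the step from \<open>A\<close> to
  \<open>add_mset a A\<close> requires.\<close>

lemma Gop_Fop_commutator:
  assumes T: "module_hom scale scale T" and S: "module_hom scaleV scaleV S" and "\<phi> \<in> coind"
    and compT: "\<And>a x. T (T1 a b x) - T1 a b (T x) = T1 (T a) b x + T1 a b' x"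
    and compS: "\<And>a v. S (S1 a b v) - S1 a b (S v) = S1 (T a) b v + S1 a b' v"
  shows "Gop T S (Fop b \<phi>) - Fop b (Gop T S \<phi>) = Fop b' \<phi>"
proof
  fix A
  show "(Gop T S (Fop b \<phi>) - Fop b (Gop T S \<phi>)) A = Fop b' \<phi> A"
    using \<open>\<phi> \<in> coind\<close>
  proof (induction A arbitrary: \<phi>)
    case empty
    show ?case by (simp add: Gop_empty Fop_empty module_hom.zero[OF S])
  next
    case (add a A)
    have "Gop T S (Gop (T1 a b) (S1 a b) \<phi>) - Gop (T1 a b) (S1 a b) (Gop T S \<phi>)
        = Gop (T1 (T a) b) (S1 (T a) b) \<phi> + Gop (T1 a b') (S1 a b') \<phi>"
      unfolding Gop_commutator[OF S S1_module_hom add.prems] compT compS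
      by (rule Gop_pair_linear[OF add.prems])
    then have G: "Gop T S (Gop (T1 a b) (S1 a b) \<phi>) A = Gop (T1 a b) (S1 a b) (Gop T S \<phi>) A
        + Gop (T1 (T a) b) (S1 (T a) b) \<phi> A + Gop (T1 a b') (S1 a b') \<phi> A"
      by (simp add: fun_eq_iff algebra_simps)
    have IH: "Gop T S (Fop b (Eop a \<phi>)) A = Fop b (Gop T S (Eop a \<phi>)) A + Fop b' (Eop a \<phi>) A"
      using add.IH[of "Eop a \<phi>"] add.prems by (simp add: algebra_simps)
    have "Gop T S (Fop b \<phi>) (add_mset a A) = Fop b (Gop T S (Eop a \<phi>)) A + Fop b' (Eop a \<phi>) A
      + Gop (T1 a b) (S1 a b) (Gop T S \<phi>) A + Gop (T1 a b') (S1 a b') \<phi> A - Fop b (Eop (T a) \<phi>) A"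
      unfolding Gop_add_mset Eop_Fop[OF add.prems] Gop_linear(1)[OF S] plus_fun_apply G IH
        Fop_add_mset[OF add.prems] by (simp add: algebra_simps)
    moreover have "Fop b (Gop T S \<phi>) (add_mset a A)
      = Fop b (Gop T S (Eop a \<phi>)) A - Fop b (Eop (T a) \<phi>) A + Gop (T1 a b) (S1 a b) (Gop T S \<phi>) A"
      using add.prems by (simp add: Fop_add_mset T S Eop_Gop Fop_linear)
    ultimately show ?case
      by (simp add: Fop_add_mset[OF add.prems])
  qed
qed

lemma rho_cyclic: "jrel a (mult b c) v + jrel b (mult c a) v + jrel c (mult a b) v = 0"
proof -
  define B where "B x = jrel x (mult x x) v" for x
  let ?G = "jrel a (mult b c) v + jrel b (mult c a) v + jrel c (mult a b) v"
  have "B (a + b + c) - B (a + b) - B (a + c) - B (b + c) + B a + B b + B c = ?G + ?G"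
    by (simp add: B_def op_comm_def rho_add_left rho_add mult_add_left mult_add_right
        mult_commute[of b a] mult_commute[of c a] mult_commute[of c b])
  moreover have "B x = 0" for x
    by (simp add: B_def op_comm_def rho_square)
  ultimately have "scaleV 2 ?G = 0"
    using V.scale_left_distrib[of 1 1 ?G] by simp
  then show ?thesis by simp
qed

lemma der_pairD:
  assumes "der_pair D Q"
  shows "D (x + y) = D x + D y" "D (x - y) = D x - D y" "D (scale r x) = scale r (D x)"
    "Q (v + w) = Q v + Q w" "Q (v - w) = Q v - Q w" "Q (scaleV r v) = scaleV r (Q v)"
    "D (mult x y) = mult (D x) y + mult x (D y)" "Q (\<rho> x v) = \<rho> x (Q v) + \<rho> (D x) v"
proof -
  have D: "module_hom scale scale D" and Q: "module_hom scaleV scaleV Q"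
    using assms by (auto simp: der_pair_def)
  show "D (x + y) = D x + D y" "D (x - y) = D x - D y" "D (scale r x) = scale r (D x)"
    "Q (v + w) = Q v + Q w" "Q (v - w) = Q v - Q w" "Q (scaleV r v) = scaleV r (Q v)"
    by (fact module_hom.add[OF D] module_hom.diff[OF D] module_hom.scale[OF D]
        module_hom.add[OF Q] module_hom.diff[OF Q] module_hom.scale[OF Q])+
  show "D (mult x y) = mult (D x) y + mult x (D y)" "Q (\<rho> x v) = \<rho> x (Q v) + \<rho> (D x) v"
    using assms by (simp_all add: der_pair_def)
qed

lemma T0_module_hom: "der_pair D Q \<Longrightarrow> module_hom scale scale (T0 c D)"
  by (intro module_homI) (simp_all add: der_pairD[of D Q] mult_add_right
      mult_scale_right scale_right_distrib mult.commute)

lemma S0_module_hom: "der_pair D Q \<Longrightarrow> module_hom scaleV scaleV (S0 c Q)"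
  by (intro module_homI) (simp_all add: der_pairD[of D Q] rho_add
      rho_scale V.scale_right_distrib)

text \<open>Here \<open>g = h(c) + d\<close>, and \<open>D b - 2 c b\<close> is the argument of
  \<open>[g, f(b)]\<close>. The part with \<open>D\<close> is the derivation property, the part with
  \<open>c\<close> is \<open>mult_triple\<close>.\<close>

lemma T0_T1:
  assumes dp: "der_pair D Q"
  shows "T0 c D (T1 a b x) - T1 a b (T0 c D x)
    = T1 (T0 c D a) b x + T1 a (D b - scale 2 (mult c b)) x"
proof -
  note D = der_pairD(1-3,7)[OF dp]
  have 1: "D (triple a b x) = triple (D a) b x + triple a (D b) x + triple a b (D x)"
    by (simp add: triple_def der_def D mult_add_left mult_add_right algebra_simps)
  have 2: "mult c (triple a b x) = triple a b (mult c x) + triple (mult c a) b x - triple a (mult c b) x"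
    using mult_triple[of c a b x] by (simp add: algebra_simps)
  have 3: "triple a (p - q) x = triple a p x - triple a q x" for p q
    using triple_linear(2)[of a "p - q" q x] by (simp add: algebra_simps)
  show ?thesis
    by (simp add: D mult_scale_right 1 2 3 triple_linear scale_right_distrib scale_right_diff_distrib)
qed

text \<open>The analogue on \<open>V\<close>: the part with \<open>c\<close> uses the double
  commutator axiom \<open>rho_der\<close> and the polarized axiom \<open>rho_cyclic\<close> in place
  of the Jordan identities.\<close>

lemma S0_S1:
  assumes dp: "der_pair D Q"
  shows "S0 c Q (S1 a b v) - S1 a b (S0 c Q v)
    = S1 (T0 c D a) b v + S1 a (D b - scale 2 (mult c b)) v"
proof -
  note Q = der_pairD(4-8)[OF dp]
  have neg: "\<rho> (- x) u = - \<rho> x u" for x u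
    using rho_scale_left[of "-1" x u] by simp
  have rho_diff_left: "\<rho> (x - y) u = \<rho> x u - \<rho> y u" for x y u
    using rho_add_left[of x "- y" u] by (simp add: neg)
  have Qpart: "Q (S1 a b v) - S1 a b (Q v) = S1 (D a) b v + S1 a (D b) v"
    by (simp add: Q op_comm_def rho_add rho_add_left V.scale_right_distrib V.scale_right_diff_distrib
        algebra_simps)
  have der_c: "\<rho> c (jrel a b v) - jrel a b (\<rho> c v) = - scaleV 4 (\<rho> (der a b c) v)"
    using rho_der[of a b c v] by (simp add: op_comm_def algebra_simps)
  have half: "scaleV (1 / 2) (\<rho> c (jrel a b v)) - scaleV (1 / 2) (jrel a b (\<rho> c v))
      = - scaleV 2 (\<rho> (der a b c) v)"
    unfolding V.scale_right_diff_distrib[symmetric] der_c by (simp add: V.scale_minus_right)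
  have dd: "\<rho> (der a b c) v = \<rho> (mult a (mult c b)) v - \<rho> (mult (mult c a) b) v"
    by (simp add: der_def rho_diff_left mult_commute)
  have cyc: "jrel c (mult a b) v = jrel (mult c a) b v - jrel a (mult c b) v"
    using rho_cyclic[of a b c v] by (simp add: op_comm_def mult_commute[of b c] algebra_simps)
  have "\<rho> c (S1 a b v) - S1 a b (\<rho> c v) = jrel c (mult a b) v
      + (scaleV (1 / 2) (\<rho> c (jrel a b v)) - scaleV (1 / 2) (jrel a b (\<rho> c v)))"
    by (simp add: rho_add rho_scale op_comm_def[of "\<rho> c"])
  also have "\<dots> = S1 (scale 2 (mult c a)) b v - S1 a (scale 2 (mult c b)) v"
    unfolding half dd cyc S1_linear by (simp add: V.scale_right_distrib V.scale_right_diff_distrib)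
  finally have Lpart: "\<rho> c (S1 a b v) - S1 a b (\<rho> c v)
    = S1 (scale 2 (mult c a)) b v - S1 a (scale 2 (mult c b)) v" .
  have S1_add: "S1 a b (x + y) = S1 a b x + S1 a b y" for x y
    using module_hom.add[OF S1_module_hom] .
  have S1_diff: "S1 a (p - q) v = S1 a p v - S1 a q v" for p q
    using S1_linear(3)[of a "p - q" q v] by (simp add: algebra_simps)
  show ?thesis
    unfolding S1_add S1_diff S1_linear(1) using Qpart Lpart by (simp only: algebra_simps)
qed

lemma T1_eq_T0: "T1 a b = T0 (mult a b) (\<lambda>x. scale 2 (der a b x))"
  by (simp add: triple_def scale_right_distrib fun_eq_iff)

lemma der_pair_S1: "der_pair (\<lambda>x. scale 2 (der a b x)) (\<lambda>v. scaleV (1 / 2) (jrel a b v))"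
proof -
  have "scaleV (1 / 2) (jrel a b (\<rho> x v)) = \<rho> x (scaleV (1 / 2) (jrel a b v)) + \<rho> (scale 2 (der a b x)) v" for x v
  proof -
    have "jrel a b (\<rho> x v) = \<rho> x (jrel a b v) + scaleV 4 (\<rho> (der a b x) v)"
      using rho_der[of a b x v] by (simp add: op_comm_def algebra_simps)
    then show ?thesis by (simp add: V.scale_right_distrib rho_scale rho_scale_left)
  qed
  then show ?thesis
    unfolding der_pair_def
    by (auto intro!: module_homI simp: der_add der_scale der_mult scale_right_distrib mult_scale_left
        mult_scale_right mult.commute op_comm_def rho_add rho_scale V.scale_right_distrib
        V.scale_right_diff_distrib)
qed

lemma Gop_Fop:
  assumes "der_pair D Q" "\<phi> \<in> coind"
  shows "Gop (T0 c D) (S0 c Q) (Fop b \<phi>) - Fop b (Gop (T0 c D) (S0 c Q) \<phi>)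
    = Fop (D b - scale 2 (mult c b)) \<phi>"
  using assms by (intro Gop_Fop_commutator T0_module_hom S0_module_hom T0_T1 S0_S1)

text \<open>Adding an argument \<open>a\<close> produces \<open>[[e(a), f(b)], f(c)]\<close>, which
  is \<open>f\<close> of \<open>- 2 triple b a c\<close> and therefore symmetric in \<open>b\<close>
  and \<open>c\<close>.\<close>

lemma Fop_commute:
  assumes "\<phi> \<in> coind"
  shows "Fop b (Fop c \<phi>) = Fop c (Fop b \<phi>)"
proof
  fix A show "Fop b (Fop c \<phi>) A = Fop c (Fop b \<phi>) A"
    using assms
  proof (induction A arbitrary: \<phi>)
    case (add a A)
    have "scale 2 (der a b c) - scale 2 (mult (mult a b) c)
        = scale 2 (der a c b) - scale 2 (mult (mult a c) b)"
      by (simp add: der_def scale_right_diff_distrib mult_commute algebra_simps)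
    then have "Gop (T1 a b) (S1 a b) (Fop c \<phi>) - Fop c (Gop (T1 a b) (S1 a b) \<phi>)
        = Gop (T1 a c) (S1 a c) (Fop b \<phi>) - Fop b (Gop (T1 a c) (S1 a c) \<phi>)"
      unfolding T1_eq_T0 Gop_Fop[OF der_pair_S1 add.prems] by simp
    then have "(Gop (T1 a b) (S1 a b) (Fop c \<phi>) - Fop c (Gop (T1 a b) (S1 a b) \<phi>)) A
        = (Gop (T1 a c) (S1 a c) (Fop b \<phi>) - Fop b (Gop (T1 a c) (S1 a c) \<phi>)) A"
      by simp
    moreover have "Fop b (Fop c (Eop a \<phi>)) A = Fop c (Fop b (Eop a \<phi>)) A"
      using add by simp
    ultimately show ?case
      using add.prems
      by (simp add: Fop_add_mset Eop_Fop Fop_linear algebra_simps)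
  qed (simp add: Fop_empty)
qed

end

text \<open>Subtracting \<open>2 ^ Suc K\<close> times the value at \<open>t\<close> from the value
  at \<open>2 t\<close> removes the top term and multiplies every other coefficient by a nonzero
  scalar.\<close>

lemma (in char_0_space) vector_polynomial_eq_0:
  assumes "\<And>t. (\<Sum>k\<le>K. scale (t ^ k) (c k)) = 0" and "k \<le> K"
  shows "c k = 0"
  using assms
proof (induction K arbitrary: c k)
  case 0
  then show ?case by simp
next
  case (Suc K)
  define d where "d k = scale (2 ^ k - 2 ^ Suc K) (c k)" for k
  have "(\<Sum>k\<le>K. scale (t ^ k) (d k)) = 0" for t
  proof -
    have "(\<Sum>k\<le>K. scale (t ^ k) (d k)) = (\<Sum>k\<le>Suc K. scale (t ^ k) (d k))"
      by (simp add: d_def)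
    also have "\<dots> = (\<Sum>k\<le>Suc K. scale ((2 * t) ^ k) (c k)) - scale (2 ^ Suc K) (\<Sum>k\<le>Suc K. scale (t ^ k) (c k))"
      unfolding scale_sum_right sum_subtractf[symmetric]
      by (intro sum.cong) (simp_all add: d_def power_mult_distrib algebra_simps)
    also have "\<dots> = 0"
      unfolding Suc.prems(1) by simp
    finally show ?thesis .
  qed
  then have d: "d k = 0" if "k \<le> K" for k
    using Suc.IH that by blast
  have c: "c k = 0" if "k \<le> K" for k
  proof -
    have "(2 ^ k :: nat) \<noteq> 2 ^ Suc K"
      using that by (metis Suc_n_not_le_n numeral_2_eq_2 one_less_numeral_iff power_inject_exp semiring_norm(76))
    then have "(2 ^ k - 2 ^ Suc K :: 'k) \<noteq> 0"
      by (metis eq_iff_diff_eq_0 of_nat_eq_iff of_nat_numeral of_nat_power)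
    then show ?thesis using d[OF that] by (simp add: d_def)
  qed
  then have "c (Suc K) = 0"
    using Suc.prems(1)[of 1] by simp
  then show ?case using c Suc.prems(2) by (auto simp: le_Suc_eq)
qed

lemma (in jordan_algebra) submodule:
  assumes "sl2J_module smul M act" "N \<subseteq> M" "module.subspace smul N"
    "\<And>x m. x \<in> sl2J_carrier \<Longrightarrow> m \<in> N \<Longrightarrow> act x m \<in> N"
  shows "sl2J_module smul N act"
  using assms unfolding sl2J_module_def by (meson subsetD)

section \<open>The module structure on the coinduced space\<close>

context J_rep
begin

definition coact :: "('k, 'j) sl2J \<Rightarrow> ('j multiset \<Rightarrow> 'v) \<Rightarrow> 'j multiset \<Rightarrow> 'v" where
  "coact u \<phi> = Eop (fst u Be) \<phi> + Fop (fst u Bf) \<phi>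
     + Gop (T0 (fst u Bh) (jj_der (snd u))) (S0 (fst u Bh) (jj_op (snd u))) \<phi>"

text \<open>Both sides are split into their \<open>e\<close>, \<open>f\<close> and degree zero
  parts, and each part is one of the commutators of \<open>Eop\<close>, \<open>Fop\<close> and
  \<open>Gop\<close> found above.\<close>

lemma coact_bracket:
  assumes "u \<in> sl2J_carrier" "v \<in> sl2J_carrier" and \<phi>: "\<phi> \<in> coind"
  shows "coact (sl2J_bracket u v) \<phi> = coact u (coact v \<phi>) - coact v (coact u \<phi>)"
proof -
  obtain X C Y C' where uv: "u = (X, C)" "v = (Y, C')" "C \<in> jj_carrier" "C' \<in> jj_carrier"
    using assms by (auto simp: sl2J_carrier_def)
  define K where "K = jj_class (\<Sum>i\<in>UNIV. \<Sum>j\<in>UNIV.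
    free_scale (sl2_kappa (sl2_unit i) (sl2_unit j)) (fgen (X i) (Y j)))"
  define B where "B = jj_add K (jj_bracket C C')"
  define Z where "Z = (\<lambda>l. (\<Sum>i\<in>UNIV. \<Sum>j\<in>UNIV.
      scale (sl2_bracket (sl2_unit i) (sl2_unit j) l) (mult (X i) (Y j))) + jj_der C (Y l) - jj_der C' (X l))"
  have br: "sl2J_bracket u v = (Z, B)"
    by (simp add: sl2J_bracket_def uv K_def B_def Z_def)
  have carr: "K \<in> jj_carrier" "jj_bracket C C' \<in> jj_carrier"
    by (simp_all add: K_def jj_bracket_def jj_carrier_def)
  define D Q D' Q' where DQ: "D = jj_der C" "Q = jj_op C" "D' = jj_der C'" "Q' = jj_op C'"
  have dp: "der_pair D Q" "der_pair D' Q'"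
    by (simp_all add: DQ der_pair_jj)
  note hom = S0_module_hom[OF dp(1), of "X Bh"] S0_module_hom[OF dp(2), of "Y Bh"]
  \<comment> \<open>The coefficients are the values of \<open>sl2_kappa\<close>: \<open>2\<close> on
    \<open>e\<close>, \<open>f\<close> and \<open>4\<close> on \<open>h\<close>, \<open>h\<close>.
    In \<open>op_K\<close> they are divided by the \<open>4\<close> in \<open>jj_op\<close>.\<close>
  have der_K: "jj_der K x = scale 2 (der (X Be) (Y Bf) x) + scale 2 (der (X Bf) (Y Be) x)
      + scale 4 (der (X Bh) (Y Bh) x)" for x
    unfolding K_def jj_der_class lin_ext_sum lin_ext_scale
    by (simp add: UNIV_sl2_basis sl2_kappa_eq sl2_unit_def)
  have op_K: "jj_op K v = scaleV (1 / 2) (jrel (X Be) (Y Bf) v) + scaleV (1 / 2) (jrel (X Bf) (Y Be) v)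
      + jrel (X Bh) (Y Bh) v" for v
    unfolding K_def jj_op_class V.lin_ext_sum V.lin_ext_scale
    by (simp add: UNIV_sl2_basis sl2_kappa_eq sl2_unit_def)
  have der_B: "jj_der B x = jj_der K x + (D (D' x) - D' (D x))"
    and op_B: "jj_op B w = jj_op K w + (Q (Q' w) - Q' (Q w))" for x w
    by (simp_all add: B_def DQ jj_der_linear jj_op_linear jj_bracket_der_op carr uv)
  have Z: "Z Be = T0 (X Bh) D (Y Be) - T0 (Y Bh) D' (X Be)"
    "Z Bf = (D (Y Bf) - scale 2 (mult (X Bh) (Y Bf))) - (D' (X Bf) - scale 2 (mult (Y Bh) (X Bf)))"
    "Z Bh = mult (X Be) (Y Bf) - mult (X Bf) (Y Be) + D (Y Bh) - D' (X Bh)"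
    by (simp_all add: Z_def UNIV_sl2_basis sl2_bracket_def sl2_unit_def DQ mult_commute algebra_simps)
  have rho_diff_left: "\<rho> (x - y) w = \<rho> x w - \<rho> y w" for x y w
    using rho_add_left[of "x - y" y w] by (simp add: algebra_simps)
  define TX SX TY SY where TS: "TX = T0 (X Bh) D" "SX = S0 (X Bh) Q" "TY = T0 (Y Bh) D'" "SY = S0 (Y Bh) Q'"
  \<comment> \<open>The term with \<open>scale 4\<close> in \<open>der_K\<close> is the commutator
    of the multiplications by \<open>2 X Bh\<close> and \<open>2 Y Bh\<close>.\<close>
  have T: "T0 (Z Bh) (jj_der B) x = (T1 (X Be) (Y Bf) x - T1 (Y Be) (X Bf) x)
      + (TX (TY x) - TY (TX x))" for x
  proof -
    have "scale 4 w = scale 2 w + scale 2 w" for w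
      using scale_left_distrib[of 2 2 w] by simp
    then show ?thesis
      unfolding der_B der_K Z triple_def TS
      by (simp add: der_pairD[OF dp(1)] der_pairD[OF dp(2)] mult_add_left mult_add_right mult_diff_left
        mult_scale_left mult_scale_right scale_right_distrib scale_right_diff_distrib der_def
        mult_commute[of "X Bf" "Y Be"] algebra_simps)
  qed
  have S: "S0 (Z Bh) (jj_op B) w = (S1 (X Be) (Y Bf) w - S1 (Y Be) (X Bf) w)
      + (SX (SY w) - SY (SX w))" for w
    unfolding op_B op_K Z TS
    by (simp add: der_pairD[OF dp(1)] der_pairD[OF dp(2)] rho_add_left rho_diff_left rho_add
        op_comm_def mult_commute[of "X Bf" "Y Be"] V.scale_right_diff_distrib algebra_simps)
  have E: "Eop (Z Be) \<phi> = Eop (TX (Y Be)) \<phi> - Eop (TY (X Be)) \<phi>"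
    unfolding Z TS by (rule Eop_linear_left[OF \<phi>])
  have F_diff: "Fop (b - c) \<phi> = Fop b \<phi> - Fop c \<phi>" for b c
    using Fop_linear_left(1)[OF \<phi>, of "b - c" c] by simp
  let ?fX = "\<lambda>b. D b - scale 2 (mult (X Bh) b)" and ?fY = "\<lambda>b. D' b - scale 2 (mult (Y Bh) b)"
  have F: "Fop (Z Bf) \<phi> = Fop (?fX (Y Bf)) \<phi> - Fop (?fY (X Bf)) \<phi>"
    unfolding Z by (rule F_diff)
  have G: "Gop (T0 (Z Bh) (jj_der B)) (S0 (Z Bh) (jj_op B)) \<phi>
      = (Gop (T1 (X Be) (Y Bf)) (S1 (X Be) (Y Bf)) \<phi> - Gop (T1 (Y Be) (X Bf)) (S1 (Y Be) (X Bf)) \<phi>)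
      + (Gop TX SX (Gop TY SY \<phi>) - Gop TY SY (Gop TX SX \<phi>))"
    unfolding T S Gop_commutator[OF hom \<phi>, folded TS] Gop_pair_linear(1,2)[OF \<phi>, symmetric]
    by (simp only: TS)
  have GX: "Gop TX SX (Fop b \<phi>) = Fop b (Gop TX SX \<phi>) + Fop (?fX b) \<phi>"
    and GY: "Gop TY SY (Fop b \<phi>) = Fop b (Gop TY SY \<phi>) + Fop (?fY b) \<phi>" for b
    using Gop_Fop[OF dp(1) \<phi>, of "X Bh" b] Gop_Fop[OF dp(2) \<phi>, of "Y Bh" b]
    by (simp_all add: TS algebra_simps)
  have GE: "Gop T S (Eop a \<phi>) = Eop a (Gop T S \<phi>) + Eop (T a) \<phi>" for T S a
    by (simp add: Eop_Gop)
  note lin = Gop_linear[OF hom(1), folded TS] Gop_linear[OF hom(2), folded TS]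
  have co: "coact (sl2J_bracket u v) \<phi> = Eop (Z Be) \<phi> + Fop (Z Bf) \<phi>
      + Gop (T0 (Z Bh) (jj_der B)) (S0 (Z Bh) (jj_op B)) \<phi>"
    "coact u \<psi> = Eop (X Be) \<psi> + Fop (X Bf) \<psi> + Gop TX SX \<psi>"
    "coact v \<psi> = Eop (Y Be) \<psi> + Fop (Y Bf) \<psi> + Gop TY SY \<psi>" for \<psi>
    by (simp_all only: coact_def br[unfolded uv(1,2)] uv(1,2) DQ TS fst_conv snd_conv)
  show ?thesis
    unfolding co E F G Eop_linear Fop_linear lin Eop_Fop[OF \<phi>] GX GY GE
      Eop_commute[of "Y Be" "X Be"] Fop_commute[OF \<phi>, of "Y Bf" "X Bf"]
    by (simp add: algebra_simps)
qed

lemma coact_module: "sl2J_module fscale coind coact"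
  unfolding sl2J_module_def
proof (intro conjI ballI allI)
  show "vector_space fscale" ..
  show "fn.subspace coind" by (rule coind_subspace)
  have hom: "module_hom scale scale (T0 c (jj_der C))" "module_hom scaleV scaleV (S0 c (jj_op C))" for c C
    by (rule T0_module_hom S0_module_hom, rule der_pair_jj)+
  show "coact u \<phi> \<in> coind" if "\<phi> \<in> coind" for u \<phi>
    using that by (simp add: coact_def hom)
  show "coact u (\<phi> + \<psi>) = coact u \<phi> + coact u \<psi>" for u \<phi> \<psi>
    by (simp add: coact_def Eop_linear Fop_linear Gop_linear[OF hom(2)] algebra_simps)
  show "coact u (fscale r \<phi>) = fscale r (coact u \<phi>)" for u r \<phi>
    by (simp add: coact_def Eop_linear Fop_linear Gop_linear[OF hom(2)] fn.scale_right_distrib)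
  show "coact (sl2J_add u v) \<phi> = coact u \<phi> + coact v \<phi>"
    if uv: "u \<in> sl2J_carrier" "v \<in> sl2J_carrier" and \<phi>: "\<phi> \<in> coind" for u v \<phi>
  proof -
    have "snd u \<in> jj_carrier" "snd v \<in> jj_carrier"
      using uv by (auto simp: sl2J_carrier_def)
    then have "Gop (T0 (fst u Bh + fst v Bh) (jj_der (jj_add (snd u) (snd v))))
        (S0 (fst u Bh + fst v Bh) (jj_op (jj_add (snd u) (snd v)))) \<phi>
      = Gop (T0 (fst u Bh) (jj_der (snd u))) (S0 (fst u Bh) (jj_op (snd u))) \<phi>
      + Gop (T0 (fst v Bh) (jj_der (snd v))) (S0 (fst v Bh) (jj_op (snd v))) \<phi>"
      unfolding Gop_pair_linear(1)[OF \<phi>, symmetric]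
      by (intro arg_cong2[of _ _ _ _ "\<lambda>T S. Gop T S \<phi>"])
        (simp_all add: jj_der_linear jj_op_linear mult_add_left scale_right_distrib rho_add_left fun_eq_iff)
    then show ?thesis
      by (simp add: coact_def sl2J_add_def Eop_linear_left[OF \<phi>] Fop_linear_left[OF \<phi>] algebra_simps)
  qed
  show "coact (sl2J_scale r u) \<phi> = fscale r (coact u \<phi>)"
    if u: "u \<in> sl2J_carrier" and \<phi>: "\<phi> \<in> coind" for u r \<phi>
  proof -
    have "snd u \<in> jj_carrier"
      using u by (auto simp: sl2J_carrier_def)
    then have "Gop (T0 (scale r (fst u Bh)) (jj_der (jj_scale r (snd u))))
        (S0 (scale r (fst u Bh)) (jj_op (jj_scale r (snd u)))) \<phi>
      = fscale r (Gop (T0 (fst u Bh) (jj_der (snd u))) (S0 (fst u Bh) (jj_op (snd u))) \<phi>)"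
      unfolding Gop_pair_linear(3)[OF \<phi>, symmetric]
      by (intro arg_cong2[of _ _ _ _ "\<lambda>T S. Gop T S \<phi>"])
        (simp_all add: jj_der_linear jj_op_linear mult_scale_left scale_right_distrib rho_scale_left
          V.scale_right_distrib mult.commute fun_eq_iff)
    then show ?thesis
      by (simp add: coact_def sl2J_scale_def Eop_linear_left[OF \<phi>] Fop_linear_left[OF \<phi>]
          fn.scale_right_distrib)
  qed
  show "coact (sl2J_bracket u v) \<phi> = coact u (coact v \<phi>) - coact v (coact u \<phi>)"
    if "u \<in> sl2J_carrier" "v \<in> sl2J_carrier" "\<phi> \<in> coind" for u v \<phi>
    using that by (rule coact_bracket)
qed

sublocale co: sl2J_action scale mult one fscale coind coact
  by unfold_locales (rule coact_module)

lemma coact_tens: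
  assumes \<phi>: "\<phi> \<in> coind"
  shows "coact (tens (sl2_unit Be) a) \<phi> = Eop a \<phi>"
    and "coact (tens (sl2_unit Bf) a) \<phi> = Fop a \<phi>"
    and "coact (tens (sl2_unit Bh) a) \<phi> = Gop (\<lambda>x. scale 2 (mult a x)) (\<rho> a) \<phi>"
proof -
  have 0: "Eop 0 \<phi> = 0" "Fop 0 \<phi> = 0" "jj_op (jj_class 0) v = 0" "\<rho> 0 v = 0" for v
    using Eop_linear_left(3)[OF \<phi>, of 0 0] Fop_linear_left(2)[OF \<phi>, of 0 0]
      rho_scale_left[of 0 0 v] by (simp_all add: jj_op_class V.lin_ext_def)
  have "Gop (\<lambda>x. 0) (\<lambda>v. 0) \<phi> = 0"
    using Gop_pair_linear(3)[OF \<phi>, of 0 id id] by simp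
  then show "coact (tens (sl2_unit Be) a) \<phi> = Eop a \<phi>"
    "coact (tens (sl2_unit Bf) a) \<phi> = Fop a \<phi>"
    "coact (tens (sl2_unit Bh) a) \<phi> = Gop (\<lambda>x. scale 2 (mult a x)) (\<rho> a) \<phi>"
    by (simp_all add: coact_def tens_def sl2_unit_def 0 jj_der_0)
qed

end

section \<open>The submodule of \<open>f(1)\<close>-nilpotent elements\<close>

context J_rep
begin

abbreviation F0 :: "('j multiset \<Rightarrow> 'v) \<Rightarrow> 'j multiset \<Rightarrow> 'v" where
  "F0 \<equiv> Fop one"

lemma F0_power_coind [simp]: "\<phi> \<in> coind \<Longrightarrow> (F0 ^^ k) \<phi> \<in> coind"
  by (induction k) simp_all

lemma F0_power_linear:
  "(F0 ^^ k) (\<phi> + \<psi>) = (F0 ^^ k) \<phi> + (F0 ^^ k) \<psi>" "(F0 ^^ k) (fscale r \<phi>) = fscale r ((F0 ^^ k) \<phi>)"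
  "(F0 ^^ k) 0 = 0"
proof -
  have "F0 0 = 0"
    using Fop_linear(3)[of one 0 0] by simp
  then show "(F0 ^^ k) 0 = 0" by (induction k) simp_all
  show "(F0 ^^ k) (\<phi> + \<psi>) = (F0 ^^ k) \<phi> + (F0 ^^ k) \<psi>"
    "(F0 ^^ k) (fscale r \<phi>) = fscale r ((F0 ^^ k) \<phi>)"
    by (induction k) (simp_all add: Fop_linear)
qed

definition nilp :: "('j multiset \<Rightarrow> 'v) set" where
  "nilp = {\<phi> \<in> coind. \<exists>k. (F0 ^^ k) \<phi> = 0}"

lemma nilpI: "\<phi> \<in> coind \<Longrightarrow> (F0 ^^ k) \<phi> = 0 \<Longrightarrow> \<phi> \<in> nilp"
  unfolding nilp_def by blast

lemma nilpE:
  assumes "\<phi> \<in> nilp"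
  obtains k where "\<phi> \<in> coind" "(F0 ^^ k) \<phi> = 0"
  using assms unfolding nilp_def by blast

lemma nilp_coind: "\<phi> \<in> nilp \<Longrightarrow> \<phi> \<in> coind"
  by (simp add: nilp_def)

lemma nilp_subspace: "fn.subspace nilp"
proof (rule fn.subspaceI)
  show "0 \<in> nilp" by (rule nilpI[of _ 0]) simp_all
  show "\<phi> + \<psi> \<in> nilp" if asm: "\<phi> \<in> nilp" "\<psi> \<in> nilp" for \<phi> \<psi>
  proof -
    obtain k l where kl: "(F0 ^^ k) \<phi> = 0" "(F0 ^^ l) \<psi> = 0"
      using asm unfolding nilp_def by blast
    have "(F0 ^^ (l + k)) \<phi> = 0" "(F0 ^^ (k + l)) \<psi> = 0"
      unfolding funpow_add o_apply kl F0_power_linear by simp_all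
    then have "(F0 ^^ (k + l)) \<phi> = 0" "(F0 ^^ (k + l)) \<psi> = 0"
      by (simp_all only: add.commute)
    then have "(F0 ^^ (k + l)) (\<phi> + \<psi>) = 0"
      by (simp add: F0_power_linear)
    then show ?thesis
      using asm nilpI nilp_coind coind_closed(2) by metis
  qed
  show "fscale r \<phi> \<in> nilp" if "\<phi> \<in> nilp" for r \<phi>
  proof (rule nilpE[OF that])
    fix k assume "\<phi> \<in> coind" "(F0 ^^ k) \<phi> = 0"
    then show ?thesis
      by (intro nilpI[of _ k]) (simp_all only: coind_closed F0_power_linear fn.scale_zero_right)
  qed
qed

lemma nilp_add: "\<phi> \<in> nilp \<Longrightarrow> \<psi> \<in> nilp \<Longrightarrow> \<phi> + \<psi> \<in> nilp"
  and nilp_diff: "\<phi> \<in> nilp \<Longrightarrow> \<psi> \<in> nilp \<Longrightarrow> \<phi> - \<psi> \<in> nilp"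
  using nilp_subspace by (auto intro: fn.subspace_add fn.subspace_diff)

lemma nilpI_F0: "\<phi> \<in> coind \<Longrightarrow> F0 \<phi> \<in> nilp \<Longrightarrow> \<phi> \<in> nilp"
  unfolding nilp_def mem_Collect_eq by (metis comp_apply funpow_Suc_right)

lemma nilp_Fop: "\<phi> \<in> nilp \<Longrightarrow> Fop b \<phi> \<in> nilp"
proof -
  assume "\<phi> \<in> nilp"
  then obtain k where k: "\<phi> \<in> coind" "(F0 ^^ k) \<phi> = 0"
    by (rule nilpE)
  have "(F0 ^^ k) (Fop b \<phi>) = Fop b ((F0 ^^ k) \<phi>)"
    using k(1) by (induction k) (simp_all add: Fop_commute[of _ one b])
  also have "\<dots> = 0"
    using k(2) Fop_linear(3)[of b 0 0] by simp
  finally show ?thesis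
    using k(1) by (intro nilpI) simp_all
qed

text \<open>
  Since \<open>ad f(1)\<close> lowers the degree, the three pieces of the grading are treated in the order
  \<open>f\<close>, degree zero, \<open>e\<close>.
\<close>
lemma nilp_Gop:
  assumes dp: "der_pair D Q" and "\<phi> \<in> nilp"
  shows "Gop (T0 c D) (S0 c Q) \<phi> \<in> nilp"
proof -
  note hom = T0_module_hom[OF dp] S0_module_hom[OF dp]
  have "Gop (T0 c D) (S0 c Q) \<phi> \<in> nilp" if "\<phi> \<in> coind" "(F0 ^^ k) \<phi> = 0" for k
    using that
  proof (induction k arbitrary: \<phi>)
    case 0
    then have "\<phi> = 0" unfolding funpow.simps id_apply by blast
    moreover have "Gop (T0 c D) (S0 c Q) 0 = 0"
      using Gop_linear(3)[OF hom(2), of "T0 c D" c 0 0] by simp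
    ultimately show ?case
      using fn.subspace_0[OF nilp_subspace] by metis
  next
    case (Suc k)
    have "F0 (Gop (T0 c D) (S0 c Q) \<phi>) = Gop (T0 c D) (S0 c Q) (F0 \<phi>)
        - Fop (D one - scale 2 (mult c one)) \<phi>"
      using Gop_Fop[OF dp Suc.prems(1), of c one] by (simp add: algebra_simps)
    moreover have "Gop (T0 c D) (S0 c Q) (F0 \<phi>) \<in> nilp"
      using Suc.prems by (intro Suc.IH) (simp_all del: funpow.simps add: funpow_Suc_right)
    moreover have "\<phi> \<in> nilp"
      using Suc.prems by (rule nilpI)
    ultimately have "F0 (Gop (T0 c D) (S0 c Q) \<phi>) \<in> nilp"
      by (simp add: nilp_diff nilp_Fop)
    then show ?case
      using Suc.prems(1) hom by (rule_tac nilpI_F0) simp_all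
  qed
  then show ?thesis using nilpE[OF assms(2)] by metis
qed

lemma nilp_Eop:
  assumes "\<phi> \<in> nilp"
  shows "Eop a \<phi> \<in> nilp"
proof -
  have "Eop a \<phi> \<in> nilp" if "\<phi> \<in> coind" "(F0 ^^ k) \<phi> = 0" for k
    using that
  proof (induction k arbitrary: \<phi>)
    case 0
    then have "\<phi> = 0" unfolding funpow.simps id_apply by blast
    moreover have "Eop a 0 = 0"
      using Eop_linear(3)[of a 0 0] by simp
    ultimately show ?case
      using fn.subspace_0[OF nilp_subspace] by metis
  next
    case (Suc k)
    have "F0 (Eop a \<phi>) = Eop a (F0 \<phi>) - Gop (T1 a one) (S1 a one) \<phi>"
      using Eop_Fop[OF Suc.prems(1), of a one] by (simp add: algebra_simps)
    moreover have "Eop a (F0 \<phi>) \<in> nilp"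
      using Suc.prems by (intro Suc.IH) (simp_all del: funpow.simps add: funpow_Suc_right)
    moreover have "\<phi> \<in> nilp"
      using Suc.prems by (rule nilpI)
    then have "Gop (T1 a one) (S1 a one) \<phi> \<in> nilp"
      unfolding T1_eq_T0 by (rule nilp_Gop[OF der_pair_S1])
    ultimately have "F0 (Eop a \<phi>) \<in> nilp"
      by (simp add: nilp_diff)
    then show ?case
      using Suc.prems(1) by (rule_tac nilpI_F0) simp_all
  qed
  then show ?thesis using nilpE[OF assms] by metis
qed

lemma nilp_module: "sl2J_module fscale nilp coact"
proof (rule submodule[OF coact_module])
  show "nilp \<subseteq> coind" by (auto simp: nilp_def)
  show "fn.subspace nilp" by (rule nilp_subspace)
  show "coact u \<phi> \<in> nilp" if "\<phi> \<in> nilp" for u \<phi>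
    unfolding coact_def using that
    by (intro nilp_add nilp_Eop nilp_Fop nilp_Gop der_pair_jj)
qed

section \<open>Degrees and weights\<close>

definition cut :: "nat \<Rightarrow> ('j multiset \<Rightarrow> 'v) \<Rightarrow> 'j multiset \<Rightarrow> 'v" where
  "cut r \<phi> = (\<lambda>A. if size A = r then \<phi> A else 0)"

lemma cut_coind [simp]: "\<phi> \<in> coind \<Longrightarrow> cut r \<phi> \<in> coind"
  by (simp add: coind_def cut_def)

lemma S1_zero: "S1 a b 0 = 0"
  using module_hom.zero[OF S1_module_hom] .

text \<open>Every term of \<open>Fop b \<phi> A\<close> evaluates \<open>\<phi>\<close> at a
  multiset with one element less than \<open>A\<close>.\<close>

lemma Fop_cut: "Fop b (cut r \<phi>) = cut (Suc r) (Fop b \<phi>)"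
proof
  fix A :: "'j multiset"
  have "size (A - {#x#}) = r \<longleftrightarrow> size A = Suc r" if "x \<in># A" for x
    using that by (auto simp: size_Diff_singleton) (metis Suc_pred nonempty_has_size empty_iff set_mset_empty)
  moreover have "size (add_mset z (A - {#x#} - {#y#})) = size (A - {#x#})" if "y \<in># A - {#x#}" for x y z
    using that by (metis insert_DiffM size_add_mset)
  ultimately have "S1 x b (cut r \<phi> (A - {#x#}))
      - (\<Sum>y\<in>#A - {#x#}. cut r \<phi> (add_mset (triple x b y) (A - {#x#} - {#y#})))
    = (if size A = Suc r then S1 x b (\<phi> (A - {#x#}))
      - (\<Sum>y\<in>#A - {#x#}. \<phi> (add_mset (triple x b y) (A - {#x#} - {#y#}))) else 0)" if "x \<in># A" for x
    using that unfolding cut_def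
    by (auto simp: S1_zero[simplified] rho_zero op_comm_def cong: image_mset_cong)
  then show "Fop b (cut r \<phi>) A = cut (Suc r) (Fop b \<phi>) A"
    by (simp add: Fop_def cut_def[of "Suc r"] cong: image_mset_cong)
qed

lemma F0_power_cut: "(F0 ^^ k) (cut r \<phi>) = cut (r + k) ((F0 ^^ k) \<phi>)"
  by (induction k) (simp_all add: Fop_cut)

lemma cut_nilp: "\<phi> \<in> nilp \<Longrightarrow> cut r \<phi> \<in> nilp"
proof (elim nilpE)
  fix k assume "\<phi> \<in> coind" "(F0 ^^ k) \<phi> = 0"
  then show "cut r \<phi> \<in> nilp"
    by (intro nilpI[of _ k]) (simp_all add: F0_power_cut, simp add: cut_def fun_eq_iff)
qed

lemma Gop_one:
  assumes \<phi>: "\<phi> \<in> coind"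
  shows "Gop (scale 2) (\<rho> one) \<phi> A = scaleV (of_nat n - 2 * of_nat (size A)) (\<phi> A)"
proof -
  have "(\<Sum>x\<in>#A. \<phi> (add_mset (scale 2 x) (A - {#x#}))) = (\<Sum>x\<in>#A. scaleV 2 (\<phi> A))"
    by (rule sum_mset_cong_in) (simp add: coindD[OF \<phi>])
  also have "\<dots> = scaleV (of_nat (size A)) (scaleV 2 w)" if "w = \<phi> A" for w
    unfolding that[symmetric] by (induction A) (simp_all add: V.scale_left_distrib)
  finally show ?thesis
    by (simp add: Gop_def rho_one V.scale_left_diff_distrib mult.commute)
qed

abbreviation E0 :: "('j multiset \<Rightarrow> 'v) \<Rightarrow> 'j multiset \<Rightarrow> 'v" where
  "E0 \<equiv> Eop one"

lemma E0_F0: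
  assumes "\<phi> \<in> coind"
  shows "E0 (F0 \<phi>) A = F0 (E0 \<phi>) A + scaleV (of_nat n - 2 * of_nat (size A)) (\<phi> A)"
proof -
  have "der one one x = 0" for x by (simp add: der_self)
  then have "T1 one one = scale 2" by (simp add: triple_def mult_one_left fun_eq_iff)
  moreover have "S1 one one = \<rho> one"
    by (simp add: fun_eq_iff op_comm_def mult_one_left)
  ultimately show ?thesis
    using Gop_one[OF assms] by (simp add: Eop_Fop[OF assms])
qed

lemma E0_power_coind [simp]: "\<phi> \<in> coind \<Longrightarrow> (E0 ^^ k) \<phi> \<in> coind"
  by (induction k) simp_all

lemma Eop_power: "(Eop a ^^ k) \<phi> A = \<phi> (A + replicate_mset k a)"
  by (induction k arbitrary: A) (simp_all add: Eop_def)

text \<open>A lowest weight vector of \<open>sl2\<close> of weight \<open>-j\<close> with \<open>j \<ge> 0\<close> survives \<open>e\<^sup>j\<close>.\<close>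
lemma lowest_weight_eq_0:
  assumes \<phi>: "\<phi> \<in> coind" "cut r \<phi> = \<phi>" "F0 \<phi> = 0" and r: "n < r"
  shows "\<phi> = 0"
proof -
  have supp: "\<phi> A = 0" if "size A \<noteq> r" for A
    using that \<phi>(2) by (metis cut_def)
  \<comment> \<open>The usual \<open>sl2\<close> coefficient for a lowest weight vector of weight
    \<open>n - 2 r\<close>: the factor \<open>2 r - n - i\<close> stays positive for
    \<open>i \<le> r\<close> because \<open>n < r\<close>.\<close>
  define c :: "nat \<Rightarrow> 'k" where
    "c i = of_nat (Suc i) * (2 * of_nat r - of_nat n - of_nat i)" for i
  have c: "F0 ((E0 ^^ Suc i) \<phi>) = fscale (c i) ((E0 ^^ i) \<phi>)" for i
  proof (induction i)
    have step: "F0 ((E0 ^^ Suc i) \<phi>) A = E0 (F0 ((E0 ^^ i) \<phi>)) A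
        + scaleV (2 * of_nat r - of_nat n - 2 * of_nat i) ((E0 ^^ i) \<phi> A)" for i A
    proof (cases "size A + i = r")
      case True
      then have eq: "(of_nat n - 2 * of_nat (size A) :: 'k) = - (2 * of_nat r - of_nat n - 2 * of_nat i)"
        by (auto simp flip: True)
      show ?thesis
        unfolding funpow.simps o_apply E0_F0[OF E0_power_coind[OF \<phi>(1)]] eq V.scale_minus_left
        by (simp only: add.assoc add.left_inverse add.right_neutral)
    next
      case False
      then have "(E0 ^^ i) \<phi> A = 0"
        by (simp add: Eop_power supp)
      then show ?thesis
        using E0_F0[of "(E0 ^^ i) \<phi>" A] \<phi>(1) by simp
    qed
    {
      case 0
      show ?case
        using step[of 0] \<phi>(3) by (simp add: fun_eq_iff fscale_def c_def Eop_def)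
    next
      case (Suc i)
      have "c i + (2 * of_nat r - of_nat n - 2 * of_nat (Suc i)) = c (Suc i)"
        by (simp add: c_def algebra_simps)
      moreover have "E0 (fscale (c i) ((E0 ^^ i) \<phi>)) = fscale (c i) ((E0 ^^ Suc i) \<phi>)"
        by (simp add: Eop_linear)
      ultimately show ?case
        using step[of "Suc i"] unfolding Suc.IH
        by (simp add: fun_eq_iff fscale_def del: funpow.simps flip: V.scale_left_distrib)
    }
  qed
  have nonzero: "c i \<noteq> 0" if "i \<le> r" for i
  proof -
    have "2 * of_nat r - of_nat n - of_nat i = (of_nat (2 * r - n - i) :: 'k)"
      using that r by (simp add: of_nat_diff)
    moreover have "2 * r - n - i \<noteq> 0"
      using that r by simp
    ultimately show ?thesis by (simp only: c_def mult_eq_0_iff of_nat_eq_0_iff) simp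
  qed
  \<comment> \<open>Applying \<open>E0\<close> more than \<open>r\<close> times leads to values on
    multisets with more than \<open>r\<close> elements, where \<open>\<phi>\<close> is zero. From
    here the nonzero \<open>c i\<close> carry the vanishing down to \<open>\<phi>\<close>.\<close>
  have top: "(E0 ^^ Suc r) \<phi> = 0"
    unfolding fun_eq_iff Eop_power by (simp add: supp)
  have "(E0 ^^ 0) \<phi> = 0"
  proof (rule inc_induct[of 0 "Suc r" "\<lambda>i. (E0 ^^ i) \<phi> = 0"])
    show "(E0 ^^ i) \<phi> = 0" if "i < Suc r" "(E0 ^^ Suc i) \<phi> = 0" for i
    proof -
      have "fscale (c i) ((E0 ^^ i) \<phi>) = 0"
        using c[of i] that(2) F0_power_linear(3)[of 1] by simp
      then show ?thesis
        using nonzero[of i] that(1) by (simp add: fn.scale_eq_0_iff)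
    qed
  qed (simp, rule top)
  then show ?thesis unfolding funpow.simps id_apply .
qed

text \<open>For a component of degree \<open>r > n\<close>, induction on the nilpotency exponent
  shows that its image under \<open>F0\<close>, of degree \<open>r + 1\<close>, is zero. The
  component is then a lowest weight vector of negative weight and vanishes too.\<close>

lemma nilp_support:
  assumes \<phi>: "\<phi> \<in> nilp" and "n < size A"
  shows "\<phi> A = 0"
proof -
  have *: "\<psi> = 0" if "\<psi> \<in> coind" "cut r \<psi> = \<psi>" "(F0 ^^ k) \<psi> = 0" "n < r" for \<psi> r k
    using that
  proof (induction k arbitrary: \<psi> r)
    case (Suc k)
    have "F0 \<psi> = 0"
    proof (rule Suc.IH)
      show "cut (Suc r) (F0 \<psi>) = F0 \<psi>"
        unfolding Fop_cut[symmetric] Suc.prems(2) ..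
      show "(F0 ^^ k) (F0 \<psi>) = 0"
        using Suc.prems(3) unfolding funpow_Suc_right o_apply .
    qed (use Suc.prems in simp_all)
    then show ?case
      using Suc.prems lowest_weight_eq_0 by blast
  qed simp
  let ?\<psi> = "cut (size A) \<phi>"
  obtain k where "(F0 ^^ k) ?\<psi> = 0"
    using cut_nilp[OF \<phi>, of "size A"] by (rule nilpE)
  moreover have "cut (size A) ?\<psi> = ?\<psi>"
    by (simp add: cut_def fun_eq_iff)
  ultimately have "?\<psi> = 0"
    using *[of ?\<psi> "size A" k] cut_coind[OF nilp_coind[OF \<phi>]] \<open>n < size A\<close> by blast
  then show ?thesis
    by (simp add: cut_def fun_eq_iff) metis
qed

end

section \<open>Polarization and sufficiency of the identity\<close>

context J_rep
begin

text \<open>The linear coefficient is the one wanted. The constant one is tracked because it feeds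
  the linear coefficient in the induction, when \<open>b\<close> is chosen for the first
  argument.\<close>

lemma replicate_expansion:
  assumes "\<psi> \<in> coind"
  shows "\<exists>c. c 0 = \<psi> (replicate_mset N a) \<and>
    c 1 = scaleV (of_nat N) (\<psi> (add_mset b (replicate_mset (N - 1) a))) \<and>
    (\<forall>k>N. c k = 0) \<and>
    (\<forall>t. \<psi> (replicate_mset N (a + scale t b)) = (\<Sum>k\<le>N. scaleV (t ^ k) (c k)))"
  using assms
proof (induction N arbitrary: \<psi>)
  case 0
  show ?case by (rule exI[of _ "\<lambda>k. if k = 0 then \<psi> {#} else 0"]) simp
next
  case (Suc N)
  obtain cA where cA: "cA 0 = Eop a \<psi> (replicate_mset N a)"
    "cA 1 = scaleV (of_nat N) (Eop a \<psi> (add_mset b (replicate_mset (N - 1) a)))"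
    "\<And>k. k > N \<Longrightarrow> cA k = 0"
    "\<And>t. Eop a \<psi> (replicate_mset N (a + scale t b)) = (\<Sum>k\<le>N. scaleV (t ^ k) (cA k))"
    using Suc.IH[OF Eop_coind[OF Suc.prems, of a]] by blast
  obtain cB where cB: "cB 0 = Eop b \<psi> (replicate_mset N a)"
    "\<And>k. k > N \<Longrightarrow> cB k = 0"
    "\<And>t. Eop b \<psi> (replicate_mset N (a + scale t b)) = (\<Sum>k\<le>N. scaleV (t ^ k) (cB k))"
    using Suc.IH[OF Eop_coind[OF Suc.prems, of b]] by blast
  let ?c = "\<lambda>k. cA k + (if k = 0 then 0 else cB (k - 1))"
  show ?case
  proof (intro exI[of _ ?c] conjI allI impI)
    show "?c 0 = \<psi> (replicate_mset (Suc N) a)"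
      by (simp add: cA Eop_def)
    have "cA 1 = scaleV (of_nat N) (\<psi> (add_mset b (replicate_mset N a)))"
      using cA(2) by (cases N) (simp_all add: Eop_def add_mset_commute)
    then show "?c 1 = scaleV (of_nat (Suc N)) (\<psi> (add_mset b (replicate_mset (Suc N - 1) a)))"
      using cB(1) by (simp add: Eop_def V.scale_left_distrib add.commute)
    show "?c k = 0" if "Suc N < k" for k
      using that cA(3) cB(2) by simp
    fix t
    have "\<psi> (replicate_mset (Suc N) (a + scale t b))
        = (\<Sum>k\<le>N. scaleV (t ^ k) (cA k)) + scaleV t (\<Sum>k\<le>N. scaleV (t ^ k) (cB k))"
      unfolding cA(4)[symmetric] cB(3)[symmetric] by (simp add: Eop_def coindD[OF Suc.prems])
    also have "(\<Sum>k\<le>N. scaleV (t ^ k) (cA k)) = (\<Sum>k\<le>Suc N. scaleV (t ^ k) (cA k))"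
      by (simp add: cA(3))
    also have "scaleV t (\<Sum>k\<le>N. scaleV (t ^ k) (cB k))
        = (\<Sum>k\<le>Suc N. scaleV (t ^ k) (if k = 0 then 0 else cB (k - 1)))"
      by (subst sum.atMost_Suc_shift) (simp add: V.scale_sum_right)
    finally show "\<psi> (replicate_mset (Suc N) (a + scale t b)) = (\<Sum>k\<le>Suc N. scaleV (t ^ k) (?c k))"
      by (simp only: V.scale_right_distrib sum.distrib)
  qed
qed

text \<open>If \<open>\<psi>\<close> vanishes on the diagonal, so does the linear coefficient in
  \<open>t\<close> of its value at copies of \<open>a + t b\<close>. Thus
  \<open>Eop b \<psi>\<close> vanishes on the diagonal as well, in one argument less.\<close>

lemma polarization:
  assumes "\<psi> \<in> coind" "\<And>a. \<psi> (replicate_mset N a) = 0" "size A = N"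
  shows "\<psi> A = 0"
  using assms
proof (induction N arbitrary: \<psi> A)
  case 0
  then show ?case by simp
next
  case (Suc N)
  obtain b A' where A: "A = add_mset b A'"
    using Suc.prems(3) by (cases A) auto
  have "Eop b \<psi> A' = 0"
  proof (rule Suc.IH)
    fix a
    obtain c where c: "c 1 = scaleV (of_nat (Suc N)) (\<psi> (add_mset b (replicate_mset N a)))"
      "\<And>t. \<psi> (replicate_mset (Suc N) (a + scale t b)) = (\<Sum>k\<le>Suc N. scaleV (t ^ k) (c k))"
      using replicate_expansion[OF Suc.prems(1), of "Suc N" a b] by auto
    have "c 1 = 0"
    proof (rule V.vector_polynomial_eq_0[where K = "Suc N" and c = c])
      show "(\<Sum>k\<le>Suc N. scaleV (t ^ k) (c k)) = 0" for t
        using c(2)[of t] Suc.prems(2)[of "a + scale t b"] by metis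
    qed simp
    then show "Eop b \<psi> (replicate_mset N a) = 0"
      unfolding c(1) V.scale_eq_0_iff of_nat_eq_0_iff by (simp add: Eop_def)
  qed (use Suc.prems A in simp_all)
  then show ?case by (simp add: A Eop_def)
qed

definition delta :: "'v \<Rightarrow> 'j multiset \<Rightarrow> 'v" where
  "delta v = (\<lambda>A. if A = {#} then v else 0)"

lemma delta_coind [simp]: "delta v \<in> coind"
  by (simp add: coind_def delta_def)

lemma coact_h_delta: "coact (tens (sl2_unit Bh) a) (delta v) = delta (\<rho> a v)"
  unfolding coact_tens(3)[OF delta_coind]
  by (auto simp: Gop_def delta_def fun_eq_iff rho_zero)

lemma funpow_cong_on:
  assumes "\<And>x. x \<in> X \<Longrightarrow> f x = g x" "\<And>x. x \<in> X \<Longrightarrow> g x \<in> X" "x \<in> X"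
  shows "(f ^^ k) x = (g ^^ k) x"
proof -
  have "(f ^^ k) x = (g ^^ k) x \<and> (g ^^ k) x \<in> X"
    using assms by (induction k) simp_all
  then show ?thesis by simp
qed

lemma linear_delta: "Vector_Spaces.linear scaleV fscale delta"
  unfolding Vector_Spaces.linear_def module_hom_def module_hom_axioms_def
  by (simp add: V.vector_space_axioms fn.vector_space_axioms V.module_axioms fn.module_axioms
      delta_def fscale_def fun_eq_iff)

text \<open>\<open>e(J)\<close> annihilates functions of degree zero, so Garland's formula applies
  to the vectors \<open>delta (elem a v s)\<close> and yields the diagonal values of the symmetric
  function \<open>?\<psi>\<close>, which is concentrated in degree \<open>Suc n\<close>.\<close>

lemma delta_nilp:
  assumes elem: "\<And>a v. elem a v (Suc n) = 0"
  shows "delta v \<in> nilp"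
proof (rule nilpI)
  show "delta v \<in> coind" by simp
  interpret d: Vector_Spaces.linear scaleV fscale delta by (rule linear_delta)
  let ?\<psi> = "(F0 ^^ Suc n) (delta v)"
  have \<psi>: "?\<psi> \<in> coind" by (rule F0_power_coind) simp
  have "?\<psi> (replicate_mset (Suc n) a) = 0" for a
  proof -
    have p: "delta (elem a v s) \<in> coind" "Eop a (delta (elem a v s)) = 0" for s
      by (simp, simp add: Eop_def delta_def fun_eq_iff)
    have "(co.E a ^^ Suc n) ((co.F one ^^ Suc n) (delta (elem a v 0)))
        = fscale (fact (Suc n) * fact (Suc n)) (delta (elem a v (Suc n)))"
    proof (rule co.E_power_F_power)
      show "delta (elem a v s) \<in> coind" for s by simp
      show "co.E a (delta (elem a v s)) = 0" for s
        unfolding coact_tens(1)[OF p(1)] by (rule p(2))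
      show "fscale (of_nat (Suc s)) (delta (elem a v (Suc s)))
        = (\<Sum>i\<le>s. fscale ((- 1) ^ i) (co.H (jpow a (Suc i)) (delta (elem a v (s - i)))))" for s
        unfolding coact_h_delta d.scale[symmetric] elem_Suc d.sum ..
    qed
    moreover have "(co.F one ^^ Suc n) (delta v) = ?\<psi>"
      by (rule funpow_cong_on[of coind]) (simp_all add: coact_tens)
    moreover have "(co.E a ^^ Suc n) ?\<psi> = (Eop a ^^ Suc n) ?\<psi>"
      using \<psi> by (intro funpow_cong_on[of coind]) (simp_all add: coact_tens)
    ultimately have "(Eop a ^^ Suc n) ?\<psi> = 0"
      unfolding elem elem_0 d.zero fn.scale_zero_right by simp
    \<comment> \<open>At the empty multiset, the power of \<open>Eop a\<close> returns the value of
      \<open>?\<psi>\<close> at \<open>Suc n\<close> copies of \<open>a\<close>.\<close>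
    then have "(Eop a ^^ Suc n) ?\<psi> {#} = 0"
      by (simp only: zero_fun_apply)
    then show ?thesis
      unfolding Eop_power by simp
  qed
  then have "?\<psi> A = 0" if "size A = Suc n" for A
    using polarization[OF \<psi>] that by blast
  moreover have "?\<psi> A = 0" if "size A \<noteq> Suc n" for A
  proof -
    have "cut 0 (delta v) = delta v"
      by (auto simp: cut_def delta_def fun_eq_iff)
    then have "?\<psi> = cut (Suc n) ?\<psi>"
      using F0_power_cut[of "Suc n" 0 "delta v"] by (simp only: add_0)
    then have "?\<psi> A = cut (Suc n) ?\<psi> A" by (rule fun_cong)
    also have "\<dots> = 0" using that by (simp add: cut_def)
    finally show ?thesis .
  qed
  ultimately show "?\<psi> = 0"
    unfolding fun_eq_iff zero_fun_apply by blast
qed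

section \<open>Weight decomposition of the nilpotent part\<close>

lemma coact_h_one:
  assumes "\<phi> \<in> coind"
  shows "coact (tens (sl2_unit Bh) one) \<phi> A = scaleV (of_int (int n - 2 * int (size A))) (\<phi> A)"
  using Gop_one[OF assms, of A] unfolding coact_tens(3)[OF assms] mult_one_left by simp

lemma weight_space_nilp:
  "weight_space fscale nilp coact j = {\<phi> \<in> nilp. \<forall>A. int n - 2 * int (size A) \<noteq> j \<longrightarrow> \<phi> A = 0}"
proof -
  have "coact (tens (sl2_unit Bh) one) \<phi> = fscale (of_int j) \<phi> \<longleftrightarrow>
      (\<forall>A. int n - 2 * int (size A) \<noteq> j \<longrightarrow> \<phi> A = 0)" if "\<phi> \<in> nilp" for \<phi>
  proof -
    have "coact (tens (sl2_unit Bh) one) \<phi> A = fscale (of_int j) \<phi> A \<longleftrightarrow>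
      (int n - 2 * int (size A) \<noteq> j \<longrightarrow> \<phi> A = 0)" for A
      unfolding coact_h_one[OF nilp_coind[OF that]] fscale_def V.scale_cancel_right of_int_eq_iff by blast
    then show ?thesis unfolding fun_eq_iff by blast
  qed
  then show ?thesis
    unfolding weight_space_def by blast
qed

lemma sum_fun_apply: "(\<Sum>i\<in>S. f i) x = (\<Sum>i\<in>S. f i x)"
  for f :: "'i \<Rightarrow> 'x \<Rightarrow> 'y::ab_group_add"
  by (induction S rule: infinite_finite_induct) simp_all

text \<open>The part of degree \<open>r\<close> has weight \<open>n - 2 r\<close>, and
  \<open>nilp_support\<close> keeps these weights in the required range; weights of the other parity
  have zero component. Uniqueness holds because different weights live on multisets of different
  sizes.\<close>

lemma nilp_decomposition:
  assumes \<phi>: "\<phi> \<in> nilp"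
  shows "\<exists>!c. (\<forall>j\<in>{- int n..int n}. c j \<in> weight_space fscale nilp coact j) \<and>
    (\<forall>j. j \<notin> {- int n..int n} \<longrightarrow> c j = 0) \<and> \<phi> = (\<Sum>j\<in>{- int n..int n}. c j)"
proof -
  let ?I = "{- int n..int n}"
  define c where "c j = (\<lambda>A. if int n - 2 * int (size A) = j then \<phi> A else 0)" for j
  have supp: "\<phi> A = 0" if "int n - 2 * int (size A) \<notin> ?I" for A
    using that by (intro nilp_support[OF \<phi>]) auto
  have c_nilp: "c j \<in> nilp" for j
  proof (cases "\<exists>r. j = int n - 2 * int r")
    case True
    then obtain r where "j = int n - 2 * int r" by blast
    then have "c j = cut r \<phi>"
      by (simp add: c_def cut_def fun_eq_iff)
    then show ?thesis using cut_nilp[OF \<phi>] by metis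
  next
    case False
    then have "c j = 0"
      by (auto simp: c_def fun_eq_iff)
    then show ?thesis using fn.subspace_0[OF nilp_subspace] by metis
  qed
  show ?thesis
  proof (rule ex1I[of _ c], intro conjI ballI allI impI)
    show "c j \<in> weight_space fscale nilp coact j" for j
      unfolding weight_space_nilp using c_nilp by (simp add: c_def)
    show "c j = 0" if "j \<notin> ?I" for j
      using that supp by (auto simp: c_def fun_eq_iff)
    show "\<phi> = (\<Sum>j\<in>?I. c j)"
    proof
      fix A
      show "\<phi> A = (\<Sum>j\<in>?I. c j) A"
        using supp[of A] unfolding sum_fun_apply c_def by (subst sum.delta') auto
    qed
  next
    fix d assume d: "(\<forall>j\<in>?I. d j \<in> weight_space fscale nilp coact j) \<and>
      (\<forall>j. j \<notin> ?I \<longrightarrow> d j = 0) \<and> \<phi> = (\<Sum>j\<in>?I. d j)"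
    have d0: "d j A = 0" if "int n - 2 * int (size A) \<noteq> j" for j A
      using d that unfolding weight_space_nilp by (cases "j \<in> ?I") auto
    show "d = c"
    proof (intro ext)
      fix j A
      have "\<phi> A = (\<Sum>i\<in>?I. d i A)"
        using d by (metis sum_fun_apply)
      also have "\<dots> = (\<Sum>i\<in>?I. if i = int n - 2 * int (size A) then d (int n - 2 * int (size A)) A else 0)"
        using d0 by (intro sum.cong) auto
      also have "\<dots> = d (int n - 2 * int (size A)) A"
        using d by (subst sum.delta) auto
      finally show "d j A = c j A"
        using d0[of A j] by (simp add: c_def)
    qed
  qed
qed

text \<open>The top weight space of \<open>nilp\<close> consists of the functions of degree zero, a
  copy of \<open>V\<close>; it is nonzero because \<open>V\<close> is. Dominance is first obtained
  over the type \<open>'j multiset \<Rightarrow> 'v\<close> and then transferred.\<close>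

lemma elem_eq_0_imp_dominant:
  assumes elem: "\<And>a v. elem a v (Suc n) = 0" and nonzero: "\<exists>v :: 'v. v \<noteq> 0"
  shows "dominant scaleV \<rho> n"
proof (rule dominant_in_imp_dominant)
  have top: "weight_space fscale nilp coact (int n) = range delta"
  proof
    show "range delta \<subseteq> weight_space fscale nilp coact (int n)"
      unfolding weight_space_nilp using delta_nilp[OF elem] by (auto simp: delta_def)
    show "weight_space fscale nilp coact (int n) \<subseteq> range delta"
    proof
      fix \<phi> assume "\<phi> \<in> weight_space fscale nilp coact (int n)"
      then have "\<phi> A = 0" if "A \<noteq> {#}" for A
        using that unfolding weight_space_nilp by simp
      then have "\<phi> = delta (\<phi> {#})"
        by (auto simp: delta_def fun_eq_iff)
      then show "\<phi> \<in> range delta" by blast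
    qed
  qed
  have inj: "inj delta"
    by (rule injI) (metis delta_def)
  have "bounded_module fscale nilp coact n"
    unfolding bounded_module_def
  proof (intro conjI ballI)
    show "weight_space fscale nilp coact (int n) \<noteq> {0}"
    proof -
      obtain v :: 'v where "v \<noteq> 0" using nonzero by blast
      then have "delta v {#} \<noteq> 0" by (simp add: delta_def)
      then have "delta v \<noteq> 0" by (metis zero_fun_apply)
      then show ?thesis unfolding top by blast
    qed
  qed (rule nilp_module nilp_decomposition, assumption?)+
  moreover have "bij_betw delta UNIV (weight_space fscale nilp coact (int n))"
    unfolding top using inj by (rule inj_on_imp_bij_betw)
  ultimately show "dominant_in TYPE('j multiset \<Rightarrow> 'v) scaleV \<rho> n"
    unfolding dominant_in_def using linear_delta coact_h_delta by metis
qed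

end

theorem theoremB:
  fixes scale :: "'k::{alg_closed_field, field_char_0} \<Rightarrow> 'j::ab_group_add \<Rightarrow> 'j"
    and mult :: "'j \<Rightarrow> 'j \<Rightarrow> 'j"
    and one :: 'j
    and scaleV :: "'k \<Rightarrow> 'v::ab_group_add \<Rightarrow> 'v"
    and \<rho> :: "'j \<Rightarrow> 'v \<Rightarrow> 'v"
    and n :: nat
  assumes "jordan_algebra scale mult one"
    and "jordan_algebra.J_space_of_level scale mult one scaleV \<rho> n"
    and "\<exists>v :: 'v. v \<noteq> 0"
  shows "jordan_algebra.dominant scale mult one scaleV \<rho> n \<longleftrightarrow>
    (\<forall>a v. (\<Sum>\<sigma>\<in>partitions (n + 1).
       scaleV (of_int (sgn_part \<sigma>) * of_nat (card (conj_class \<sigma>)))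
         (jordan_algebra.rho_part mult one \<rho> \<sigma> a v)) = 0)"
proof -
  interpret J_rep scale mult one scaleV \<rho> n
    using assms(1,2) by (simp add: J_rep_def J_rep_axioms_def)
  show ?thesis
    unfolding sum_partitions_eq_0_iff
    using dominant_imp_elem_eq_0 elem_eq_0_imp_dominant assms(3) by auto
qed

end
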